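(* Let $\mathcal{T}$ be a triangulated category such that for all $X,Y\in\mathcal{T}$ the group $\operatorname{Hom}_{\mathcal{T}}(X,Y)$ is finitely generated as an $\operatorname{End}_{\mathcal{T}}(X)$-module and as an $\operatorname{End}_{\mathcal{T}}(Y)^{\mathrm{op}}$-module. Let $M$ and $N$ be silting objects of $\mathcal{T}$. Then $M$ has a right (respectively, left) adjacent t-structure if and only if $N$ has a right (respectively, left) adjacent t-structure.
   Context: All subcategories are full; $[1]$ is the shift functor. $\operatorname{add}M$ is the closure of $M$ under isomorphisms, finite direct sums and direct summands. An object $M$ is silting if $\operatorname{Hom}_{\mathcal{T}}(M,M[i])=0$ for all $i>0$ and the smallest triangulated subcategory of $\mathcal{T}$ containing $M$ and closed under direct summands is $\mathcal{T}$. Compositions are written so that $gf$ means first $f$ then $g$; modules are right modules, $\operatorname{End}_{\mathcal{T}}(X)$ and $\operatorname{End}_{\mathcal{T}}(Y)^{\mathrm{op}}$ acting on $\operatorname{Hom}_{\mathcal{T}}(X,Y)$ by composition. ${}^{\perp}\mathcal{S}=\{X\mid\operatorname{Hom}_{\mathcal{T}}(X,\mathcal{S})=0\}$, $\mathcal{S}^{\perp}=\{X\mid\operatorname{Hom}_{\mathcal{T}}(\mathcal{S},X)=0\}$; $M[<0]$ (resp. $M[>0]$) stands for all $M[i]$ with $i<0$ (resp. $i>0$). A t-structure on $\mathcal{T}$ is a pair $(\mathcal{T}^{\le0},\mathcal{T}^{\ge0})$ of subcategories such that, with $\mathcal{T}^{\ge1}=\mathcal{T}^{\ge0}[-1]$,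 one has $\mathcal{T}^{\ge1}\subset\mathcal{T}^{\ge0}$, $\mathcal{T}^{\le0}={}^{\perp}\mathcal{T}^{\ge1}$, $\mathcal{T}^{\ge1}=(\mathcal{T}^{\le0})^{\perp}$, and every $X\in\mathcal{T}$ fits in a triangle $X'\to X\to X''\to X'[1]$ with $X'\in\mathcal{T}^{\le0}$, $X''\in\mathcal{T}^{\ge1}$. A silting object $M$ has a right adjacent t-structure if $(M[<0]^{\perp},M[>0]^{\perp})$ is a t-structure on $\mathcal{T}$, and has a left adjacent t-structure if $({}^{\perp}M[<0],{}^{\perp}M[>0])$ is a t-structure on $\mathcal{T}$. *)

theory Defs
  imports "HOL-Algebra.Module"
begin

section \<open>Right modules over a not necessarily commutative ring\<close>

text \<open>
  The locale \<^locale>\<open>module\<close> of the library requires a commutative ring. The record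
  is reused here, but its scalar multiplication is read on the right: \<open>r \<odot> x\<close> stands
  for \<open>x \<cdot> r\<close>, which explains the order in \<open>smult_assoc\<close>.
\<close>

locale right_module = R?: ring R + M?: abelian_group M
  for R (structure) and M (structure) +
  assumes smult_closed: "\<lbrakk>r \<in> carrier R; x \<in> carrier M\<rbrakk> \<Longrightarrow> r \<odot>\<^bsub>M\<^esub> x \<in> carrier M"
    and smult_l_distr: "\<lbrakk>r \<in> carrier R; s \<in> carrier R; x \<in> carrier M\<rbrakk>
      \<Longrightarrow> (r \<oplus>\<^bsub>R\<^esub> s) \<odot>\<^bsub>M\<^esub> x = r \<odot>\<^bsub>M\<^esub> x \<oplus>\<^bsub>M\<^esub> s \<odot>\<^bsub>M\<^esub> x"
    and smult_r_distr: "\<lbrakk>r \<in> carrier R; x \<in> carrier M; y \<in> carrier M\<rbrakk>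
      \<Longrightarrow> r \<odot>\<^bsub>M\<^esub> (x \<oplus>\<^bsub>M\<^esub> y) = r \<odot>\<^bsub>M\<^esub> x \<oplus>\<^bsub>M\<^esub> r \<odot>\<^bsub>M\<^esub> y"
    and smult_assoc: "\<lbrakk>r \<in> carrier R; s \<in> carrier R; x \<in> carrier M\<rbrakk>
      \<Longrightarrow> (r \<otimes>\<^bsub>R\<^esub> s) \<odot>\<^bsub>M\<^esub> x = s \<odot>\<^bsub>M\<^esub> (r \<odot>\<^bsub>M\<^esub> x)"
    and smult_one: "x \<in> carrier M \<Longrightarrow> \<one>\<^bsub>R\<^esub> \<odot>\<^bsub>M\<^esub> x = x"

definition fg_right_module :: "('r, 'a) ring_scheme \<Rightarrow> ('r, 'x, 'b) module_scheme \<Rightarrow> bool" where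
  "fg_right_module R M \<longleftrightarrow> right_module R M \<and>
     (\<exists>F. finite F \<and> F \<subseteq> carrier M \<and>
       (\<forall>x\<in>carrier M. \<exists>c\<in>F \<rightarrow> carrier R. x = (\<Oplus>\<^bsub>M\<^esub>y\<in>F. c y \<odot>\<^bsub>M\<^esub> y)))"

definition opposite_ring :: "('r, 'a) ring_scheme \<Rightarrow> ('r, 'a) ring_scheme" where
  "opposite_ring R = R\<lparr>mult := \<lambda>r s. s \<otimes>\<^bsub>R\<^esub> r\<rparr>"


section \<open>Additive categories\<close>

text \<open>
  All data of a triangulated category. Arrows know their source and target, so that hom-sets
  are disjoint. The composite \<open>g \<cdot> f\<close> means first \<open>f\<close>, then \<open>g\<close>.
  A candidate triangle is given by its three arrows.
\<close>

record ('o, 'm) tricat =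
  Obj :: "'o set"
  Arr :: "'m set"
  Src :: "'m \<Rightarrow> 'o"
  Tgt :: "'m \<Rightarrow> 'o"
  Ident :: "'o \<Rightarrow> 'm"
  Comp :: "'m \<Rightarrow> 'm \<Rightarrow> 'm" (infixl "\<cdot>\<index>" 70)
  ZeroArr :: "'o \<Rightarrow> 'o \<Rightarrow> 'm"
  AddArr :: "'m \<Rightarrow> 'm \<Rightarrow> 'm"
  ShO :: "'o \<Rightarrow> 'o"
  ShA :: "'m \<Rightarrow> 'm"
  Tri :: "('m \<times> 'm \<times> 'm) set"

definition Hom :: "('o, 'm, 'z) tricat_scheme \<Rightarrow> 'o \<Rightarrow> 'o \<Rightarrow> 'm set" where
  "Hom T X Y = {f \<in> Arr T. Src T f = X \<and> Tgt T f = Y}"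

text \<open>
  The additive group \<open>Hom(X,Y)\<close>. For \<open>X = Y\<close> this is the endomorphism ring of \<open>X\<close>; for \<open>X \<noteq> Y\<close> only the additive part of
  the record is meaningful.
\<close>

definition hom_group :: "('o, 'm, 'z) tricat_scheme \<Rightarrow> 'o \<Rightarrow> 'o \<Rightarrow> 'm ring" where
  "hom_group T X Y = \<lparr>carrier = Hom T X Y, mult = Comp T, one = Ident T X,
     zero = ZeroArr T X Y, add = AddArr T\<rparr>"

abbreviation End :: "('o, 'm, 'z) tricat_scheme \<Rightarrow> 'o \<Rightarrow> 'm ring" where
  "End T X \<equiv> hom_group T X X"

text \<open>
  \<open>Hom(X,Y)\<close> as a right module over \<open>End(X)\<close>, with \<open>f\<cdot>a\<close> the composite of \<open>a\<close> followed by \<open>f\<close>,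
  and as a right module over the opposite ring of \<open>End(Y)\<close>. The fields \<open>mult\<close> and \<open>one\<close>
  play no role here, as for every \<^locale>\<open>module\<close> record of the library.
\<close>

definition hom_module_src :: "('o, 'm, 'z) tricat_scheme \<Rightarrow> 'o \<Rightarrow> 'o \<Rightarrow> ('m, 'm) module" where
  "hom_module_src T X Y = \<lparr>carrier = Hom T X Y, mult = Comp T, one = Ident T X,
     zero = ZeroArr T X Y, add = AddArr T, smult = \<lambda>a f. f \<cdot>\<^bsub>T\<^esub> a\<rparr>"

definition hom_module_tgt :: "('o, 'm, 'z) tricat_scheme \<Rightarrow> 'o \<Rightarrow> 'o \<Rightarrow> ('m, 'm) module" where
  "hom_module_tgt T X Y = \<lparr>carrier = Hom T X Y, mult = Comp T, one = Ident T X,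
     zero = ZeroArr T X Y, add = AddArr T, smult = \<lambda>b f. b \<cdot>\<^bsub>T\<^esub> f\<rparr>"

definition iso_arr :: "('o, 'm, 'z) tricat_scheme \<Rightarrow> 'o \<Rightarrow> 'o \<Rightarrow> 'm \<Rightarrow> bool" where
  "iso_arr T X Y f \<longleftrightarrow> f \<in> Hom T X Y \<and>
     (\<exists>g\<in>Hom T Y X. g \<cdot>\<^bsub>T\<^esub> f = Ident T X \<and> f \<cdot>\<^bsub>T\<^esub> g = Ident T Y)"

definition zero_object :: "('o, 'm, 'z) tricat_scheme \<Rightarrow> 'o \<Rightarrow> bool" where
  "zero_object T Z \<longleftrightarrow> Z \<in> Obj T \<and>
     (\<forall>X\<in>Obj T. (\<exists>!f. f \<in> Hom T X Z) \<and> (\<exists>!f. f \<in> Hom T Z X))"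

definition is_biproduct ::
  "('o, 'm, 'z) tricat_scheme \<Rightarrow> 'o \<Rightarrow> 'o \<Rightarrow> 'o \<Rightarrow> 'm \<Rightarrow> 'm \<Rightarrow> 'm \<Rightarrow> 'm \<Rightarrow> bool" where
  "is_biproduct T P X Y i j p q \<longleftrightarrow>
     P \<in> Obj T \<and> X \<in> Obj T \<and> Y \<in> Obj T \<and>
     i \<in> Hom T X P \<and> j \<in> Hom T Y P \<and> p \<in> Hom T P X \<and> q \<in> Hom T P Y \<and>
     p \<cdot>\<^bsub>T\<^esub> i = Ident T X \<and> q \<cdot>\<^bsub>T\<^esub> j = Ident T Y \<and>
     q \<cdot>\<^bsub>T\<^esub> i = ZeroArr T X Y \<and> p \<cdot>\<^bsub>T\<^esub> j = ZeroArr T Y X \<and>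
     AddArr T (i \<cdot>\<^bsub>T\<^esub> p) (j \<cdot>\<^bsub>T\<^esub> q) = Ident T P"

definition direct_summand :: "('o, 'm, 'z) tricat_scheme \<Rightarrow> 'o \<Rightarrow> 'o \<Rightarrow> bool" where
  "direct_summand T X P \<longleftrightarrow> (\<exists>Y i j p q. is_biproduct T P X Y i j p q)"

locale additive_category =
  fixes T :: "('o, 'm, 'z) tricat_scheme" (structure)
  assumes Src_closed: "f \<in> Arr T \<Longrightarrow> Src T f \<in> Obj T"
    and Tgt_closed: "f \<in> Arr T \<Longrightarrow> Tgt T f \<in> Obj T"
    and Ident_closed: "X \<in> Obj T \<Longrightarrow> Ident T X \<in> Hom T X X"
    and Comp_closed: "\<lbrakk>f \<in> Hom T X Y; g \<in> Hom T Y Z\<rbrakk> \<Longrightarrow> g \<cdot> f \<in> Hom T X Z"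
    and Comp_Ident: "f \<in> Hom T X Y \<Longrightarrow> f \<cdot> Ident T X = f"
    and Ident_Comp: "f \<in> Hom T X Y \<Longrightarrow> Ident T Y \<cdot> f = f"
    and Comp_assoc: "\<lbrakk>f \<in> Hom T W X; g \<in> Hom T X Y; h \<in> Hom T Y Z\<rbrakk>
      \<Longrightarrow> (h \<cdot> g) \<cdot> f = h \<cdot> (g \<cdot> f)"
    and hom_abelian_group: "\<lbrakk>X \<in> Obj T; Y \<in> Obj T\<rbrakk> \<Longrightarrow> abelian_group (hom_group T X Y)"
    and Comp_add_left: "\<lbrakk>f \<in> Hom T X Y; g \<in> Hom T Y Z; g' \<in> Hom T Y Z\<rbrakk>
      \<Longrightarrow> AddArr T g g' \<cdot> f = AddArr T (g \<cdot> f) (g' \<cdot> f)"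
    and Comp_add_right: "\<lbrakk>f \<in> Hom T X Y; f' \<in> Hom T X Y; g \<in> Hom T Y Z\<rbrakk>
      \<Longrightarrow> g \<cdot> AddArr T f f' = AddArr T (g \<cdot> f) (g \<cdot> f')"
    and ex_zero_object: "\<exists>Z. zero_object T Z"
    and ex_biproduct: "\<lbrakk>X \<in> Obj T; Y \<in> Obj T\<rbrakk> \<Longrightarrow> \<exists>P i j p q. is_biproduct T P X Y i j p q"


section \<open>Triangulated categories\<close>

definition triangle ::
  "('o, 'm, 'z) tricat_scheme \<Rightarrow> 'o \<Rightarrow> 'o \<Rightarrow> 'o \<Rightarrow> 'm \<Rightarrow> 'm \<Rightarrow> 'm \<Rightarrow> bool" where
  "triangle T X Y Z f g h \<longleftrightarrow> (f, g, h) \<in> Tri T \<and>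
     f \<in> Hom T X Y \<and> g \<in> Hom T Y Z \<and> h \<in> Hom T Z (ShO T X)"

text \<open>
  The shift is an additive automorphism of the category; \<open>TR4\<close> is the octahedral axiom.
\<close>

locale triangulated_category = additive_category T
  for T :: "('o, 'm, 'z) tricat_scheme" (structure) +
  assumes ShO_bij: "bij_betw (ShO T) (Obj T) (Obj T)"
    and ShA_bij: "bij_betw (ShA T) (Arr T) (Arr T)"
    and ShA_Hom: "f \<in> Hom T X Y \<Longrightarrow> ShA T f \<in> Hom T (ShO T X) (ShO T Y)"
    and ShA_Ident: "X \<in> Obj T \<Longrightarrow> ShA T (Ident T X) = Ident T (ShO T X)"
    and ShA_Comp: "\<lbrakk>f \<in> Hom T X Y; g \<in> Hom T Y Z\<rbrakk> \<Longrightarrow> ShA T (g \<cdot> f) = ShA T g \<cdot> ShA T f"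
    and ShA_add: "\<lbrakk>f \<in> Hom T X Y; f' \<in> Hom T X Y\<rbrakk>
      \<Longrightarrow> ShA T (AddArr T f f') = AddArr T (ShA T f) (ShA T f')"
    and Tri_typed: "(f, g, h) \<in> Tri T \<Longrightarrow> \<exists>X Y Z. triangle T X Y Z f g h"
    and TR1_iso: "\<lbrakk>triangle T X Y Z f g h; iso_arr T X X' a; iso_arr T Y Y' b; iso_arr T Z Z' c;
        f' \<in> Hom T X' Y'; g' \<in> Hom T Y' Z'; h' \<in> Hom T Z' (ShO T X');
        b \<cdot> f = f' \<cdot> a; c \<cdot> g = g' \<cdot> b; ShA T a \<cdot> h = h' \<cdot> c\<rbrakk>
      \<Longrightarrow> triangle T X' Y' Z' f' g' h'"
    and TR1_Ident: "\<lbrakk>X \<in> Obj T; zero_object T Z\<rbrakk>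
      \<Longrightarrow> triangle T X X Z (Ident T X) (ZeroArr T X Z) (ZeroArr T Z (ShO T X))"
    and TR1_cone: "f \<in> Hom T X Y \<Longrightarrow> \<exists>Z g h. triangle T X Y Z f g h"
    and TR2: "\<lbrakk>f \<in> Hom T X Y; g \<in> Hom T Y Z; h \<in> Hom T Z (ShO T X)\<rbrakk>
      \<Longrightarrow> triangle T X Y Z f g h \<longleftrightarrow>
        triangle T Y Z (ShO T X) g h (\<ominus>\<^bsub>hom_group T (ShO T X) (ShO T Y)\<^esub> ShA T f)"
    and TR3: "\<lbrakk>triangle T X Y Z f g h; triangle T X' Y' Z' f' g' h';
        a \<in> Hom T X X'; b \<in> Hom T Y Y'; b \<cdot> f = f' \<cdot> a\<rbrakk>
      \<Longrightarrow> \<exists>c\<in>Hom T Z Z'. c \<cdot> g = g' \<cdot> b \<and> ShA T a \<cdot> h = h' \<cdot> c"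
    and TR4: "\<lbrakk>triangle T X Y Z' f i i'; triangle T Y Z X' g j j';
        triangle T X Z Y' (g \<cdot> f) k k'\<rbrakk>
      \<Longrightarrow> \<exists>u v. triangle T Z' Y' X' u v (ShA T i \<cdot> j') \<and>
        u \<cdot> i = k \<cdot> g \<and> k' \<cdot> u = i' \<and> v \<cdot> k = j \<and> j' \<cdot> v = ShA T f \<cdot> k'"

definition shift :: "('o, 'm, 'z) tricat_scheme \<Rightarrow> int \<Rightarrow> 'o \<Rightarrow> 'o" where
  "shift T n X = (if 0 \<le> n then (ShO T ^^ nat n) X
     else (inv_into (Obj T) (ShO T) ^^ nat (- n)) X)"


section \<open>Silting objects and adjacent t-structures\<close>

text \<open>
  Full subcategories are represented by their sets of objects.
\<close>

definition triangulated_subcategory :: "('o, 'm, 'z) tricat_scheme \<Rightarrow> 'o set \<Rightarrow> bool" where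
  "triangulated_subcategory T S \<longleftrightarrow> S \<subseteq> Obj T \<and> S \<noteq> {} \<and>
     (\<forall>X\<in>S. \<forall>Y\<in>Obj T. \<forall>f. iso_arr T X Y f \<longrightarrow> Y \<in> S) \<and>
     (\<forall>X\<in>S. \<forall>n. shift T n X \<in> S) \<and>
     (\<forall>X Y Z f g h. triangle T X Y Z f g h \<longrightarrow> X \<in> S \<longrightarrow> Y \<in> S \<longrightarrow> Z \<in> S)"

definition thick_subcategory :: "('o, 'm, 'z) tricat_scheme \<Rightarrow> 'o set \<Rightarrow> bool" where
  "thick_subcategory T S \<longleftrightarrow> triangulated_subcategory T S \<and>
     (\<forall>Y\<in>S. \<forall>X. direct_summand T X Y \<longrightarrow> X \<in> S)"

definition thick_closure :: "('o, 'm, 'z) tricat_scheme \<Rightarrow> 'o \<Rightarrow> 'o set" where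
  "thick_closure T M = \<Inter>{S. thick_subcategory T S \<and> M \<in> S}"

definition silting :: "('o, 'm, 'z) tricat_scheme \<Rightarrow> 'o \<Rightarrow> bool" where
  "silting T M \<longleftrightarrow> M \<in> Obj T \<and>
     (\<forall>i>0. Hom T M (shift T i M) = {ZeroArr T M (shift T i M)}) \<and>
     thick_closure T M = Obj T"

definition left_perp :: "('o, 'm, 'z) tricat_scheme \<Rightarrow> 'o set \<Rightarrow> 'o set" where
  "left_perp T S = {X \<in> Obj T. \<forall>Y\<in>S. Hom T X Y = {ZeroArr T X Y}}"

definition right_perp :: "('o, 'm, 'z) tricat_scheme \<Rightarrow> 'o set \<Rightarrow> 'o set" where
  "right_perp T S = {X \<in> Obj T. \<forall>Y\<in>S. Hom T Y X = {ZeroArr T Y X}}"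

definition t_structure :: "('o, 'm, 'z) tricat_scheme \<Rightarrow> 'o set \<Rightarrow> 'o set \<Rightarrow> bool" where
  "t_structure T A B \<longleftrightarrow> A \<subseteq> Obj T \<and> B \<subseteq> Obj T \<and>
     (let B1 = shift T (- 1) ` B in
        B1 \<subseteq> B \<and> A = left_perp T B1 \<and> B1 = right_perp T A \<and>
        (\<forall>X\<in>Obj T. \<exists>X'\<in>A. \<exists>X''\<in>B1. \<exists>f g h. triangle T X' X X'' f g h))"

definition neg_shifts :: "('o, 'm, 'z) tricat_scheme \<Rightarrow> 'o \<Rightarrow> 'o set" where
  "neg_shifts T M = {shift T i M | i. i < 0}"

definition pos_shifts :: "('o, 'm, 'z) tricat_scheme \<Rightarrow> 'o \<Rightarrow> 'o set" where
  "pos_shifts T M = {shift T i M | i. i > 0}"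

definition has_right_adjacent_t_structure :: "('o, 'm, 'z) tricat_scheme \<Rightarrow> 'o \<Rightarrow> bool" where
  "has_right_adjacent_t_structure T M \<longleftrightarrow>
     t_structure T (right_perp T (neg_shifts T M)) (right_perp T (pos_shifts T M))"

definition has_left_adjacent_t_structure :: "('o, 'm, 'z) tricat_scheme \<Rightarrow> 'o \<Rightarrow> bool" where
  "has_left_adjacent_t_structure T M \<longleftrightarrow>
     t_structure T (left_perp T (neg_shifts T M)) (left_perp T (pos_shifts T M))"


section \<open>The module structures on hom-groups\<close>

context additive_category
begin

lemma hom_group_simps [simp]:
  "carrier (hom_group T X Y) = Hom T X Y" "mult (hom_group T X Y) = Comp T"
  "one (hom_group T X Y) = Ident T X" "zero (hom_group T X Y) = ZeroArr T X Y"
  "add (hom_group T X Y) = AddArr T"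
  by (simp_all add: hom_group_def)

lemma ring_End:
  assumes "X \<in> Obj T"
  shows "ring (End T X)"
proof (rule ringI)
  show "abelian_group (End T X)"
    using hom_abelian_group assms by blast
  show "monoid (End T X)"
    by (rule monoidI) (use assms in \<open>auto intro: Comp_closed Ident_closed Ident_Comp Comp_Ident Comp_assoc\<close>)
qed (auto intro: Comp_add_left Comp_add_right)

lemma ring_End_op:
  assumes "X \<in> Obj T"
  shows "ring (opposite_ring (End T X))"
proof (rule ringI)
  show "abelian_group (opposite_ring (End T X))"
    using hom_abelian_group[OF assms assms]
    unfolding opposite_ring_def abelian_group_def abelian_monoid_def abelian_group_axioms_def
    by simp
  show "monoid (opposite_ring (End T X))"
    by (rule monoidI) (use assms in \<open>auto simp: opposite_ring_def
      intro: Comp_closed Ident_closed Ident_Comp Comp_Ident Comp_assoc[symmetric]\<close>)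
qed (auto simp: opposite_ring_def intro: Comp_add_left Comp_add_right)

lemma right_module_hom_src:
  assumes "X \<in> Obj T" "Y \<in> Obj T"
  shows "right_module (End T X) (hom_module_src T X Y)"
proof -
  interpret A: abelian_group "hom_group T X Y"
    using hom_abelian_group[OF assms] .
  have neg: "\<exists>g\<in>Hom T X Y. AddArr T g f = ZeroArr T X Y" if "f \<in> Hom T X Y" for f
    using that A.l_neg A.a_inv_closed by auto
  have "abelian_group (hom_module_src T X Y)"
    by (rule abelian_groupI)
      (use A.a_closed A.zero_closed A.a_assoc A.a_comm A.l_zero neg
        in \<open>auto simp: hom_module_src_def\<close>)
  then show ?thesis
    using ring_End[OF assms(1)]
    by (auto simp: right_module_def right_module_axioms_def hom_module_src_def
        intro: Comp_closed Comp_Ident Comp_add_left Comp_add_right Comp_assoc[symmetric])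
qed

lemma right_module_hom_tgt:
  assumes "X \<in> Obj T" "Y \<in> Obj T"
  shows "right_module (opposite_ring (End T Y)) (hom_module_tgt T X Y)"
proof -
  interpret A: abelian_group "hom_group T X Y"
    using hom_abelian_group[OF assms] .
  have neg: "\<exists>g\<in>Hom T X Y. AddArr T g f = ZeroArr T X Y" if "f \<in> Hom T X Y" for f
    using that A.l_neg A.a_inv_closed by auto
  have "abelian_group (hom_module_tgt T X Y)"
    by (rule abelian_groupI)
      (use A.a_closed A.zero_closed A.a_assoc A.a_comm A.l_zero neg
        in \<open>auto simp: hom_module_tgt_def\<close>)
  then show ?thesis
    using ring_End_op[OF assms(2)]
    by (auto simp: right_module_def right_module_axioms_def hom_module_tgt_def
        opposite_ring_def
        intro: Comp_closed Ident_Comp Comp_add_left Comp_add_right Comp_assoc)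
qed

end

end

(*
  Write U(N) for the objects X with Hom(N, X[i]) = 0 for all i > 0. A silting object N has a right
  adjacent t-structure iff U(N) is coreflective. Since each silting object generates T,
  U(M)[a] is contained in U(N) and U(N)[b] in U(M) for some a, b. Approximations by sums of N split
  every object of U(N) as an extension of an object of U(N)[1] by a sum of copies of N; iterating
  until U(N)[a+b], which lies in the coreflective U(M)[a], shows that U(N) is precovering.

  A precovering suspended class is coreflective as soon as one idempotent e: V -> V splits, and T need
  not be idempotent complete. But the image of e exists in T up to a summand of V[n] for each n,
  and for n = a+b that summand is removed by the coreflection to U(M)[a].

  All axioms that this uses are self-dual, so the left case is the right case in the opposite category.
*)

theory Submission
  imports Defs
begin

section \<open>Additive categories\<close>

text \<open>The constants come from devissage: the objects Z with Hom(Z, U(M)[l]) = 0 for some l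
  form a thick subcategory containing M, hence exhaust T. Taking Z = N gives a; exchanging M and N
  gives b. The class C = U(M)[a] is coreflective and sandwiched between U(N)[a+b] and U(N). Finite
  generation enters only through the approximations: over End(X) it yields them in T, over the
  opposite of End(Y) in the opposite category. The spurious summand of V[n] is harmless only for
  targets X without maps from C. The coreflection of X to C is therefore split off beforehand and
  glued back by base change of its triangle. Base change yields only a weak pullback, so lifts to it
  are correct up to a difference that factors through the first term of the triangle and is added
  back. Coreflectivity suffices for a t-structure because the right orthogonal of U(N) can be tested
  on the objects N[n] with n >= 0, and an object of the left orthogonal of that class is a retract
  of its coreflection.\<close>

context additive_category
begin

lemma Hom_iff: "f \<in> Hom T X Y \<longleftrightarrow> f \<in> Arr T \<and> Src T f = X \<and> Tgt T f = Y"
  by (simp add: Hom_def)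

lemma Hom_Obj:
  assumes "f \<in> Hom T X Y"
  shows "X \<in> Obj T" "Y \<in> Obj T"
  using assms Src_closed Tgt_closed by (auto simp: Hom_iff)

text \<open>The source and target of the first argument select the hom-group, so that differences
  can be simplified without naming objects.\<close>

definition diff :: "'m \<Rightarrow> 'm \<Rightarrow> 'm" where
  "diff f g = f \<ominus>\<^bsub>hom_group T (Src T f) (Tgt T f)\<^esub> g"

lemma ZeroArr_closed: "\<lbrakk>X \<in> Obj T; Y \<in> Obj T\<rbrakk> \<Longrightarrow> ZeroArr T X Y \<in> Hom T X Y"
  using abelian_groupE(2)[OF hom_abelian_group] by simp

lemma AddArr_closed: "\<lbrakk>f \<in> Hom T X Y; g \<in> Hom T X Y\<rbrakk> \<Longrightarrow> AddArr T f g \<in> Hom T X Y"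
  using abelian_groupE(1)[OF hom_abelian_group] Hom_Obj by simp

lemma diff_closed:
  assumes "f \<in> Hom T X Y" "g \<in> Hom T X Y"
  shows "diff f g \<in> Hom T X Y"
proof -
  interpret A: abelian_group "hom_group T X Y" using hom_abelian_group Hom_Obj assms by blast
  show ?thesis using A.minus_closed assms by (auto simp: diff_def Hom_iff)
qed

lemma diff_zero: "f \<in> Hom T X Y \<Longrightarrow> diff f (ZeroArr T X Y) = f"
proof -
  assume f: "f \<in> Hom T X Y"
  interpret A: abelian_group "hom_group T X Y" using hom_abelian_group Hom_Obj f by blast
  have "f \<ominus>\<^bsub>hom_group T X Y\<^esub> ZeroArr T X Y = f"
    using f A.add.inv_one A.r_zero[of f] unfolding A.minus_eq a_inv_def by simp
  then show ?thesis using f by (auto simp: diff_def Hom_iff)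
qed

lemma diff_add:
  assumes "f \<in> Hom T X Y" "g \<in> Hom T X Y"
  shows "AddArr T (diff f g) g = f"
proof -
  interpret A: abelian_group "hom_group T X Y" using hom_abelian_group Hom_Obj assms by blast
  have "(f \<ominus>\<^bsub>hom_group T X Y\<^esub> g) \<oplus>\<^bsub>hom_group T X Y\<^esub> g = f"
    using assms A.a_assoc[of f "\<ominus>\<^bsub>hom_group T X Y\<^esub> g" g] A.l_neg[of g] A.a_inv_closed[of g] A.r_zero[of f] unfolding A.minus_eq by simp
  then show ?thesis using assms by (auto simp: diff_def Hom_iff)
qed

lemma diff_eq_zero_iff:
  assumes "f \<in> Hom T X Y" "g \<in> Hom T X Y"
  shows "diff f g = ZeroArr T X Y \<longleftrightarrow> f = g"
proof
  interpret A: abelian_group "hom_group T X Y" using hom_abelian_group Hom_Obj assms by blast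
  show "f = g" if "diff f g = ZeroArr T X Y"
    using that diff_add[OF assms] A.l_zero[of g] assms by simp
  show "diff f g = ZeroArr T X Y" if "f = g"
    using that A.r_neg[of g] assms by (auto simp: diff_def A.minus_eq Hom_iff)
qed

lemma add_right_cancel:
  assumes "f \<in> Hom T X Y" "g \<in> Hom T X Y" "h \<in> Hom T X Y" "AddArr T f h = AddArr T g h"
  shows "f = g"
proof -
  interpret A: abelian_group "hom_group T X Y" using hom_abelian_group Hom_Obj assms by blast
  show ?thesis using A.add.right_cancel[of h f g] assms by simp
qed

lemma Comp_diff_right:
  assumes "f \<in> Hom T X Y" "f' \<in> Hom T X Y" "g \<in> Hom T Y Z"
  shows "g \<cdot> diff f f' = diff (g \<cdot> f) (g \<cdot> f')"
proof (rule add_right_cancel)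
  have "g \<cdot> AddArr T (diff f f') f' = AddArr T (g \<cdot> diff f f') (g \<cdot> f')"
    using assms by (intro Comp_add_right diff_closed)
  then show "AddArr T (g \<cdot> diff f f') (g \<cdot> f') = AddArr T (diff (g \<cdot> f) (g \<cdot> f')) (g \<cdot> f')"
    using assms by (metis diff_add Comp_closed)
qed (use assms in \<open>auto intro: Comp_closed diff_closed\<close>)

lemma Comp_diff_left:
  assumes "f \<in> Hom T X Y" "g \<in> Hom T Y Z" "g' \<in> Hom T Y Z"
  shows "diff g g' \<cdot> f = diff (g \<cdot> f) (g' \<cdot> f)"
proof (rule add_right_cancel)
  have "AddArr T (diff g g') g' \<cdot> f = AddArr T (diff g g' \<cdot> f) (g' \<cdot> f)"
    using assms by (intro Comp_add_left diff_closed)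
  then show "AddArr T (diff g g' \<cdot> f) (g' \<cdot> f) = AddArr T (diff (g \<cdot> f) (g' \<cdot> f)) (g' \<cdot> f)"
    using assms by (metis diff_add Comp_closed)
qed (use assms in \<open>auto intro: Comp_closed diff_closed\<close>)

lemma Comp_diff_right_eq_zero_iff:
  assumes "f \<in> Hom T X Y" "f' \<in> Hom T X Y" "g \<in> Hom T Y Z"
  shows "g \<cdot> diff f f' = ZeroArr T X Z \<longleftrightarrow> g \<cdot> f = g \<cdot> f'"
  using diff_eq_zero_iff[OF Comp_closed[OF assms(1,3)] Comp_closed[OF assms(2,3)]]
    Comp_diff_right[OF assms] by simp

lemma Comp_diff_left_eq_zero_iff:
  assumes "f \<in> Hom T X Y" "g \<in> Hom T Y Z" "g' \<in> Hom T Y Z"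
  shows "diff g g' \<cdot> f = ZeroArr T X Z \<longleftrightarrow> g \<cdot> f = g' \<cdot> f"
  using diff_eq_zero_iff[OF Comp_closed[OF assms(1,2)] Comp_closed[OF assms(1,3)]]
    Comp_diff_left[OF assms] by simp

text \<open>In a group only zero equals its own double; this shows below that composition and shift
  preserve \<open>ZeroArr\<close>.\<close>

lemma add_idem_zero:
  assumes "f \<in> Hom T X Y" "AddArr T f f = f"
  shows "f = ZeroArr T X Y"
proof -
  interpret A: abelian_group "hom_group T X Y" using hom_abelian_group Hom_Obj assms by blast
  show ?thesis using A.add.l_cancel_one[of f f] assms by simp
qed

lemma Zero_add_Zero: "\<lbrakk>X \<in> Obj T; Y \<in> Obj T\<rbrakk> \<Longrightarrow> AddArr T (ZeroArr T X Y) (ZeroArr T X Y) = ZeroArr T X Y"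
  using abelian_groupE(5)[OF hom_abelian_group] ZeroArr_closed by simp

lemma Comp_Zero:
  assumes "g \<in> Hom T Y Z" "X \<in> Obj T"
  shows "g \<cdot> ZeroArr T X Y = ZeroArr T X Z"
proof (rule add_idem_zero)
  have "g \<cdot> AddArr T (ZeroArr T X Y) (ZeroArr T X Y) = AddArr T (g \<cdot> ZeroArr T X Y) (g \<cdot> ZeroArr T X Y)"
    using assms Hom_Obj[OF assms(1)] by (intro Comp_add_right[where X=X] ZeroArr_closed) (auto intro: ZeroArr_closed)
  then show "AddArr T (g \<cdot> ZeroArr T X Y) (g \<cdot> ZeroArr T X Y) = g \<cdot> ZeroArr T X Y"
    using assms Hom_Obj[OF assms(1)] by (simp add: Zero_add_Zero)
qed (use assms Hom_Obj(1)[OF assms(1)] Hom_Obj(2)[OF assms(1)] in \<open>blast intro: Comp_closed ZeroArr_closed\<close>)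

lemma Zero_Comp:
  assumes "f \<in> Hom T X Y" "Z \<in> Obj T"
  shows "ZeroArr T Y Z \<cdot> f = ZeroArr T X Z"
proof (rule add_idem_zero)
  have "AddArr T (ZeroArr T Y Z) (ZeroArr T Y Z) \<cdot> f = AddArr T (ZeroArr T Y Z \<cdot> f) (ZeroArr T Y Z \<cdot> f)"
    using assms Hom_Obj[OF assms(1)] by (intro Comp_add_left[where Z=Z] ZeroArr_closed) (auto intro: ZeroArr_closed)
  then show "AddArr T (ZeroArr T Y Z \<cdot> f) (ZeroArr T Y Z \<cdot> f) = ZeroArr T Y Z \<cdot> f"
    using assms Hom_Obj[OF assms(1)] by (simp add: Zero_add_Zero)
qed (use assms Hom_Obj(1)[OF assms(1)] Hom_Obj(2)[OF assms(1)] in \<open>blast intro: Comp_closed ZeroArr_closed\<close>)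

text \<open>Typing side conditions in terms of sources and targets can be discharged by the simplifier.\<close>

lemma Arr_Comp: "\<lbrakk>f \<in> Arr T; g \<in> Arr T; Src T g = Tgt T f\<rbrakk> \<Longrightarrow>
    g \<cdot> f \<in> Arr T \<and> Src T (g \<cdot> f) = Src T f \<and> Tgt T (g \<cdot> f) = Tgt T g"
  using Comp_closed[of f "Src T f" "Tgt T f" g "Tgt T g"] by (auto simp: Hom_iff)

lemma Arr_diff: "\<lbrakk>f \<in> Arr T; g \<in> Arr T; Src T g = Src T f; Tgt T g = Tgt T f\<rbrakk> \<Longrightarrow>
    diff f g \<in> Arr T \<and> Src T (diff f g) = Src T f \<and> Tgt T (diff f g) = Tgt T f"
  using diff_closed[of f "Src T f" "Tgt T f" g] by (auto simp: Hom_iff)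

lemma Arr_Ident: "X \<in> Obj T \<Longrightarrow> Ident T X \<in> Arr T \<and> Src T (Ident T X) = X \<and> Tgt T (Ident T X) = X"
  using Ident_closed by (auto simp: Hom_iff)

lemma Arr_Zero: "\<lbrakk>X \<in> Obj T; Y \<in> Obj T\<rbrakk> \<Longrightarrow> ZeroArr T X Y \<in> Arr T \<and> Src T (ZeroArr T X Y) = X \<and> Tgt T (ZeroArr T X Y) = Y"
  using ZeroArr_closed by (auto simp: Hom_iff)

lemma Arr_assoc: "\<lbrakk>f \<in> Arr T; g \<in> Arr T; h \<in> Arr T; Src T g = Tgt T f; Src T h = Tgt T g\<rbrakk> \<Longrightarrow>
    (h \<cdot> g) \<cdot> f = h \<cdot> (g \<cdot> f)"
  using Comp_assoc[of f "Src T f" "Tgt T f" g "Tgt T g" h "Tgt T h"] by (auto simp: Hom_iff)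

lemma Arr_Comp_diff: "\<lbrakk>f \<in> Arr T; f' \<in> Arr T; g \<in> Arr T; Src T f' = Src T f; Tgt T f' = Tgt T f; Src T g = Tgt T f\<rbrakk> \<Longrightarrow>
    g \<cdot> diff f f' = diff (g \<cdot> f) (g \<cdot> f')"
  using Comp_diff_right[of f "Src T f" "Tgt T f" f' g "Tgt T g"] by (auto simp: Hom_iff)

lemma Arr_diff_Comp: "\<lbrakk>f \<in> Arr T; g \<in> Arr T; g' \<in> Arr T; Src T g' = Src T g; Tgt T g' = Tgt T g; Src T g = Tgt T f\<rbrakk> \<Longrightarrow>
    diff g g' \<cdot> f = diff (g \<cdot> f) (g' \<cdot> f)"
  using Comp_diff_left[of f "Src T f" "Tgt T f" g "Tgt T g" g'] by (auto simp: Hom_iff)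

lemma Arr_Comp_Ident: "\<lbrakk>f \<in> Arr T; Src T f = X\<rbrakk> \<Longrightarrow> f \<cdot> Ident T X = f"
  using Comp_Ident by (auto simp: Hom_iff)

lemma Arr_Ident_Comp: "\<lbrakk>f \<in> Arr T; Tgt T f = X\<rbrakk> \<Longrightarrow> Ident T X \<cdot> f = f"
  using Ident_Comp by (auto simp: Hom_iff)

lemma Arr_Comp_Zero: "\<lbrakk>g \<in> Arr T; Src T g = Y; X \<in> Obj T\<rbrakk> \<Longrightarrow> g \<cdot> ZeroArr T X Y = ZeroArr T X (Tgt T g)"
  using Comp_Zero by (auto simp: Hom_iff)

lemma Arr_Zero_Comp: "\<lbrakk>f \<in> Arr T; Tgt T f = Y; Z \<in> Obj T\<rbrakk> \<Longrightarrow> ZeroArr T Y Z \<cdot> f = ZeroArr T (Src T f) Z"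
  using Zero_Comp by (auto simp: Hom_iff)

lemma Arr_diff_self: "f \<in> Arr T \<Longrightarrow> diff f f = ZeroArr T (Src T f) (Tgt T f)"
  using diff_eq_zero_iff[of f "Src T f" "Tgt T f" f] by (auto simp: Hom_iff)

lemma Arr_diff_zero: "\<lbrakk>f \<in> Arr T; Src T f = X; Tgt T f = Y\<rbrakk> \<Longrightarrow> diff f (ZeroArr T X Y) = f"
  using diff_zero by (auto simp: Hom_iff)

lemmas arr_simps = Hom_iff Arr_Comp Arr_diff Arr_Ident Arr_Zero Arr_assoc Arr_Comp_diff Arr_diff_Comp
  Arr_Comp_Ident Arr_Ident_Comp Arr_Comp_Zero Arr_Zero_Comp Arr_diff_self Arr_diff_zero

text \<open>Inclusion suffices: with both objects in \<open>Obj T\<close> it is the equality used in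
  \<open>left_perp\<close> and \<open>right_perp\<close>, by \<open>no_maps_iff\<close>.\<close>

definition no_maps :: "'o \<Rightarrow> 'o \<Rightarrow> bool" where
  "no_maps X Y \<longleftrightarrow> Hom T X Y \<subseteq> {ZeroArr T X Y}"

lemma no_mapsD: "\<lbrakk>no_maps X Y; f \<in> Hom T X Y\<rbrakk> \<Longrightarrow> f = ZeroArr T X Y"
  by (auto simp: no_maps_def)

lemma no_mapsI: "(\<And>f. f \<in> Hom T X Y \<Longrightarrow> f = ZeroArr T X Y) \<Longrightarrow> no_maps X Y"
  by (auto simp: no_maps_def)

lemma no_maps_iff: "\<lbrakk>X \<in> Obj T; Y \<in> Obj T\<rbrakk> \<Longrightarrow> no_maps X Y \<longleftrightarrow> Hom T X Y = {ZeroArr T X Y}"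
  using ZeroArr_closed by (auto simp: no_maps_def)

end

section \<open>Triangles\<close>

text \<open>The part of the structure that passes to the opposite category with the inverse shift.
  Bijectivity on arrows is stated for each hom-set separately.\<close>

locale shift_category = additive_category T
  for T :: "('o, 'm, 'z) tricat_scheme" (structure) +
  assumes ShO_bij: "bij_betw (ShO T) (Obj T) (Obj T)"
    and ShA_bij: "\<lbrakk>X \<in> Obj T; Y \<in> Obj T\<rbrakk> \<Longrightarrow> bij_betw (ShA T) (Hom T X Y) (Hom T (ShO T X) (ShO T Y))"
    and ShA_Comp: "\<lbrakk>f \<in> Hom T X Y; g \<in> Hom T Y Z\<rbrakk> \<Longrightarrow> ShA T (g \<cdot> f) = ShA T g \<cdot> ShA T f"
    and ShA_add: "\<lbrakk>f \<in> Hom T X Y; f' \<in> Hom T X Y\<rbrakk>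
      \<Longrightarrow> ShA T (AddArr T f f') = AddArr T (ShA T f) (ShA T f')"
begin

lemma ShO_closed: "X \<in> Obj T \<Longrightarrow> ShO T X \<in> Obj T"
  using ShO_bij by (auto simp: bij_betw_def)

lemma ShO_surj: "X \<in> Obj T \<Longrightarrow> \<exists>Y\<in>Obj T. X = ShO T Y"
  using ShO_bij by (auto simp: bij_betw_def)

lemma ShOn_closed: "X \<in> Obj T \<Longrightarrow> (ShO T ^^ n) X \<in> Obj T"
  by (induction n) (auto intro: ShO_closed)

lemma ShA_closed: "f \<in> Hom T X Y \<Longrightarrow> ShA T f \<in> Hom T (ShO T X) (ShO T Y)"
  using ShA_bij[of X Y] Hom_Obj by (auto simp: bij_betw_def)

lemma ShA_surj: "\<lbrakk>f \<in> Hom T (ShO T X) (ShO T Y); X \<in> Obj T; Y \<in> Obj T\<rbrakk> \<Longrightarrow> \<exists>g\<in>Hom T X Y. f = ShA T g"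
  using ShA_bij[of X Y] by (auto simp: bij_betw_def)

lemma ShA_inj: "\<lbrakk>ShA T f = ShA T g; f \<in> Hom T X Y; g \<in> Hom T X Y\<rbrakk> \<Longrightarrow> f = g"
  using ShA_bij[of X Y] Hom_Obj by (auto simp: bij_betw_def inj_on_def)

lemma ShA_Zero:
  assumes "X \<in> Obj T" "Y \<in> Obj T"
  shows "ShA T (ZeroArr T X Y) = ZeroArr T (ShO T X) (ShO T Y)"
proof (rule add_idem_zero)
  have Z: "ZeroArr T X Y \<in> Hom T X Y" using assms ZeroArr_closed by blast
  then show "ShA T (ZeroArr T X Y) \<in> Hom T (ShO T X) (ShO T Y)" by (rule ShA_closed)
  show "AddArr T (ShA T (ZeroArr T X Y)) (ShA T (ZeroArr T X Y)) = ShA T (ZeroArr T X Y)"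
    using ShA_add[OF Z Z] assms by (simp add: Zero_add_Zero)
qed

text \<open>By fullness the identity of the shifted object is the shift of some
  \<open>\<iota>\<close>; functoriality on composites identifies it with the shifted
  identity.\<close>

lemma ShA_Ident:
  assumes "X \<in> Obj T"
  shows "ShA T (Ident T X) = Ident T (ShO T X)"
proof -
  obtain \<iota> where \<iota>: "\<iota> \<in> Hom T X X" "Ident T (ShO T X) = ShA T \<iota>"
    using ShA_surj[OF Ident_closed[OF ShO_closed]] assms by blast
  have "ShA T (Ident T X) = ShA T \<iota> \<cdot> ShA T (Ident T X)"
    using \<iota> Ident_Comp[OF ShA_closed[OF Ident_closed[OF assms]]] by simp
  also have "\<dots> = ShA T \<iota>"
    using ShA_Comp[OF Ident_closed[OF assms] \<iota>(1)] Comp_Ident[OF \<iota>(1)] by simp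
  finally show ?thesis using \<iota> by simp
qed

lemma Arr_ShA: "f \<in> Arr T \<Longrightarrow> ShA T f \<in> Arr T \<and> Src T (ShA T f) = ShO T (Src T f) \<and> Tgt T (ShA T f) = ShO T (Tgt T f)"
  using ShA_closed[of f "Src T f" "Tgt T f"] by (auto simp: Hom_iff)

lemma no_maps_ShO:
  assumes "X \<in> Obj T" "Y \<in> Obj T"
  shows "no_maps (ShO T X) (ShO T Y) \<longleftrightarrow> no_maps X Y"
proof
  assume 0: "no_maps (ShO T X) (ShO T Y)"
  show "no_maps X Y"
  proof (rule no_mapsI)
    fix f assume f: "f \<in> Hom T X Y"
    then have "ShA T f = ShA T (ZeroArr T X Y)"
      using no_mapsD[OF 0 ShA_closed] assms by (simp add: ShA_Zero)
    then show "f = ZeroArr T X Y" using ShA_inj f ZeroArr_closed assms by blast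
  qed
next
  assume "no_maps X Y"
  then show "no_maps (ShO T X) (ShO T Y)"
    using ShA_surj assms ShA_Zero by (metis no_mapsI no_mapsD)
qed

lemma no_maps_ShOn:
  assumes "X \<in> Obj T" "Y \<in> Obj T"
  shows "no_maps ((ShO T ^^ n) X) ((ShO T ^^ n) Y) \<longleftrightarrow> no_maps X Y"
  by (induction n) (auto simp: no_maps_ShO ShOn_closed assms)

end

text \<open>
  \<open>D\<close> will be instantiated with the triangles up to the sign of their third arrow. Ignoring
  that sign makes the axioms self-dual; the octahedral axiom is not among them.
\<close>

locale pretriangulated = shift_category T
  for T :: "('o, 'm, 'z) tricat_scheme" (structure) +
  fixes D :: "'o \<Rightarrow> 'o \<Rightarrow> 'o \<Rightarrow> 'm \<Rightarrow> 'm \<Rightarrow> 'm \<Rightarrow> bool"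
  assumes D_typed: "D X Y Z f g h \<Longrightarrow> f \<in> Hom T X Y \<and> g \<in> Hom T Y Z \<and> h \<in> Hom T Z (ShO T X)"
    and D_cone: "f \<in> Hom T X Y \<Longrightarrow> \<exists>Z g h. D X Y Z f g h"
    and D_rot: "D X Y Z f g h \<Longrightarrow> D Y Z (ShO T X) g h (ShA T f)"
    and D_unrot: "\<lbrakk>D Y Z (ShO T X) g h (ShA T f); f \<in> Hom T X Y\<rbrakk> \<Longrightarrow> D X Y Z f g h"
    and D_comp: "D X Y Z f g h \<Longrightarrow> g \<cdot> f = ZeroArr T X Z"
    and D_lift: "\<lbrakk>D X Y Z f g h; u \<in> Hom T U Y; g \<cdot> u = ZeroArr T U Z\<rbrakk> \<Longrightarrow> \<exists>v\<in>Hom T U X. u = f \<cdot> v"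
    and D_extend: "\<lbrakk>D X Y Z f g h; u \<in> Hom T Y U; u \<cdot> f = ZeroArr T X U\<rbrakk> \<Longrightarrow> \<exists>v\<in>Hom T Z U. u = v \<cdot> g"
    and base_change: "\<lbrakk>D P X C p g k; c \<in> Hom T Q C\<rbrakk>
      \<Longrightarrow> \<exists>E i \<pi> y. D P E Q i \<pi> (k \<cdot> c) \<and> y \<in> Hom T E X \<and> y \<cdot> i = p \<and> g \<cdot> y = c \<cdot> \<pi>"
    and cobase_change: "\<lbrakk>D A C X f g h; c \<in> Hom T C Q\<rbrakk>
      \<Longrightarrow> \<exists>E \<pi> i y. D A Q E (c \<cdot> f) \<pi> i \<and> y \<in> Hom T X E \<and> y \<cdot> g = \<pi> \<cdot> c \<and> i \<cdot> y = h"
begin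

lemma D_Hom:
  assumes "D X Y Z f g h"
  shows "f \<in> Hom T X Y" "g \<in> Hom T Y Z" "h \<in> Hom T Z (ShO T X)"
  using D_typed[OF assms] by auto

lemma D_Obj:
  assumes "D X Y Z f g h"
  shows "X \<in> Obj T" "Y \<in> Obj T" "Z \<in> Obj T"
  using D_Hom[OF assms] Hom_Obj by blast+

lemma D_comp2: "D X Y Z f g h \<Longrightarrow> h \<cdot> g = ZeroArr T Y (ShO T X)"
  using D_comp D_rot by blast

lemma D_comp3: "D X Y Z f g h \<Longrightarrow> ShA T f \<cdot> h = ZeroArr T Z (ShO T Y)"
  using D_comp2 D_rot by blast

lemma D_lift2: "\<lbrakk>D X Y Z f g h; u \<in> Hom T U Z; h \<cdot> u = ZeroArr T U (ShO T X)\<rbrakk> \<Longrightarrow> \<exists>v\<in>Hom T U Y. u = g \<cdot> v"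
  using D_lift D_rot by blast

lemma D_lift3: "\<lbrakk>D X Y Z f g h; u \<in> Hom T U (ShO T X); ShA T f \<cdot> u = ZeroArr T U (ShO T Y)\<rbrakk>
    \<Longrightarrow> \<exists>v\<in>Hom T U Z. u = h \<cdot> v"
  using D_lift2 D_rot by blast

lemma D_extend2: "\<lbrakk>D X Y Z f g h; u \<in> Hom T Z U; u \<cdot> g = ZeroArr T Y U\<rbrakk> \<Longrightarrow> \<exists>v\<in>Hom T (ShO T X) U. u = v \<cdot> h"
  using D_extend D_rot by blast

lemma D_extend3: "\<lbrakk>D X Y Z f g h; u \<in> Hom T (ShO T X) U; u \<cdot> h = ZeroArr T Z U\<rbrakk>
    \<Longrightarrow> \<exists>v\<in>Hom T (ShO T Y) U. u = v \<cdot> ShA T f"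
  using D_extend2 D_rot by blast

lemma D_cocone:
  assumes "g \<in> Hom T Y Z"
  shows "\<exists>X f h. D X Y Z f g h"
proof -
  obtain W u v where D1: "D Y Z W g u v" using D_cone[OF assms] by blast
  obtain X where X: "X \<in> Obj T" "W = ShO T X" using ShO_surj D_Obj(3)[OF D1] by blast
  obtain f where "f \<in> Hom T X Y" "v = ShA T f"
    using ShA_surj[of v X Y] X D_Hom(3)[OF D1] Hom_Obj[OF assms] by auto
  then show ?thesis using D_unrot D1 X by blast
qed

text \<open>\<open>h\<close> is read as an extension class; its cocone is the middle object.\<close>

lemma D_extension:
  assumes "h \<in> Hom T Z (ShO T X)" "X \<in> Obj T"
  shows "\<exists>Y f g. D X Y Z f g h"
proof -
  obtain Y g v where D1: "D Y Z (ShO T X) g h v" using D_cocone[OF assms(1)] by blast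
  obtain f where "f \<in> Hom T X Y" "v = ShA T f"
    using ShA_surj[of v X Y] assms D_Hom(3)[OF D1] D_Obj[OF D1] by auto
  then show ?thesis using D_unrot D1 by blast
qed

definition ext_closed :: "'o set \<Rightarrow> bool" where
  "ext_closed A \<longleftrightarrow> (\<forall>X Y Z f g h. D X Y Z f g h \<longrightarrow> X \<in> A \<longrightarrow> Z \<in> A \<longrightarrow> Y \<in> A)"

text \<open>Encoded by the truncation triangle instead of an adjoint functor;
  \<open>corepr_cone\<close> recovers the triangle from representability.\<close>

definition coreflective :: "'o set \<Rightarrow> bool" where
  "coreflective A \<longleftrightarrow> (\<forall>X\<in>Obj T. \<exists>A'\<in>A. \<exists>B f g h. D A' X B f g h \<and> (\<forall>A''\<in>A. no_maps A'' B))"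

text \<open>Two classes are kept apart: the precovering objects stay in \<open>A\<close>, while the
  class \<open>S\<close> on which lifting is tested can be enlarged step by step until it is
  \<open>A\<close>.\<close>

definition precovers :: "'o set \<Rightarrow> 'o set \<Rightarrow> bool" where
  "precovers A S \<longleftrightarrow> (\<forall>X\<in>Obj T. \<exists>A'\<in>A. \<exists>f\<in>Hom T A' X. \<forall>U\<in>S. \<forall>u\<in>Hom T U X. \<exists>v\<in>Hom T U A'. u = f \<cdot> v)"

text \<open>\<open>f\<close> is the counit at \<open>X\<close> of a would-be right adjoint to the
  inclusion of \<open>A\<close>.\<close>

definition corepr :: "'o set \<Rightarrow> 'o \<Rightarrow> 'o \<Rightarrow> 'm \<Rightarrow> bool" where
  "corepr A W X f \<longleftrightarrow> W \<in> A \<and> f \<in> Hom T W X \<and>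
    (\<forall>U\<in>A. bij_betw (\<lambda>v. f \<cdot> v) (Hom T U W) (Hom T U X))"

lemma coreprI:
  assumes "W \<in> A" "f \<in> Hom T W X" "A \<subseteq> Obj T"
    and surj: "\<And>U u. \<lbrakk>U \<in> A; u \<in> Hom T U X\<rbrakk> \<Longrightarrow> \<exists>v\<in>Hom T U W. u = f \<cdot> v"
    and inj: "\<And>U v. \<lbrakk>U \<in> A; v \<in> Hom T U W; f \<cdot> v = ZeroArr T U X\<rbrakk> \<Longrightarrow> v = ZeroArr T U W"
  shows "corepr A W X f"
  unfolding corepr_def bij_betw_def
proof (intro conjI ballI)
  show "W \<in> A" "f \<in> Hom T W X" using assms by auto
next
  fix U assume U: "U \<in> A"
  show "(\<lambda>v. f \<cdot> v) ` Hom T U W = Hom T U X"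
  proof
    show "(\<lambda>v. f \<cdot> v) ` Hom T U W \<subseteq> Hom T U X" by (rule image_subsetI) (rule Comp_closed[OF _ assms(2)])
    show "Hom T U X \<subseteq> (\<lambda>v. f \<cdot> v) ` Hom T U W"
    proof
      fix u assume "u \<in> Hom T U X"
      then obtain v where "v \<in> Hom T U W" "u = f \<cdot> v" using surj[OF U] by blast
      then show "u \<in> (\<lambda>v. f \<cdot> v) ` Hom T U W" by (rule rev_image_eqI)
    qed
  qed
  show "inj_on (\<lambda>v. f \<cdot> v) (Hom T U W)"
  proof (rule inj_onI)
    fix v v' assume v: "v \<in> Hom T U W" "v' \<in> Hom T U W" "f \<cdot> v = f \<cdot> v'"
    then have "f \<cdot> diff v v' = ZeroArr T U X"
      using Comp_diff_right_eq_zero_iff[OF v(1,2) assms(2)] by simp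
    then have "diff v v' = ZeroArr T U W" by (rule inj[OF U diff_closed[OF v(1,2)]])
    then show "v = v'" using diff_eq_zero_iff[OF v(1,2)] by simp
  qed
qed

lemma corepr_surj: "\<lbrakk>corepr A W X f; U \<in> A; u \<in> Hom T U X\<rbrakk> \<Longrightarrow> \<exists>v\<in>Hom T U W. u = f \<cdot> v"
  by (force simp: corepr_def bij_betw_def)

lemma corepr_inj: "\<lbrakk>corepr A W X f; U \<in> A; v \<in> Hom T U W; v' \<in> Hom T U W; f \<cdot> v = f \<cdot> v'\<rbrakk> \<Longrightarrow> v = v'"
  by (auto simp: corepr_def bij_betw_def inj_on_def)

text \<open>An argument in the style of Wakamatsu's lemma. The composite \<open>\<delta>\<close> of
  \<open>u\<close> with the connecting map classifies an extension of \<open>U\<close> by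
  \<open>W\<close> inside \<open>A\<close>. As \<open>f\<close> extends over it, uniqueness of lifts
  through \<open>f\<close> splits the extension; so \<open>\<delta>\<close> vanishes and
  \<open>u\<close> comes from \<open>X\<close>, hence from \<open>W\<close>.\<close>

lemma corepr_cone:
  assumes A: "ext_closed A" and W: "corepr A W X f" and tri: "D W X B f g h" and U: "U \<in> A" "U \<in> Obj T"
  shows "no_maps U B"
proof (rule no_mapsI)
  fix u assume u: "u \<in> Hom T U B"
  note t = D_Hom[OF tri] and o = D_Obj[OF tri]
  define \<delta> where "\<delta> = h \<cdot> u"
  have \<delta>: "\<delta> \<in> Hom T U (ShO T W)" using u t Comp_closed by (auto simp: \<delta>_def)
  obtain E i \<pi> where E: "D W E U i \<pi> \<delta>" using D_extension[OF \<delta> o(1)] by blast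
  have EA: "E \<in> A" using A E U W unfolding ext_closed_def corepr_def by blast
  have "ShA T f \<cdot> \<delta> = ZeroArr T U (ShO T X)"
    using D_comp3[OF tri] u t o U Zero_Comp ShO_closed by (simp add: \<delta>_def Comp_assoc[OF u t(3) ShA_closed[OF t(1)], symmetric])
  from D_extend3[OF E ShA_closed[OF t(1)] this]
  obtain \<epsilon>' where \<epsilon>': "\<epsilon>' \<in> Hom T (ShO T E) (ShO T X)" "ShA T f = \<epsilon>' \<cdot> ShA T i" by blast
  obtain \<epsilon> where \<epsilon>: "\<epsilon> \<in> Hom T E X" "\<epsilon>' = ShA T \<epsilon>" using ShA_surj \<epsilon>' o D_Obj[OF E] by blast
  have i: "i \<in> Hom T W E" using D_Hom[OF E] by auto
  have fi: "f = \<epsilon> \<cdot> i" using \<epsilon> \<epsilon>' i t ShA_Comp ShA_inj Comp_closed by metis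
  obtain r where r: "r \<in> Hom T E W" "\<epsilon> = f \<cdot> r" using corepr_surj[OF W EA \<epsilon>(1)] by blast
  have "f \<cdot> (r \<cdot> i) = f \<cdot> Ident T W"
    using fi r i t Comp_Ident by (simp add: Comp_assoc[OF i r(1) t(1), symmetric])
  then have ri: "r \<cdot> i = Ident T W"
    using corepr_inj[OF W _ Comp_closed[OF i r(1)] Ident_closed] W o by (auto simp: corepr_def)
  have "\<delta> = ZeroArr T U (ShO T W)"
  proof -
    have "ShA T r \<cdot> (ShA T i \<cdot> \<delta>) = ShA T r \<cdot> ZeroArr T U (ShO T E)" using D_comp3[OF E] by simp
    also have "\<dots> = ZeroArr T U (ShO T W)" using Comp_Zero ShA_closed[OF r(1)] U by blast
    finally have 1: "ShA T (r \<cdot> i) \<cdot> \<delta> = ZeroArr T U (ShO T W)"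
      using Comp_assoc[OF \<delta> ShA_closed[OF i] ShA_closed[OF r(1)]] ShA_Comp[OF i r(1)] by simp
    then show ?thesis using ri ShA_Ident o Ident_Comp[OF \<delta>] by simp
  qed
  then obtain v where v: "v \<in> Hom T U X" "u = g \<cdot> v" using D_lift2[OF tri u] \<delta>_def by auto
  obtain w where w: "w \<in> Hom T U W" "v = f \<cdot> w" using corepr_surj[OF W U(1) v(1)] by blast
  show "u = ZeroArr T U B"
    using v w D_comp[OF tri] Zero_Comp[OF w(1)] o Comp_assoc[OF w(1) t(1,2)] by simp
qed

section \<open>Precovering suspended classes\<close>

definition suspended :: "'o set \<Rightarrow> bool" where
  "suspended A \<longleftrightarrow> A \<subseteq> Obj T \<and> ext_closed A \<and> (\<forall>X\<in>A. ShO T X \<in> A)"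

lemma suspended_ext: "\<lbrakk>suspended A; D X Y Z f g h; X \<in> A; Z \<in> A\<rbrakk> \<Longrightarrow> Y \<in> A"
  unfolding suspended_def ext_closed_def by blast

lemma suspended_cone: "\<lbrakk>suspended A; D X Y Z f g h; X \<in> A; Y \<in> A\<rbrakk> \<Longrightarrow> Z \<in> A"
  using suspended_ext D_rot unfolding suspended_def by blast

lemma suspended_ShOn: "\<lbrakk>suspended A; X \<in> A\<rbrakk> \<Longrightarrow> (ShO T ^^ n) X \<in> A"
  by (induction n) (auto simp: suspended_def)

text \<open>
  In the idempotent completion of \<^term>\<open>T\<close> the object \<open>V'\<close> below is the direct sum of the image of \<open>e\<close>
  and a summand of the \<open>n\<close>-fold shift of \<open>V\<close>. Taking the cone of \<open>m\<close> moves the second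
  summand up by one degree.
\<close>

lemma idempotent_telescope:
  assumes A: "suspended A" and V: "V \<in> A" and e: "e \<in> Hom T V V" "e \<cdot> e = e"
  shows "\<exists>V' a b m d. V' \<in> A \<and> a \<in> Hom T V V' \<and> b \<in> Hom T V' V \<and>
    m \<in> Hom T ((ShO T ^^ n) V) V' \<and> d \<in> Hom T V' ((ShO T ^^ n) V) \<and>
    b \<cdot> a = e \<and> e \<cdot> b = b \<and> b \<cdot> m = ZeroArr T ((ShO T ^^ n) V) V \<and>
    m \<cdot> d = diff (Ident T V') (a \<cdot> b)"
proof (induction n)
  case 0
  have VO: "V \<in> Obj T" using A V by (auto simp: suspended_def)
  have "e \<cdot> diff (Ident T V) e = ZeroArr T V V"
    "diff (Ident T V) e \<cdot> diff (Ident T V) e = diff (Ident T V) (e \<cdot> e)"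
    using e VO by (auto simp: arr_simps)
  \<comment> \<open>Both maps between \<open>V\<close> and \<open>V'\<close> are \<open>e\<close>,
    while \<open>m\<close> and \<open>d\<close> are the complementary idempotent.\<close>
  then show ?case
    using e V diff_closed[OF Ident_closed[OF VO] e(1)]
    by (intro exI[of _ V] exI[of _ e] exI[of _ "diff (Ident T V) e"]) auto
next
  case (Suc n)
  let ?S = "(ShO T ^^ n) V"
  obtain V' a b m d where V': "V' \<in> A" and a: "a \<in> Hom T V V'" and b: "b \<in> Hom T V' V"
    and m: "m \<in> Hom T ?S V'" and d: "d \<in> Hom T V' ?S" and ba: "b \<cdot> a = e" and eb: "e \<cdot> b = b"
    and bm: "b \<cdot> m = ZeroArr T ?S V" and md: "m \<cdot> d = diff (Ident T V') (a \<cdot> b)"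
    using Suc.IH by blast
  \<comment> \<open>In the idempotent completion \<open>m\<close> projects onto the complement of
    the image of \<open>e\<close>, so its cone carries the shifted kernel of \<open>m\<close> in
    place of that complement.\<close>
  obtain W c w where tri: "D ?S V' W m c w" using D_cone[OF m] by blast
  note t = D_Hom[OF tri] and o = D_Obj[OF tri]
  have VO: "V \<in> Obj T" using A V by (auto simp: suspended_def)
  have S: "ShO T ?S \<in> Obj T" using o ShO_closed by blast
  have W: "W \<in> A" using suspended_cone[OF A tri suspended_ShOn[OF A V] V'] .
  obtain b'' where b'': "b'' \<in> Hom T W V" "b = b'' \<cdot> c" using D_extend[OF tri b bm] by blast
  \<comment> \<open>Composing with \<open>e\<close> enforces the invariant
    \<open>e \<cdot> b' = b'\<close>, which an arbitrary extension of \<open>b\<close> may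
    violate.\<close>
  define b' where "b' = e \<cdot> b''"
  define a' where "a' = c \<cdot> a"
  have b': "b' \<in> Hom T W V" using e(1) b'' by (auto simp: b'_def intro: Comp_closed)
  have a': "a' \<in> Hom T V W" using a t by (auto simp: a'_def intro: Comp_closed)
  have b'c: "b' \<cdot> c = b" using eb b'' e t by (simp add: b'_def arr_simps)
  have eb': "e \<cdot> b' = b'"
    using Comp_assoc[OF b''(1) e(1) e(1)] e(2) by (simp add: b'_def)
  have b'a': "b' \<cdot> a' = e"
    using Comp_assoc[OF a t(2) b'] b'c ba by (simp add: a'_def)
  define r where "r = diff (Ident T W) (a' \<cdot> b')"
  have r: "r \<in> Hom T W W" using a' b' o by (auto simp: r_def intro!: diff_closed Ident_closed Comp_closed)
  have "r \<cdot> c = ZeroArr T V' W"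
  proof -
    have "r \<cdot> c = diff c (a' \<cdot> (b' \<cdot> c))" using a' b' t o by (simp add: r_def arr_simps)
    also have "\<dots> = c \<cdot> diff (Ident T V') (a \<cdot> b)" using a b t o unfolding b'c by (simp add: a'_def arr_simps)
    also have "\<dots> = (c \<cdot> m) \<cdot> d" using Comp_assoc[OF d m t(2)] md by simp
    finally show ?thesis using D_comp[OF tri] Zero_Comp[OF d] o by simp
  qed
  then obtain m0 where m0: "m0 \<in> Hom T (ShO T ?S) W" "r = m0 \<cdot> w" using D_extend2[OF tri r] by blast
  have b'r: "b' \<cdot> r = ZeroArr T W V"
  proof -
    have "b' \<cdot> r = diff b' ((b' \<cdot> a') \<cdot> b')" using a' b' o by (simp add: r_def arr_simps)
    then show ?thesis using b'a' eb' b' by (simp add: diff_eq_zero_iff)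
  qed
  have b'm0: "b' \<cdot> m0 \<in> Hom T (ShO T ?S) V" using Comp_closed m0(1) b' by blast
  have "(b' \<cdot> m0) \<cdot> w = ZeroArr T W V" using b'r m0 Comp_assoc[OF t(3) m0(1) b'] by simp
  then obtain y where y: "y \<in> Hom T (ShO T V') V" "b' \<cdot> m0 = y \<cdot> ShA T m"
    using D_extend3[OF tri b'm0] by blast
  have Sm: "ShA T m \<in> Hom T (ShO T ?S) (ShO T V')" using ShA_closed[OF m] .
  \<comment> \<open>\<open>m0\<close> need not be killed by \<open>b'\<close>. The correction
    factors through \<open>ShA T m\<close>, so it vanishes after precomposition with
    \<open>w\<close> and keeps the factorisation of \<open>r\<close>.\<close>
  define m' where "m' = diff m0 (a' \<cdot> (y \<cdot> ShA T m))"
  have m': "m' \<in> Hom T (ShO T ?S) W"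
    using m0 a' y Sm by (auto simp: m'_def intro!: diff_closed Comp_closed)
  have "m' \<cdot> w = diff (m0 \<cdot> w) (a' \<cdot> (y \<cdot> (ShA T m \<cdot> w)))"
    using m0 a' y(1) Sm t by (simp add: m'_def arr_simps)
  also have "\<dots> = r"
    unfolding D_comp3[OF tri] using m0 a' y(1) r o VO by (simp add: arr_simps)
  finally have m'w: "m' \<cdot> w = diff (Ident T W) (a' \<cdot> b')" by (simp add: r_def)
  have "b' \<cdot> m' = diff (b' \<cdot> m0) ((b' \<cdot> a') \<cdot> (y \<cdot> ShA T m))"
    using m0 a' b' y(1) Sm by (simp add: m'_def arr_simps)
  also have "\<dots> = diff (b' \<cdot> m0) ((e \<cdot> b') \<cdot> m0)"
    using Comp_assoc[OF m0(1) b' e(1)] by (simp add: b'a' y(2))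
  also have "\<dots> = ZeroArr T (ShO T ?S) V" using eb' b'm0 by (simp add: diff_eq_zero_iff)
  finally have "b' \<cdot> m' = ZeroArr T (ShO T ?S) V" .
  then show ?case using W a' b' m' m'w t(3) b'a' eb'
    by (intro exI[of _ W] exI[of _ a'] exI[of _ b'] exI[of _ m'] exI[of _ w]) simp
qed

text \<open>
  With a precover \<open>f: U0 \<rightarrow> X\<close> and a precover \<open>U1\<close> of its fibre, the cone \<open>V\<close> of \<open>U1 \<rightarrow> U0\<close> maps to \<open>X\<close>, and
  lifting \<open>V \<rightarrow> X\<close> through \<open>f\<close> yields an idempotent \<open>e\<close> on \<open>V\<close> whose image would represent
  \<open>Hom(-, X)\<close> on \<open>A\<close>. The reflection of the telescope of \<open>e\<close> away from \<open>C\<close> replaces this image.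
\<close>

lemma corepr_right_perp:
  assumes A: "suspended A" and pre: "precovers A A" and C: "coreflective C" "C \<subseteq> A"
    and sh: "\<And>V. V \<in> A \<Longrightarrow> (ShO T ^^ n) V \<in> C" and ShC: "\<And>X. X \<in> C \<Longrightarrow> ShO T X \<in> C"
    and X: "X \<in> Obj T" "\<And>U. U \<in> C \<Longrightarrow> no_maps U X"
  shows "\<exists>W f. corepr A W X f"
proof -
  have AO: "A \<subseteq> Obj T" using A by (simp add: suspended_def)
  obtain U0 f where U0: "U0 \<in> A" "f \<in> Hom T U0 X"
    and f: "\<And>U u. \<lbrakk>U \<in> A; u \<in> Hom T U X\<rbrakk> \<Longrightarrow> \<exists>v\<in>Hom T U U0. u = f \<cdot> v"
    using pre X unfolding precovers_def by meson
  obtain K \<kappa> \<zeta> where K: "D K U0 X \<kappa> f \<zeta>" using D_cocone[OF U0(2)] by blast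
  obtain U1 u1 where U1: "U1 \<in> A" "u1 \<in> Hom T U1 K"
    and u1: "\<And>U u. \<lbrakk>U \<in> A; u \<in> Hom T U K\<rbrakk> \<Longrightarrow> \<exists>v\<in>Hom T U U1. u = u1 \<cdot> v"
    using pre D_Obj(1)[OF K] unfolding precovers_def by meson
  have \<kappa>: "\<kappa> \<in> Hom T K U0" using D_Hom[OF K] by blast
  have \<kappa>u1: "\<kappa> \<cdot> u1 \<in> Hom T U1 U0" using Comp_closed[OF U1(2) \<kappa>] .
  obtain V p \<omega> where V: "D U1 U0 V (\<kappa> \<cdot> u1) p \<omega>" using D_cone[OF \<kappa>u1] by blast
  have VA: "V \<in> A" using suspended_cone[OF A V U1(1) U0(1)] .
  have p: "p \<in> Hom T U0 V" using D_Hom[OF V] by blast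
  have O: "U0 \<in> Obj T" "U1 \<in> Obj T" "V \<in> Obj T" "K \<in> Obj T" using D_Obj[OF V] D_Obj[OF K] by auto
  have "f \<cdot> (\<kappa> \<cdot> u1) = ZeroArr T U1 X"
    using D_comp[OF K] Zero_Comp[OF U1(2)] X Comp_assoc[OF U1(2) \<kappa> U0(2)] by simp
  then obtain h where h: "h \<in> Hom T V X" "f = h \<cdot> p" using D_extend[OF V U0(2)] by blast
  \<comment> \<open>Two maps from \<open>A\<close> with the same composite with \<open>f\<close>
    differ by a map from the fibre \<open>K\<close>, hence by one from \<open>U1\<close>, which
    \<open>p\<close> kills.\<close>
  have kill: "p \<cdot> x = p \<cdot> x'"
    if U: "U \<in> A" and x: "x \<in> Hom T U U0" "x' \<in> Hom T U U0" "f \<cdot> x = f \<cdot> x'" for U x x'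
  proof -
    have "f \<cdot> diff x x' = ZeroArr T U X"
      using Comp_diff_right_eq_zero_iff[OF x(1,2) U0(2)] x(3) by simp
    then obtain z where z: "z \<in> Hom T U K" "diff x x' = \<kappa> \<cdot> z"
      using D_lift[OF K diff_closed[OF x(1,2)]] by blast
    obtain z' where z': "z' \<in> Hom T U U1" "z = u1 \<cdot> z'" using u1[OF U z(1)] by blast
    have "p \<cdot> diff x x' = (p \<cdot> (\<kappa> \<cdot> u1)) \<cdot> z'"
      using z z' \<kappa> U1(2) p by (simp add: arr_simps)
    also have "\<dots> = ZeroArr T U V" using D_comp[OF V] Zero_Comp[OF z'(1)] O by simp
    finally show ?thesis
      using Comp_diff_right_eq_zero_iff[OF x(1,2) p] by simp
  qed
  obtain e' where e': "e' \<in> Hom T V U0" "h = f \<cdot> e'" using f[OF VA h(1)] by blast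
  have pe'p: "p \<cdot> (e' \<cdot> p) = p"
  proof -
    have "f \<cdot> (e' \<cdot> p) = f \<cdot> Ident T U0"
      using Comp_Ident[OF U0(2)] Comp_assoc[OF p e'(1) U0(2)] by (simp flip: h(2) e'(2))
    from kill[OF U0(1) Comp_closed[OF p e'(1)] Ident_closed[OF O(1)] this]
    show ?thesis using Comp_Ident[OF p] by simp
  qed
  define e where "e = p \<cdot> e'"
  have e: "e \<in> Hom T V V" using Comp_closed[OF e'(1) p] by (simp add: e_def)
  have ee: "e \<cdot> e = e"
  proof -
    have "e \<cdot> e = (p \<cdot> (e' \<cdot> p)) \<cdot> e'" using p e'(1) by (simp add: e_def arr_simps)
    then show ?thesis by (simp add: pe'p e_def)
  qed
  \<comment> \<open>This \<open>n\<close> is the degree in which \<open>sh\<close> places the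
    unwanted summand in \<open>C\<close>.\<close>
  obtain V' a b m d where V': "V' \<in> A" and a: "a \<in> Hom T V V'" and b: "b \<in> Hom T V' V"
    and m: "m \<in> Hom T ((ShO T ^^ n) V) V'" and d: "d \<in> Hom T V' ((ShO T ^^ n) V)"
    and ba: "b \<cdot> a = e" and eb: "e \<cdot> b = b" and md: "m \<cdot> d = diff (Ident T V') (a \<cdot> b)"
    using idempotent_telescope[OF A VA e ee, of n] by blast
  obtain C0 W c0 q \<omega>' where C0: "C0 \<in> C" and W: "D C0 V' W c0 q \<omega>'" and CW: "\<And>U. U \<in> C \<Longrightarrow> no_maps U W"
    using C(1) V' AO unfolding coreflective_def by (meson subsetD)
  note t = D_Hom[OF W]
  have WA: "W \<in> A" using suspended_cone[OF A W _ V'] C0 C(2) by blast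
  have WO: "W \<in> Obj T" "V' \<in> Obj T" "C0 \<in> Obj T" using D_Obj[OF W] by auto
  have hb: "h \<cdot> b \<in> Hom T V' X" using Comp_closed[OF b h(1)] .
  have "(h \<cdot> b) \<cdot> c0 = ZeroArr T C0 X"
    using no_mapsD[OF X(2)[OF C0]] Comp_closed[OF t(1) hb] by simp
  then obtain g where g: "g \<in> Hom T W X" "h \<cdot> b = g \<cdot> q" using D_extend[OF W hb] by blast
  obtain s where s: "s \<in> Hom T W U0" "g = f \<cdot> s" using f[OF WA g(1)] by blast
  have psq: "p \<cdot> (s \<cdot> q) = b"
  proof -
    have "f \<cdot> (s \<cdot> q) = f \<cdot> (e' \<cdot> b)"
      using Comp_assoc[OF t(2) s(1) U0(2)] Comp_assoc[OF b e'(1) U0(2)] g(2) by (simp flip: s(2) e'(2))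
    from kill[OF V' Comp_closed[OF t(2) s(1)] Comp_closed[OF b e'(1)] this]
    have "p \<cdot> (s \<cdot> q) = p \<cdot> (e' \<cdot> b)" .
    also have "\<dots> = e \<cdot> b" using Comp_assoc[OF b e'(1) p] by (simp add: e_def)
    finally show ?thesis using eb by simp
  qed
  \<comment> \<open>\<open>q\<close> kills \<open>m\<close> because V[n] lies in \<open>C\<close>,
    so \<open>a \<cdot> b\<close> acts as the identity in front of \<open>q\<close>.\<close>
  have qab: "q \<cdot> (a \<cdot> b) = q"
  proof -
    have "q \<cdot> m = ZeroArr T ((ShO T ^^ n) V) W"
      using no_mapsD[OF CW[OF sh[OF VA]] Comp_closed[OF m t(2)]] .
    then have "q \<cdot> (m \<cdot> d) = ZeroArr T V' W"
      using Comp_assoc[OF d m t(2)] Zero_Comp[OF d WO(1)] by simp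
    then have "diff q (q \<cdot> (a \<cdot> b)) = ZeroArr T V' W"
      unfolding md using t(2) a b WO by (simp add: arr_simps)
    then show ?thesis
      using diff_eq_zero_iff[OF t(2) Comp_closed[OF Comp_closed[OF b a] t(2)]] by simp
  qed
  \<comment> \<open>\<open>k\<close> and \<open>s\<close> exhibit \<open>W\<close> as a retract of
    the precover \<open>U0\<close>, compatibly with the maps \<open>g\<close> and \<open>f\<close>
    to \<open>X\<close>.\<close>
  define k where "k = q \<cdot> (a \<cdot> p)"
  have k: "k \<in> Hom T U0 W" using Comp_closed[OF Comp_closed[OF p a] t(2)] by (simp add: k_def)
  have ks: "k \<cdot> s = Ident T W"
  proof -
    have ks: "k \<cdot> s \<in> Hom T W W" using Comp_closed[OF s(1) k] .
    have "(k \<cdot> s) \<cdot> q = q \<cdot> (a \<cdot> (p \<cdot> (s \<cdot> q)))"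
      using t(2) a p s(1) by (simp add: k_def arr_simps)
    then have "(k \<cdot> s) \<cdot> q = Ident T W \<cdot> q" using psq qab Ident_Comp[OF t(2)] by simp
    \<comment> \<open>Agreement after precomposition with \<open>q\<close> is enough: the difference
      factors through the shift of \<open>C0\<close>, which has no maps to \<open>W\<close>.\<close>
    then have "diff (k \<cdot> s) (Ident T W) \<cdot> q = ZeroArr T V' W"
      using Comp_diff_left_eq_zero_iff[OF t(2) ks Ident_closed[OF WO(1)]] by simp
    then obtain z where z: "z \<in> Hom T (ShO T C0) W" "diff (k \<cdot> s) (Ident T W) = z \<cdot> \<omega>'"
      using D_extend2[OF W diff_closed[OF ks Ident_closed[OF WO(1)]]] by blast
    have "z = ZeroArr T (ShO T C0) W" using no_mapsD[OF CW[OF ShC[OF C0]] z(1)] .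
    then have "diff (k \<cdot> s) (Ident T W) = ZeroArr T W W" using z Zero_Comp[OF t(3) WO(1)] by simp
    then show ?thesis using diff_eq_zero_iff[OF ks Ident_closed[OF WO(1)]] by simp
  qed
  have gk: "g \<cdot> k = f"
  proof -
    have "g \<cdot> k = (g \<cdot> q) \<cdot> (a \<cdot> p)" using g(1) t(2) a p by (simp add: k_def arr_simps)
    also have "\<dots> = h \<cdot> ((b \<cdot> a) \<cdot> p)" unfolding g(2)[symmetric] using h(1) a b p by (simp add: arr_simps)
    also have "\<dots> = h \<cdot> (p \<cdot> (e' \<cdot> p))" unfolding ba e_def using p e'(1) by (simp add: arr_simps)
    finally show ?thesis by (simp add: pe'p h(2)[symmetric])
  qed
  have "corepr A W X g"
  proof (rule coreprI[OF WA g(1) AO])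
    fix U u assume U: "U \<in> A" "u \<in> Hom T U X"
    obtain v where v: "v \<in> Hom T U U0" "u = f \<cdot> v" using f[OF U] by blast
    then have "u = g \<cdot> (k \<cdot> v)" using gk Comp_assoc[OF v(1) k g(1)] by simp
    then show "\<exists>v\<in>Hom T U W. u = g \<cdot> v" using Comp_closed[OF v(1) k] by blast
  next
    fix U v assume U: "U \<in> A" "v \<in> Hom T U W" "g \<cdot> v = ZeroArr T U X"
    have UO: "U \<in> Obj T" using U AO by blast
    have sv: "s \<cdot> v \<in> Hom T U U0" using Comp_closed[OF U(2) s(1)] .
    have "f \<cdot> (s \<cdot> v) = f \<cdot> ZeroArr T U U0"
      using U(3) Comp_assoc[OF U(2) s(1) U0(2)] Comp_Zero[OF U0(2) UO] by (simp flip: s(2))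
    from kill[OF U(1) sv ZeroArr_closed[OF UO O(1)] this]
    have psv: "p \<cdot> (s \<cdot> v) = ZeroArr T U V" using Comp_Zero[OF p UO] by simp
    have "v = (k \<cdot> s) \<cdot> v" using ks Ident_Comp[OF U(2)] by simp
    also have "\<dots> = q \<cdot> (a \<cdot> (p \<cdot> (s \<cdot> v)))" using U(2) s(1) t(2) a p by (simp add: k_def arr_simps)
    also have "\<dots> = ZeroArr T U W" unfolding psv using t(2) a UO O by (simp add: arr_simps)
    finally show "v = ZeroArr T U W" .
  qed
  then show ?thesis by blast
qed

end

section \<open>Finite direct sums of copies of one object\<close>

context additive_category
begin

text \<open>One copy is added at a time along any biproduct, since \<open>ex_biproduct\<close>
  provides no chosen ones.\<close>

inductive finite_sum :: "'o \<Rightarrow> 'o \<Rightarrow> bool" for N where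
  zero: "zero_object T Z \<Longrightarrow> finite_sum N Z"
| plus: "\<lbrakk>finite_sum N P; is_biproduct T Q P N i j p q\<rbrakk> \<Longrightarrow> finite_sum N Q"

lemma finite_sum_Obj: "finite_sum N P \<Longrightarrow> P \<in> Obj T"
  by (induction rule: finite_sum.induct) (auto simp: zero_object_def is_biproduct_def)

lemma zero_object_no_maps:
  assumes "zero_object T Z" "X \<in> Obj T"
  shows "no_maps X Z" "no_maps Z X"
proof -
  have Z: "Z \<in> Obj T" and u: "\<exists>!f. f \<in> Hom T X Z" "\<exists>!f. f \<in> Hom T Z X"
    using assms unfolding zero_object_def by blast+
  show "no_maps X Z" using u(1) ZeroArr_closed[OF assms(2) Z] by (intro no_mapsI) blast
  show "no_maps Z X" using u(2) ZeroArr_closed[OF Z assms(2)] by (intro no_mapsI) blast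
qed

lemma biproduct_decompose:
  assumes P: "is_biproduct T P X Y i j p q" and f: "f \<in> Hom T P Z"
  shows "f = AddArr T ((f \<cdot> i) \<cdot> p) ((f \<cdot> j) \<cdot> q)"
proof -
  have t: "i \<in> Hom T X P" "j \<in> Hom T Y P" "p \<in> Hom T P X" "q \<in> Hom T P Y"
    and 1: "AddArr T (i \<cdot> p) (j \<cdot> q) = Ident T P"
    using P unfolding is_biproduct_def by auto
  show ?thesis
    using Comp_add_right[OF Comp_closed[OF t(3,1)] Comp_closed[OF t(4,2)] f] 1 Comp_Ident[OF f]
      Comp_assoc[OF t(3,1) f] Comp_assoc[OF t(4,2) f] by simp
qed

lemma finite_sum_lift:
  assumes "finite_sum N P" and f: "f \<in> Hom T Q X"
    and lift: "\<And>u. u \<in> Hom T N X \<Longrightarrow> \<exists>v\<in>Hom T N Q. u = f \<cdot> v"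
    and x: "x \<in> Hom T P X"
  shows "\<exists>v\<in>Hom T P Q. x = f \<cdot> v"
  using assms(1) x
proof (induction arbitrary: x rule: finite_sum.induct)
  case (zero Z)
  have o: "Z \<in> Obj T" "X \<in> Obj T" "Q \<in> Obj T" using zero Hom_Obj f by blast+
  have "x = f \<cdot> ZeroArr T Z Q"
    using no_mapsD[OF zero_object_no_maps(2)[OF zero(1) o(2)] zero(2)] Comp_Zero[OF f o(1)] by simp
  then show ?case using ZeroArr_closed o by blast
next
  case (plus P R i j p q)
  have t: "i \<in> Hom T P R" "j \<in> Hom T N R" "p \<in> Hom T R P" "q \<in> Hom T R N"
    using plus(2) unfolding is_biproduct_def by auto
  obtain v where v: "v \<in> Hom T P Q" "x \<cdot> i = f \<cdot> v"
    using plus.IH[OF Comp_closed[OF t(1) plus.prems]] by blast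
  obtain w where w: "w \<in> Hom T N Q" "x \<cdot> j = f \<cdot> w"
    using lift[OF Comp_closed[OF t(2) plus.prems]] by blast
  have vp: "v \<cdot> p \<in> Hom T R Q" and wq: "w \<cdot> q \<in> Hom T R Q"
    using Comp_closed t v w by blast+
  have "x = f \<cdot> AddArr T (v \<cdot> p) (w \<cdot> q)"
    using biproduct_decompose[OF plus(2) plus.prems] Comp_add_right[OF vp wq f] v(2) w(2)
      Comp_assoc[OF t(3) v(1) f] Comp_assoc[OF t(4) w(1) f] by simp
  then show ?case using AddArr_closed[OF vp wq] by blast
qed

lemma finite_sum_no_maps:
  assumes "finite_sum N P" and Y: "Y \<in> Obj T" "no_maps Y N"
  shows "no_maps Y P"
  using assms(1)
proof (induction rule: finite_sum.induct)
  case (zero Z)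
  then show ?case using zero_object_no_maps Y by blast
next
  case (plus P R i j p q)
  have t: "i \<in> Hom T P R" "j \<in> Hom T N R" "p \<in> Hom T R P" "q \<in> Hom T R N"
    and 1: "AddArr T (i \<cdot> p) (j \<cdot> q) = Ident T R" using plus(2) unfolding is_biproduct_def by auto
  have R: "R \<in> Obj T" using Hom_Obj t by blast
  show ?case
  proof (rule no_mapsI)
    fix f assume f: "f \<in> Hom T Y R"
    have 0: "p \<cdot> f = ZeroArr T Y P" "q \<cdot> f = ZeroArr T Y N"
      using no_mapsD[OF plus.IH Comp_closed[OF f t(3)]] no_mapsD[OF Y(2) Comp_closed[OF f t(4)]] by auto
    have "f = AddArr T (i \<cdot> p) (j \<cdot> q) \<cdot> f" using 1 Ident_Comp[OF f] by simp
    also have "\<dots> = AddArr T (i \<cdot> (p \<cdot> f)) (j \<cdot> (q \<cdot> f))"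
      using Comp_add_left[OF f Comp_closed[OF t(3,1)] Comp_closed[OF t(4,2)]]
        Comp_assoc[OF f t(3,1)] Comp_assoc[OF f t(4,2)] by simp
    also have "\<dots> = ZeroArr T Y R"
      unfolding 0 using Comp_Zero[OF t(1) Y(1)] Comp_Zero[OF t(2) Y(1)] Zero_add_Zero Y(1) R by simp
    finally show "f = ZeroArr T Y R" .
  qed
qed

text \<open>The form in which finite generation is used from here on. Read in
  \<open>opposite T\<close>, it provides left approximations in \<open>T\<close>.\<close>

definition approximable :: bool where
  "approximable \<longleftrightarrow> (\<forall>N\<in>Obj T. \<forall>X\<in>Obj T. \<exists>P. finite_sum N P \<and>
    (\<exists>f\<in>Hom T P X. \<forall>u\<in>Hom T N X. \<exists>v\<in>Hom T N P. u = f \<cdot> v))"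

end

section \<open>From precovers to coreflections\<close>

context pretriangulated
begin

text \<open>The part \<open>X''\<close> of \<open>X\<close> without maps from \<open>C\<close> has a
  coreflection \<open>W\<close> by \<open>corepr_right_perp\<close>. Base change of the triangle of
  \<open>X\<close> along \<open>c\<close> gives an extension of \<open>W\<close> by
  \<open>X'\<close>, and this is the coreflection of \<open>X\<close>.\<close>

lemma coreflective_of_precovers:
  assumes A: "suspended A" and pre: "precovers A A" and C: "coreflective C" "C \<subseteq> A"
    and sh: "\<And>V. V \<in> A \<Longrightarrow> (ShO T ^^ n) V \<in> C" and ShC: "\<And>X. X \<in> C \<Longrightarrow> ShO T X \<in> C"
  shows "coreflective A"
  unfolding coreflective_def
proof
  fix X assume X: "X \<in> Obj T"
  have AO: "A \<subseteq> Obj T" using A by (simp add: suspended_def)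
  obtain X' X'' p g k where X': "X' \<in> C" and tri: "D X' X X'' p g k"
    and perp: "\<And>U. U \<in> C \<Longrightarrow> no_maps U X''"
    using C(1) X unfolding coreflective_def by meson
  note t = D_Hom[OF tri] and o = D_Obj[OF tri]
  obtain W c where W: "corepr A W X'' c"
    using corepr_right_perp[OF A pre C sh ShC o(3) perp] by blast
  have c: "c \<in> Hom T W X''" and WA: "W \<in> A" using W by (auto simp: corepr_def)
  obtain E i \<pi> y where E: "D X' E W i \<pi> (k \<cdot> c)" and y: "y \<in> Hom T E X" "y \<cdot> i = p" "g \<cdot> y = c \<cdot> \<pi>"
    using base_change[OF tri c] by blast
  note tE = D_Hom[OF E]
  have EA: "E \<in> A" using suspended_ext[OF A E] X' C(2) WA by blast
  have cor: "corepr A E X y"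
  proof (rule coreprI[OF EA y(1) AO])
    fix U u assume U: "U \<in> A" and u: "u \<in> Hom T U X"
    have UO: "U \<in> Obj T" using U AO by blast
    obtain w where w: "w \<in> Hom T U W" "g \<cdot> u = c \<cdot> w"
      using corepr_surj[OF W U Comp_closed[OF u t(2)]] by blast
    have "(k \<cdot> c) \<cdot> w = (k \<cdot> g) \<cdot> u"
      using Comp_assoc[OF w(1) c t(3)] Comp_assoc[OF u t(2,3)] w(2) by simp
    also have "\<dots> = ZeroArr T U (ShO T X')"
      using D_comp2[OF tri] Zero_Comp[OF u] ShO_closed[OF o(1)] by simp
    finally obtain \<epsilon> where \<epsilon>: "\<epsilon> \<in> Hom T U E" "w = \<pi> \<cdot> \<epsilon>" using D_lift2[OF E w(1)] by blast
    have y\<epsilon>: "y \<cdot> \<epsilon> \<in> Hom T U X" using Comp_closed[OF \<epsilon>(1) y(1)] .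
    have "g \<cdot> u = g \<cdot> (y \<cdot> \<epsilon>)"
      using w(2) \<epsilon>(2) Comp_assoc[OF \<epsilon>(1) y(1) t(2)] Comp_assoc[OF \<epsilon>(1) tE(2) c] y(3) by simp
    \<comment> \<open>\<open>\<epsilon>\<close> lifts \<open>u\<close> only up to a map killed by
      \<open>g\<close>; that difference comes from \<open>X'\<close> and is restored through
      \<open>i\<close>.\<close>
    then have "g \<cdot> diff u (y \<cdot> \<epsilon>) = ZeroArr T U X''"
      using Comp_diff_right_eq_zero_iff[OF u y\<epsilon> t(2)] by simp
    then obtain z where z: "z \<in> Hom T U X'" "diff u (y \<cdot> \<epsilon>) = p \<cdot> z"
      using D_lift[OF tri diff_closed[OF u y\<epsilon>]] by blast
    have iz: "i \<cdot> z \<in> Hom T U E" using Comp_closed[OF z(1) tE(1)] .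
    have "y \<cdot> AddArr T (i \<cdot> z) \<epsilon> = u"
      using Comp_add_right[OF iz \<epsilon>(1) y(1)] Comp_assoc[OF z(1) tE(1) y(1)] y(2)
        diff_add[OF u y\<epsilon>] z(2) by simp
    then show "\<exists>v\<in>Hom T U E. u = y \<cdot> v" using AddArr_closed[OF iz \<epsilon>(1)] by metis
  next
    fix U \<epsilon> assume U: "U \<in> A" and \<epsilon>: "\<epsilon> \<in> Hom T U E" and 0: "y \<cdot> \<epsilon> = ZeroArr T U X"
    have UO: "U \<in> Obj T" and WO: "W \<in> Obj T" using U WA AO by blast+
    have \<pi>\<epsilon>: "\<pi> \<cdot> \<epsilon> \<in> Hom T U W" using Comp_closed[OF \<epsilon> tE(2)] .
    have "c \<cdot> (\<pi> \<cdot> \<epsilon>) = g \<cdot> (y \<cdot> \<epsilon>)"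
      using Comp_assoc[OF \<epsilon> tE(2) c] Comp_assoc[OF \<epsilon> y(1) t(2)] y(3) by simp
    also have "\<dots> = c \<cdot> ZeroArr T U W" using 0 Comp_Zero[OF t(2) UO] Comp_Zero[OF c UO] by simp
    finally have "\<pi> \<cdot> \<epsilon> = ZeroArr T U W"
      using corepr_inj[OF W U \<pi>\<epsilon> ZeroArr_closed[OF UO WO]] by blast
    then obtain z where z: "z \<in> Hom T U X'" "\<epsilon> = i \<cdot> z" using D_lift[OF E \<epsilon>] by blast
    have pz: "p \<cdot> z = ZeroArr T U X" using 0 z(2) y(2) Comp_assoc[OF z(1) tE(1) y(1)] by simp
    \<comment> \<open>Injectivity uses one more degree: the shift of \<open>z\<close> lifts through
      \<open>k\<close> and, since \<open>A\<close> is closed under the shift, also through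
      \<open>c\<close>; thus \<open>i\<close> kills \<open>z\<close>.\<close>
    have Sz: "ShA T z \<in> Hom T (ShO T U) (ShO T X')" using ShA_closed[OF z(1)] .
    have "ShA T p \<cdot> ShA T z = ZeroArr T (ShO T U) (ShO T X)"
      using ShA_Comp[OF z(1) t(1)] pz ShA_Zero[OF UO X] by simp
    then obtain v where v: "v \<in> Hom T (ShO T U) X''" "ShA T z = k \<cdot> v"
      using D_lift3[OF tri Sz] by blast
    have SU: "ShO T U \<in> A" using A U by (simp add: suspended_def)
    obtain v' where v': "v' \<in> Hom T (ShO T U) W" "v = c \<cdot> v'" using corepr_surj[OF W SU v(1)] by blast
    have "ShA T \<epsilon> = ShA T i \<cdot> ((k \<cdot> c) \<cdot> v')"
      using ShA_Comp[OF z(1) tE(1)] z(2) v(2) v'(2) Comp_assoc[OF v'(1) c t(3)] by simp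
    also have "\<dots> = ZeroArr T (ShO T U) (ShO T E)"
      using Comp_assoc[OF v'(1) tE(3) ShA_closed[OF tE(1)]] D_comp3[OF E]
        Zero_Comp[OF v'(1)] ShO_closed[OF D_Obj(2)[OF E]] by simp
    also have "\<dots> = ShA T (ZeroArr T U E)" using ShA_Zero[OF UO D_Obj(2)[OF E]] by simp
    finally show "\<epsilon> = ZeroArr T U E"
      using ShA_inj[OF _ \<epsilon> ZeroArr_closed[OF UO D_Obj(2)[OF E]]] by blast
  qed
  obtain B h l where B: "D E X B y h l" using D_cone[OF y(1)] by blast
  have "\<forall>U\<in>A. no_maps U B"
    using corepr_cone[OF _ cor B] A AO unfolding suspended_def by blast
  then show "\<exists>A'\<in>A. \<exists>B f g h. D A' X B f g h \<and> (\<forall>A''\<in>A. no_maps A'' B)" using EA B by blast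
qed

lemma D_ShO: "D X Y Z f g h \<Longrightarrow> D (ShO T X) (ShO T Y) (ShO T Z) (ShA T f) (ShA T g) (ShA T h)"
  using D_rot by blast

lemma D_ShOn: "D X Y Z f g h \<Longrightarrow> \<exists>f g h. D ((ShO T ^^ n) X) ((ShO T ^^ n) Y) ((ShO T ^^ n) Z) f g h"
proof (induction n)
  case (Suc n)
  then show ?case using D_ShO by fastforce
qed auto

lemma no_maps_ext:
  assumes tri: "D X Y Z f g h" and U: "U \<in> Obj T" and 0: "no_maps U X" "no_maps U Z"
  shows "no_maps U Y"
proof (rule no_mapsI)
  fix u assume u: "u \<in> Hom T U Y"
  note t = D_Hom[OF tri]
  have "g \<cdot> u = ZeroArr T U Z" using no_mapsD[OF 0(2) Comp_closed[OF u t(2)]] .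
  then obtain v where v: "v \<in> Hom T U X" "u = f \<cdot> v" using D_lift[OF tri u] by blast
  then show "u = ZeroArr T U Y" using no_mapsD[OF 0(1) v(1)] Comp_Zero[OF t(1) U] by simp
qed

lemma no_maps_ext_src:
  assumes tri: "D X Y Z f g h" and U: "U \<in> Obj T" and 0: "no_maps X U" "no_maps Z U"
  shows "no_maps Y U"
proof (rule no_mapsI)
  fix u assume u: "u \<in> Hom T Y U"
  note t = D_Hom[OF tri]
  have "u \<cdot> f = ZeroArr T X U" using no_mapsD[OF 0(1) Comp_closed[OF t(1) u]] .
  then obtain v where v: "v \<in> Hom T Z U" "u = v \<cdot> g" using D_extend[OF tri u] by blast
  then show "u = ZeroArr T Y U" using no_mapsD[OF 0(2) v(1)] Zero_Comp[OF t(2) U] by simp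
qed

section \<open>Aisles of silting objects\<close>

text \<open>The class U(N). It is the aisle \<open>right_perp T (neg_shifts T N)\<close>, rewritten
  with positive shifts of the target.\<close>

definition sil_aisle :: "'o \<Rightarrow> 'o set" where
  "sil_aisle N = {X \<in> Obj T. \<forall>n. no_maps N ((ShO T ^^ Suc n) X)}"

text \<open>A visibly self-dual form of thickness: extensions instead of cones, retracts instead of
  summands, and a shift condition in both directions. Cones return by rotation and isomorphic copies
  as retracts.\<close>

definition thick_set :: "'o set \<Rightarrow> bool" where
  "thick_set S \<longleftrightarrow> S \<subseteq> Obj T \<and> ext_closed S \<and> (\<forall>X\<in>Obj T. ShO T X \<in> S \<longleftrightarrow> X \<in> S) \<and>
    (\<forall>X Y i p. Y \<in> S \<longrightarrow> i \<in> Hom T X Y \<longrightarrow> p \<in> Hom T Y X \<longrightarrow> p \<cdot> i = Ident T X \<longrightarrow> X \<in> S)"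

definition presilting :: "'o \<Rightarrow> bool" where
  "presilting N \<longleftrightarrow> N \<in> Obj T \<and> (\<forall>n. no_maps N ((ShO T ^^ Suc n) N))"

definition generator :: "'o \<Rightarrow> bool" where
  "generator N \<longleftrightarrow> (\<forall>S. thick_set S \<longrightarrow> N \<in> S \<longrightarrow> Obj T \<subseteq> S)"

lemma ShOn_ShOn: "(ShO T ^^ m) ((ShO T ^^ n) X) = (ShO T ^^ (m + n)) X"
  by (simp add: funpow_add)

lemma sil_aisle_ShO:
  assumes "X \<in> sil_aisle N"
  shows "ShO T X \<in> sil_aisle N"
proof -
  have "no_maps N ((ShO T ^^ Suc n) (ShO T X))" for n
  proof -
    have "no_maps N ((ShO T ^^ Suc (Suc n)) X)" using assms unfolding sil_aisle_def by blast
    then show ?thesis by (simp only: funpow_Suc_right o_apply)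
  qed
  then show ?thesis using assms ShO_closed by (auto simp: sil_aisle_def)
qed

lemma suspended_sil_aisle:
  assumes "N \<in> Obj T"
  shows "suspended (sil_aisle N)"
  unfolding suspended_def ext_closed_def
proof (intro conjI allI impI ballI)
  show "sil_aisle N \<subseteq> Obj T" by (auto simp: sil_aisle_def)
  show "ShO T X \<in> sil_aisle N" if "X \<in> sil_aisle N" for X using that by (rule sil_aisle_ShO)
  fix X Y Z f g h assume t: "D X Y Z f g h" "X \<in> sil_aisle N" "Z \<in> sil_aisle N"
  have "no_maps N ((ShO T ^^ Suc n) Y)" for n
  proof -
    obtain f g h where "D ((ShO T ^^ Suc n) X) ((ShO T ^^ Suc n) Y) ((ShO T ^^ Suc n) Z) f g h"
      using D_ShOn[OF t(1)] by blast
    then show ?thesis by (rule no_maps_ext) (use assms t in \<open>auto simp: sil_aisle_def\<close>)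
  qed
  then show "Y \<in> sil_aisle N" using D_Obj[OF t(1)] by (auto simp: sil_aisle_def)
qed

text \<open>The objects admitting a bound form a thick set, and \<open>N\<close> has bound 1. Bounds
  can be enlarged because the aisle is closed under the shift, so the sum of two bounds serves for
  an extension.\<close>

lemma sil_aisle_bounded:
  assumes N: "N \<in> Obj T" "generator N" and Z: "Z \<in> Obj T"
  shows "\<exists>l. \<forall>X\<in>sil_aisle N. no_maps Z ((ShO T ^^ l) X)"
proof -
  let ?S = "{Z \<in> Obj T. \<exists>l. \<forall>X\<in>sil_aisle N. no_maps Z ((ShO T ^^ l) X)}"
  note sus = suspended_sil_aisle[OF N(1)]
  have O: "(ShO T ^^ l) X \<in> Obj T" if "X \<in> sil_aisle N" for X l
    using that ShOn_closed by (simp add: sil_aisle_def)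
  have "thick_set ?S"
    unfolding thick_set_def ext_closed_def
  proof (intro conjI allI impI ballI)
    show "?S \<subseteq> Obj T" by blast
  next
    fix X Y Z f g h assume t: "D X Y Z f g h" and X: "X \<in> ?S" and Z: "Z \<in> ?S"
    obtain l where l: "\<forall>U\<in>sil_aisle N. no_maps X ((ShO T ^^ l) U)" using X by blast
    obtain m where m: "\<forall>U\<in>sil_aisle N. no_maps Z ((ShO T ^^ m) U)" using Z by blast
    have "no_maps Y ((ShO T ^^ (l + m)) U)" if U: "U \<in> sil_aisle N" for U
    proof (rule no_maps_ext_src[OF t O[OF U]])
      show "no_maps X ((ShO T ^^ (l + m)) U)"
        using l suspended_ShOn[OF sus U, of m] ShOn_ShOn[of l m U] by auto
      show "no_maps Z ((ShO T ^^ (l + m)) U)"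
        using m suspended_ShOn[OF sus U, of l] ShOn_ShOn[of m l U] by (auto simp: add.commute)
    qed
    then show "Y \<in> ?S" using D_Obj[OF t] by blast
  next
    fix Z assume Z: "Z \<in> Obj T"
    show "ShO T Z \<in> ?S \<longleftrightarrow> Z \<in> ?S"
    proof
      assume "ShO T Z \<in> ?S"
      then obtain l where l: "\<forall>U\<in>sil_aisle N. no_maps (ShO T Z) ((ShO T ^^ l) U)" by blast
      have "no_maps Z ((ShO T ^^ l) U)" if U: "U \<in> sil_aisle N" for U
      proof -
        have "no_maps (ShO T Z) (ShO T ((ShO T ^^ l) U))"
          using l sil_aisle_ShO[OF U] by (metis funpow_swap1)
        then show ?thesis using no_maps_ShO[OF Z O[OF U]] by simp
      qed
      then show "Z \<in> ?S" using Z by blast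
    next
      assume "Z \<in> ?S"
      then obtain l where l: "\<forall>U\<in>sil_aisle N. no_maps Z ((ShO T ^^ l) U)" by blast
      have "no_maps (ShO T Z) ((ShO T ^^ Suc l) U)" if U: "U \<in> sil_aisle N" for U
        using l U no_maps_ShO[OF Z O[OF U]] by simp
      then show "ShO T Z \<in> ?S" using ShO_closed[OF Z] by blast
    qed
  next
    fix X Y i p assume Y: "Y \<in> ?S" and i: "i \<in> Hom T X Y" and p: "p \<in> Hom T Y X" and 1: "p \<cdot> i = Ident T X"
    obtain l where l: "\<forall>U\<in>sil_aisle N. no_maps Y ((ShO T ^^ l) U)" using Y by blast
    have "no_maps X ((ShO T ^^ l) U)" if U: "U \<in> sil_aisle N" for U
    proof (rule no_mapsI)
      fix u assume u: "u \<in> Hom T X ((ShO T ^^ l) U)"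
      have "u \<cdot> p = ZeroArr T Y ((ShO T ^^ l) U)"
        using no_mapsD[OF _ Comp_closed[OF p u]] l U by blast
      then show "u = ZeroArr T X ((ShO T ^^ l) U)"
        using Comp_assoc[OF i p u] Comp_Ident[OF u] 1 Zero_Comp[OF i O[OF U]] by simp
    qed
    then show "X \<in> ?S" using Hom_Obj[OF i] by blast
  qed
  moreover have "N \<in> ?S"
  proof -
    have "\<forall>X\<in>sil_aisle N. no_maps N ((ShO T ^^ Suc 0) X)" unfolding sil_aisle_def by blast
    then show ?thesis using N by blast
  qed
  ultimately have "Z \<in> ?S" using N(2) Z unfolding generator_def by blast
  then show ?thesis by blast
qed

lemma presilting_ShO: "presilting N \<Longrightarrow> presilting (ShO T N)"
  unfolding presilting_def using no_maps_ShO ShO_closed ShOn_closed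
  by (metis funpow_swap1)

lemma presilting_ShOn: "presilting N \<Longrightarrow> presilting ((ShO T ^^ n) N)"
  by (induction n) (auto intro: presilting_ShO)

lemma ShOn_surj: "X \<in> Obj T \<Longrightarrow> \<exists>Y\<in>Obj T. X = (ShO T ^^ n) Y"
proof (induction n arbitrary: X)
  case (Suc n)
  then obtain Y where "Y \<in> Obj T" "X = ShO T Y" using ShO_surj by blast
  then show ?case using Suc.IH[of Y] by auto
qed auto

text \<open>Shifting \<open>Y\<close> down instead of the sum up avoids having to shift
  biproducts.\<close>

lemma finite_sum_no_maps_ShOn:
  assumes P: "finite_sum N P" and Y: "Y \<in> Obj T" "no_maps Y ((ShO T ^^ n) N)" and N: "N \<in> Obj T"
  shows "no_maps Y ((ShO T ^^ n) P)"
proof -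
  obtain Y' where Y': "Y' \<in> Obj T" "Y = (ShO T ^^ n) Y'" using ShOn_surj[OF Y(1)] by blast
  then show ?thesis
    using finite_sum_no_maps[OF P Y'(1)] no_maps_ShOn[OF Y'(1) N] no_maps_ShOn[OF Y'(1) finite_sum_Obj[OF P]] Y by simp
qed

lemma finite_sum_sil_aisle:
  assumes "presilting N" "finite_sum ((ShO T ^^ l) N) P"
  shows "P \<in> sil_aisle N"
proof -
  have N: "N \<in> Obj T" using assms(1) by (simp add: presilting_def)
  have "no_maps N ((ShO T ^^ Suc n) P)" for n
  proof (rule finite_sum_no_maps_ShOn[OF assms(2) N _ ShOn_closed[OF N]])
    have "no_maps N ((ShO T ^^ Suc (n + l)) N)" using assms(1) unfolding presilting_def by blast
    then show "no_maps N ((ShO T ^^ Suc n) ((ShO T ^^ l) N))" using ShOn_ShOn[of "Suc n" l N] by simp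
  qed
  then show ?thesis using finite_sum_Obj[OF assms(2)] by (auto simp: sil_aisle_def)
qed

text \<open>\<open>C\<close> is the cone of an approximation. A map from \<open>N\<close> to
  \<open>C\<close> lifts to \<open>X\<close>, because Hom(N, P[1]) = 0, and from there to
  \<open>P\<close>, so it is zero. In positive degrees \<open>C\<close> is an extension of P[1] by
  \<open>X\<close>.\<close>

lemma sil_aisle_decompose:
  assumes ap: "approximable" and N: "presilting N" and X: "X \<in> sil_aisle N"
  shows "\<exists>P C f g h. finite_sum N P \<and> C \<in> sil_aisle (ShO T N) \<and> D P X C f g h"
proof -
  have NO: "N \<in> Obj T" and XO: "X \<in> Obj T" using N X by (auto simp: presilting_def sil_aisle_def)
  obtain P f where P: "finite_sum N P" and f: "f \<in> Hom T P X"
    and lift: "\<And>u. u \<in> Hom T N X \<Longrightarrow> \<exists>v\<in>Hom T N P. u = f \<cdot> v"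
    using ap NO XO unfolding approximable_def by meson
  obtain C g h where tri: "D P X C f g h" using D_cone[OF f] by blast
  note t = D_Hom[OF tri] and o = D_Obj[OF tri]
  have PA: "P \<in> sil_aisle N" using finite_sum_sil_aisle[OF N, of 0] P by simp
  \<comment> \<open>Degree 0 is included, since the aisle of \<open>ShO T N\<close> is tested on N
    from degree 0 on.\<close>
  have "no_maps N ((ShO T ^^ n) C)" for n
  proof (cases n)
    case 0
    have "no_maps N C"
    proof (rule no_mapsI)
      fix u assume u: "u \<in> Hom T N C"
      have "no_maps N ((ShO T ^^ Suc 0) P)" using PA unfolding sil_aisle_def by blast
      then have "h \<cdot> u = ZeroArr T N (ShO T P)" using no_mapsD Comp_closed[OF u t(3)] by simp
      then obtain v where v: "v \<in> Hom T N X" "u = g \<cdot> v" using D_lift2[OF tri u] by blast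
      obtain w where w: "w \<in> Hom T N P" "v = f \<cdot> w" using lift[OF v(1)] by blast
      show "u = ZeroArr T N C"
        using v(2) w(2) Comp_assoc[OF w(1) t(1,2)] D_comp[OF tri] Zero_Comp[OF w(1) o(3)] by simp
    qed
    then show ?thesis using 0 by simp
  next
    case (Suc m)
    obtain f' g' h' where "D ((ShO T ^^ n) X) ((ShO T ^^ n) C) ((ShO T ^^ n) (ShO T P)) f' g' h'"
      using D_ShOn[OF D_rot[OF tri]] by blast
    then show ?thesis
    proof (rule no_maps_ext[OF _ NO])
      show "no_maps N ((ShO T ^^ n) X)" using X Suc by (auto simp: sil_aisle_def)
      show "no_maps N ((ShO T ^^ n) (ShO T P))"
        using sil_aisle_ShO[OF PA] Suc by (auto simp: sil_aisle_def)
    qed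
  qed
  then have "C \<in> sil_aisle (ShO T N)"
    using no_maps_ShO[OF NO ShOn_closed[OF o(3)]] o(3) by (auto simp: sil_aisle_def)
  then show ?thesis using P tri by blast
qed

text \<open>A horseshoe argument. The target is glued from an approximation \<open>P0\<close> and a
  precover of its cone, the source \<open>U\<close> is decomposed into \<open>P\<close> and
  \<open>Q\<close>; \<open>P\<close> lifts by the approximation and \<open>Q\<close> by the
  precover.\<close>

lemma precovers_step:
  assumes A: "suspended A" and ap: approximable and N: "presilting N"
    and sub: "\<And>P. finite_sum N P \<Longrightarrow> P \<in> A" and pre: "precovers A (sil_aisle (ShO T N))"
  shows "precovers A (sil_aisle N)"
  unfolding precovers_def
proof
  fix X assume X: "X \<in> Obj T"
  have NO: "N \<in> Obj T" using N by (auto simp: presilting_def)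
  obtain P0 p where P0: "finite_sum N P0" and p: "p \<in> Hom T P0 X"
    and lift: "\<And>u. u \<in> Hom T N X \<Longrightarrow> \<exists>v\<in>Hom T N P0. u = p \<cdot> v"
    using ap NO X unfolding approximable_def by meson
  obtain C g k where tri: "D P0 X C p g k" using D_cone[OF p] by blast
  note t = D_Hom[OF tri] and o = D_Obj[OF tri]
  obtain Q0 c where Q0: "Q0 \<in> A" and c: "c \<in> Hom T Q0 C"
    and liftC: "\<And>U u. \<lbrakk>U \<in> sil_aisle (ShO T N); u \<in> Hom T U C\<rbrakk> \<Longrightarrow> \<exists>v\<in>Hom T U Q0. u = c \<cdot> v"
    using pre o(3) unfolding precovers_def by meson
  obtain E i \<pi> y where E: "D P0 E Q0 i \<pi> (k \<cdot> c)" and y: "y \<in> Hom T E X" "y \<cdot> i = p" "g \<cdot> y = c \<cdot> \<pi>"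
    using base_change[OF tri c] by blast
  note tE = D_Hom[OF E]
  have "\<exists>v\<in>Hom T U E. x = y \<cdot> v" if U: "U \<in> sil_aisle N" and x: "x \<in> Hom T U X" for U x
  proof -
    obtain P Q j \<rho> \<sigma> where P: "finite_sum N P" and Q: "Q \<in> sil_aisle (ShO T N)" and dec: "D P U Q j \<rho> \<sigma>"
      using sil_aisle_decompose[OF ap N U] by blast
    note td = D_Hom[OF dec] and od = D_Obj[OF dec]
    have xj: "x \<cdot> j \<in> Hom T P X" using Comp_closed[OF td(1) x] .
    obtain x1 where x1: "x1 \<in> Hom T P P0" "x \<cdot> j = p \<cdot> x1" using finite_sum_lift[OF P p lift xj] by blast
    have "(g \<cdot> x) \<cdot> j = ZeroArr T P C"
      using Comp_assoc[OF td(1) x t(2)] x1(2) Comp_assoc[OF x1(1) t(1,2)] D_comp[OF tri]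
        Zero_Comp[OF x1(1) o(3)] by simp
    then obtain z where z: "z \<in> Hom T Q C" "g \<cdot> x = z \<cdot> \<rho>"
      using D_extend[OF dec Comp_closed[OF x t(2)]] by blast
    obtain z' where z': "z' \<in> Hom T Q Q0" "z = c \<cdot> z'" using liftC[OF Q z(1)] by blast
    have z'\<rho>: "z' \<cdot> \<rho> \<in> Hom T U Q0" using Comp_closed[OF td(2) z'(1)] .
    have cz: "c \<cdot> (z' \<cdot> \<rho>) = g \<cdot> x" using Comp_assoc[OF td(2) z'(1) c] z(2) z'(2) by simp
    have "(k \<cdot> c) \<cdot> (z' \<cdot> \<rho>) = (k \<cdot> g) \<cdot> x"
      using Comp_assoc[OF z'\<rho> c t(3)] cz Comp_assoc[OF x t(2,3)] by simp
    also have "\<dots> = ZeroArr T U (ShO T P0)"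
      using D_comp2[OF tri] Zero_Comp[OF x ShO_closed[OF o(1)]] by simp
    finally obtain \<epsilon> where \<epsilon>: "\<epsilon> \<in> Hom T U E" "z' \<cdot> \<rho> = \<pi> \<cdot> \<epsilon>" using D_lift2[OF E z'\<rho>] by blast
    have y\<epsilon>: "y \<cdot> \<epsilon> \<in> Hom T U X" using Comp_closed[OF \<epsilon>(1) y(1)] .
    have "g \<cdot> x = g \<cdot> (y \<cdot> \<epsilon>)"
      using cz \<epsilon>(2) Comp_assoc[OF \<epsilon>(1) y(1) t(2)] Comp_assoc[OF \<epsilon>(1) tE(2) c] y(3) by simp
    then have "g \<cdot> diff x (y \<cdot> \<epsilon>) = ZeroArr T U C"
      using Comp_diff_right_eq_zero_iff[OF x y\<epsilon> t(2)] by simp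
    then obtain w where w: "w \<in> Hom T U P0" "diff x (y \<cdot> \<epsilon>) = p \<cdot> w"
      using D_lift[OF tri diff_closed[OF x y\<epsilon>]] by blast
    have iw: "i \<cdot> w \<in> Hom T U E" using Comp_closed[OF w(1) tE(1)] .
    have "y \<cdot> AddArr T (i \<cdot> w) \<epsilon> = x"
      using Comp_add_right[OF iw \<epsilon>(1) y(1)] Comp_assoc[OF w(1) tE(1) y(1)] y(2)
        diff_add[OF x y\<epsilon>] w(2) by simp
    then show ?thesis using AddArr_closed[OF iw \<epsilon>(1)] by metis
  qed
  moreover have "E \<in> A" using suspended_ext[OF A E sub[OF P0] Q0] .
  ultimately show "\<exists>A'\<in>A. \<exists>f\<in>Hom T A' X. \<forall>U\<in>sil_aisle N. \<forall>u\<in>Hom T U X. \<exists>v\<in>Hom T U A'. u = f \<cdot> v"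
    using y(1) by blast
qed

text \<open>The tested class grows from the aisle of N[l] to that of N, one shift at a time. The
  sums of N[l] used on the way all lie in the fixed class U(N).\<close>

lemma precovers_ShOn:
  assumes ap: approximable and N: "presilting N"
    and pre: "precovers (sil_aisle N) (sil_aisle ((ShO T ^^ l) N))"
  shows "precovers (sil_aisle N) (sil_aisle N)"
  using pre
proof (induction l)
  case (Suc l)
  have "precovers (sil_aisle N) (sil_aisle ((ShO T ^^ l) N))"
  proof (rule precovers_step[OF _ ap presilting_ShOn[OF N]])
    show "suspended (sil_aisle N)" using suspended_sil_aisle N by (auto simp: presilting_def)
    show "P \<in> sil_aisle N" if "finite_sum ((ShO T ^^ l) N) P" for P using finite_sum_sil_aisle[OF N that] .
    show "precovers (sil_aisle N) (sil_aisle (ShO T ((ShO T ^^ l) N)))" using Suc.prems by simp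
  qed
  then show ?case by (rule Suc.IH)
qed auto

lemma sil_aisle_ShOn_subset:
  assumes "N \<in> Obj T"
  shows "sil_aisle ((ShO T ^^ l) N) \<subseteq> (ShO T ^^ l) ` sil_aisle N"
proof
  fix X assume X: "X \<in> sil_aisle ((ShO T ^^ l) N)"
  then obtain Y where Y: "Y \<in> Obj T" "X = (ShO T ^^ l) Y" using ShOn_surj[of X l] by (auto simp: sil_aisle_def)
  have "no_maps N ((ShO T ^^ Suc n) Y)" for n
  proof -
    have "no_maps ((ShO T ^^ l) N) ((ShO T ^^ Suc n) ((ShO T ^^ l) Y))"
      using X Y(2) unfolding sil_aisle_def by blast
    then have "no_maps ((ShO T ^^ l) N) ((ShO T ^^ l) ((ShO T ^^ Suc n) Y))"
      by (simp only: ShOn_ShOn add.commute)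
    then show ?thesis using no_maps_ShOn[OF assms ShOn_closed[OF Y(1)]] by blast
  qed
  then show "X \<in> (ShO T ^^ l) ` sil_aisle N" using Y by (auto simp: sil_aisle_def)
qed

lemma coreflective_ShO:
  assumes "coreflective A" "A \<subseteq> Obj T"
  shows "coreflective (ShO T ` A)"
  unfolding coreflective_def
proof
  fix X assume "X \<in> Obj T"
  then obtain Y where Y: "Y \<in> Obj T" "X = ShO T Y" using ShO_surj by blast
  obtain A' B f g h where t: "A' \<in> A" "D A' Y B f g h" "\<forall>A''\<in>A. no_maps A'' B"
    using assms(1) Y(1) unfolding coreflective_def by meson
  have "\<forall>A''\<in>ShO T ` A. no_maps A'' (ShO T B)"
    using t(3) no_maps_ShO D_Obj(3)[OF t(2)] assms(2) by blast
  then show "\<exists>A'\<in>ShO T ` A. \<exists>B f g h. D A' X B f g h \<and> (\<forall>A''\<in>ShO T ` A. no_maps A'' B)"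
    using t(1) D_ShO[OF t(2)] Y(2) by blast
qed

lemma coreflective_ShOn:
  assumes "coreflective A" "A \<subseteq> Obj T"
  shows "coreflective ((ShO T ^^ n) ` A)"
proof (induction n)
  case (Suc n)
  have "(ShO T ^^ n) ` A \<subseteq> Obj T" using assms(2) ShOn_closed by blast
  then show ?case using coreflective_ShO[OF Suc.IH] by (simp add: image_comp)
qed (use assms in simp)

lemma coreflective_sil_aisle_transfer:
  assumes ap: approximable and M: "presilting M" "generator M" and N: "presilting N" "generator N"
    and cor: "coreflective (sil_aisle M)"
  shows "coreflective (sil_aisle N)"
proof -
  have O: "M \<in> Obj T" "N \<in> Obj T" using M N by (auto simp: presilting_def)
  \<comment> \<open>Vanishing in a single degree is enough below: since the aisles are closed under
    the shift, it holds in all later degrees too and gives membership in the other aisle.\<close>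
  obtain a where a: "\<And>X. X \<in> sil_aisle M \<Longrightarrow> no_maps N ((ShO T ^^ a) X)"
    using sil_aisle_bounded[OF O(1) M(2) O(2)] by blast
  obtain b where b: "\<And>X. X \<in> sil_aisle N \<Longrightarrow> no_maps M ((ShO T ^^ b) X)"
    using sil_aisle_bounded[OF O(2) N(2) O(1)] by blast
  let ?A = "sil_aisle N" and ?C = "(ShO T ^^ a) ` sil_aisle M"
  have A: "suspended ?A" using suspended_sil_aisle[OF O(2)] .
  have susM: "suspended (sil_aisle M)" using suspended_sil_aisle[OF O(1)] .
  have C: "coreflective ?C" using coreflective_ShOn[OF cor] by (auto simp: sil_aisle_def)
  have CA: "?C \<subseteq> ?A"
  proof (rule image_subsetI)
    fix X assume X: "X \<in> sil_aisle M"
    have "no_maps N ((ShO T ^^ Suc n) ((ShO T ^^ a) X))" for n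
    proof -
      have "(ShO T ^^ Suc n) ((ShO T ^^ a) X) = (ShO T ^^ a) ((ShO T ^^ Suc n) X)"
        by (simp only: ShOn_ShOn add.commute)
      then show ?thesis using a[OF suspended_ShOn[OF susM X, of "Suc n"]] by simp
    qed
    then show "(ShO T ^^ a) X \<in> ?A" using X ShOn_closed by (auto simp: sil_aisle_def)
  qed
  have sh: "(ShO T ^^ (a + b)) V \<in> ?C" if V: "V \<in> ?A" for V
  proof -
    have "no_maps M ((ShO T ^^ Suc n) ((ShO T ^^ b) V))" for n
    proof -
      have "(ShO T ^^ Suc n) ((ShO T ^^ b) V) = (ShO T ^^ b) ((ShO T ^^ Suc n) V)"
        by (simp only: ShOn_ShOn add.commute)
      then show ?thesis using b[OF suspended_ShOn[OF A V, of "Suc n"]] by simp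
    qed
    then have "(ShO T ^^ b) V \<in> sil_aisle M" using V ShOn_closed by (auto simp: sil_aisle_def)
    then show ?thesis unfolding ShOn_ShOn[symmetric] by blast
  qed
  have ShC: "ShO T X \<in> ?C" if "X \<in> ?C" for X
    using that sil_aisle_ShO by (auto simp: funpow_swap1)
  have sub: "sil_aisle ((ShO T ^^ (a + b)) N) \<subseteq> ?C"
    using sil_aisle_ShOn_subset[OF O(2)] sh by blast
  \<comment> \<open>The descent starts with the coreflection to \<open>?C\<close>, through which
    every map from the aisle of N[a+b] factors.\<close>
  have "precovers ?A (sil_aisle ((ShO T ^^ (a + b)) N))"
    unfolding precovers_def
  proof
    fix X assume "X \<in> Obj T"
    then obtain X' B f g h where X': "X' \<in> ?C" and tri: "D X' X B f g h" and perp: "\<forall>U\<in>?C. no_maps U B"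
      using C unfolding coreflective_def by meson
    note t = D_Hom[OF tri]
    have "\<exists>v\<in>Hom T U X'. u = f \<cdot> v" if "U \<in> sil_aisle ((ShO T ^^ (a + b)) N)" "u \<in> Hom T U X" for U u
      using D_lift[OF tri that(2)] no_mapsD[OF _ Comp_closed[OF that(2) t(2)]] perp sub that(1) by blast
    then show "\<exists>A'\<in>?A. \<exists>f\<in>Hom T A' X. \<forall>U\<in>sil_aisle ((ShO T ^^ (a + b)) N). \<forall>u\<in>Hom T U X. \<exists>v\<in>Hom T U A'. u = f \<cdot> v"
      using X' CA t(1) by blast
  qed
  then have pre: "precovers ?A ?A" by (rule precovers_ShOn[OF ap N(1)])
  show ?thesis using coreflective_of_precovers[OF A pre C CA sh ShC] .
qed

text \<open>The half in degrees >= 1 of the t-structure, hence tested from n = 0 on; its shift is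
  \<open>right_perp T (pos_shifts T N)\<close>.\<close>

definition sil_coaisle :: "'o \<Rightarrow> 'o set" where
  "sil_coaisle N = {Y \<in> Obj T. \<forall>n. no_maps ((ShO T ^^ n) N) Y}"

text \<open>Stripping sums of N[l] from the source, which have no maps to \<open>Y\<close>, factors
  \<open>u\<close> through the aisle of N[l] for every l. For large l the first factor is zero by
  \<open>sil_aisle_bounded\<close>.\<close>

lemma sil_aisle_orthogonal:
  assumes ap: approximable and N: "presilting N" "generator N"
    and X: "X \<in> sil_aisle N" and Y: "Y \<in> sil_coaisle N"
  shows "no_maps X Y"
proof (rule no_mapsI)
  fix u assume u: "u \<in> Hom T X Y"
  have O: "N \<in> Obj T" "X \<in> Obj T" "Y \<in> Obj T"
    using N X Y by (auto simp: presilting_def sil_aisle_def sil_coaisle_def)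
  have step: "\<exists>C\<in>sil_aisle ((ShO T ^^ l) N). \<exists>g\<in>Hom T X C. \<exists>v\<in>Hom T C Y. u = v \<cdot> g" for l
  proof (induction l)
    case 0
    have "u = u \<cdot> Ident T X" using Comp_Ident[OF u] by simp
    then show ?case using X u Ident_closed[OF O(2)] by auto
  next
    case (Suc l)
    then obtain C g v where C: "C \<in> sil_aisle ((ShO T ^^ l) N)" and g: "g \<in> Hom T X C"
      and v: "v \<in> Hom T C Y" and uv: "u = v \<cdot> g" by blast
    obtain P C' f g' h where P: "finite_sum ((ShO T ^^ l) N) P"
      and C': "C' \<in> sil_aisle (ShO T ((ShO T ^^ l) N))" and tri: "D P C C' f g' h"
      using sil_aisle_decompose[OF ap presilting_ShOn[OF N(1)] C] by blast
    note t = D_Hom[OF tri] and o = D_Obj[OF tri]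
    let ?Z = "ZeroArr T X Y"
    have "no_maps P Y"
    proof (rule no_mapsI)
      fix x assume x: "x \<in> Hom T P Y"
      \<comment> \<open>Lifting through a map out of a zero object expresses vanishing, so
        \<open>finite_sum_lift\<close> applies.\<close>
      obtain Z0 where Z0: "zero_object T Z0" using ex_zero_object by blast
      then have Z0O: "Z0 \<in> Obj T" by (simp add: zero_object_def)
      have "\<exists>w\<in>Hom T P Z0. x = ZeroArr T Z0 Y \<cdot> w"
      proof (rule finite_sum_lift[OF P ZeroArr_closed[OF Z0O O(3)] _ x])
        fix s assume s: "s \<in> Hom T ((ShO T ^^ l) N) Y"
        have "s = ZeroArr T ((ShO T ^^ l) N) Y"
          using no_mapsD[OF _ s] Y by (auto simp: sil_coaisle_def)
        then have "s = ZeroArr T Z0 Y \<cdot> ZeroArr T ((ShO T ^^ l) N) Z0"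
          using Comp_Zero[OF ZeroArr_closed[OF Z0O O(3)] ShOn_closed[OF O(1)]] by simp
        then show "\<exists>v\<in>Hom T ((ShO T ^^ l) N) Z0. s = ZeroArr T Z0 Y \<cdot> v"
          using ZeroArr_closed[OF ShOn_closed[OF O(1)] Z0O] by blast
      qed
      then show "x = ZeroArr T P Y" using Zero_Comp O(3) by blast
    qed
    then have "v \<cdot> f = ZeroArr T P Y" using no_mapsD Comp_closed[OF t(1) v] by blast
    then obtain v' where v': "v' \<in> Hom T C' Y" "v = v' \<cdot> g'" using D_extend[OF tri v] by blast
    have "u = v' \<cdot> (g' \<cdot> g)" using uv v'(2) Comp_assoc[OF g t(2) v'(1)] by simp
    then show ?case using C' v'(1) Comp_closed[OF g t(2)] by auto
  qed
  obtain l where l: "\<And>U. U \<in> sil_aisle N \<Longrightarrow> no_maps X ((ShO T ^^ l) U)"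
    using sil_aisle_bounded[OF O(1) N(2) O(2)] by blast
  obtain C g v where C: "C \<in> sil_aisle ((ShO T ^^ l) N)" and g: "g \<in> Hom T X C"
    and v: "v \<in> Hom T C Y" and uv: "u = v \<cdot> g" using step by blast
  have "no_maps X C" using C sil_aisle_ShOn_subset[OF O(1)] l by blast
  then show "u = ZeroArr T X Y" using uv no_mapsD[OF _ g] Comp_Zero[OF v O(2)] by simp
qed

lemma sil_coaisle_eq:
  assumes ap: approximable and N: "presilting N" "generator N"
  shows "sil_coaisle N = {Y \<in> Obj T. \<forall>X\<in>sil_aisle N. no_maps X Y}"
proof -
  have O: "N \<in> Obj T" using N by (auto simp: presilting_def)
  have "N \<in> sil_aisle N" using N by (auto simp: presilting_def sil_aisle_def)
  then have "(ShO T ^^ n) N \<in> sil_aisle N" for n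
    using suspended_ShOn suspended_sil_aisle[OF O] by blast
  then show ?thesis using sil_aisle_orthogonal[OF ap N] by (auto simp: sil_coaisle_def)
qed

text \<open>For \<open>X\<close> in the orthogonal the map to \<open>B\<close> is zero, so
  \<open>X\<close> is a retract of its coreflection, and the vanishing that defines the aisle passes
  to retracts.\<close>

lemma sil_aisle_eq:
  assumes ap: approximable and N: "presilting N" "generator N" and cor: "coreflective (sil_aisle N)"
  shows "sil_aisle N = {X \<in> Obj T. \<forall>Y\<in>sil_coaisle N. no_maps X Y}"
proof
  show "sil_aisle N \<subseteq> {X \<in> Obj T. \<forall>Y\<in>sil_coaisle N. no_maps X Y}"
    using sil_aisle_orthogonal[OF ap N] by (auto simp: sil_aisle_def)
  have O: "N \<in> Obj T" using N by (auto simp: presilting_def)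
  show "{X \<in> Obj T. \<forall>Y\<in>sil_coaisle N. no_maps X Y} \<subseteq> sil_aisle N"
  proof clarify
    fix X assume X: "X \<in> Obj T" and 0: "\<forall>Y\<in>sil_coaisle N. no_maps X Y"
    obtain X' B f g h where X': "X' \<in> sil_aisle N" and tri: "D X' X B f g h"
      and perp: "\<forall>U\<in>sil_aisle N. no_maps U B"
      using cor X unfolding coreflective_def by meson
    note t = D_Hom[OF tri]
    have "B \<in> sil_coaisle N" using sil_coaisle_eq[OF ap N] perp D_Obj[OF tri] by blast
    then have g0: "g = ZeroArr T X B" using 0 no_mapsD[OF _ t(2)] by blast
    have "g \<cdot> Ident T X = ZeroArr T X B" using g0 Comp_Ident[OF t(2)] by simp
    then obtain s where s: "s \<in> Hom T X X'" "Ident T X = f \<cdot> s" using D_lift[OF tri Ident_closed[OF X]] by blast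
    have "no_maps N ((ShO T ^^ Suc n) X)" for n
    proof -
      \<comment> \<open>Unshifting \<open>N\<close> instead of shifting \<open>X\<close> lets
        \<open>f\<close> and \<open>s\<close> be used as they are.\<close>
      obtain N' where N': "N' \<in> Obj T" "N = (ShO T ^^ Suc n) N'" using ShOn_surj[OF O] by blast
      have "no_maps N' X'"
        using X' N' no_maps_ShOn[OF N'(1), of X' "Suc n"] D_Obj[OF tri] unfolding sil_aisle_def by blast
      have "no_maps N' X"
      proof (rule no_mapsI)
        fix x assume x: "x \<in> Hom T N' X"
        have "s \<cdot> x = ZeroArr T N' X'" using no_mapsD[OF \<open>no_maps N' X'\<close> Comp_closed[OF x s(1)]] .
        then show "x = ZeroArr T N' X"
          using Comp_assoc[OF x s(1) t(1)] s(2) Ident_Comp[OF x] Comp_Zero[OF t(1) N'(1)] by simp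
      qed
      then show ?thesis using N' no_maps_ShOn[OF N'(1) X, of "Suc n"] by blast
    qed
    then show "X \<in> sil_aisle N" using X by (auto simp: sil_aisle_def)
  qed
qed

end

section \<open>Negation and signs of arrows\<close>

context additive_category
begin

definition neg :: "'m \<Rightarrow> 'm" where
  "neg f = \<ominus>\<^bsub>hom_group T (Src T f) (Tgt T f)\<^esub> f"

lemma neg_eq: "f \<in> Hom T X Y \<Longrightarrow> neg f = \<ominus>\<^bsub>hom_group T X Y\<^esub> f"
  by (auto simp: neg_def Hom_iff)

lemma neg_closed:
  assumes "f \<in> Hom T X Y"
  shows "neg f \<in> Hom T X Y"
proof -
  interpret A: abelian_group "hom_group T X Y" using hom_abelian_group Hom_Obj assms by blast
  show ?thesis using A.a_inv_closed[of f] assms by (simp add: neg_eq)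
qed

lemma add_neg:
  assumes "f \<in> Hom T X Y"
  shows "AddArr T (neg f) f = ZeroArr T X Y"
proof -
  interpret A: abelian_group "hom_group T X Y" using hom_abelian_group Hom_Obj assms by blast
  show ?thesis using A.l_neg[of f] assms by (simp add: neg_eq)
qed

lemma neg_neg:
  assumes "f \<in> Hom T X Y"
  shows "neg (neg f) = f"
proof -
  interpret A: abelian_group "hom_group T X Y" using hom_abelian_group Hom_Obj assms by blast
  show ?thesis using A.minus_minus[of f] neg_eq[OF neg_closed[OF assms]] neg_eq[OF assms] assms by simp
qed

lemma neg_unique: "\<lbrakk>f \<in> Hom T X Y; g \<in> Hom T X Y; AddArr T g f = ZeroArr T X Y\<rbrakk> \<Longrightarrow> g = neg f"
  by (rule add_right_cancel[OF _ neg_closed]) (auto simp: add_neg)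

lemma neg_Zero: "\<lbrakk>X \<in> Obj T; Y \<in> Obj T\<rbrakk> \<Longrightarrow> neg (ZeroArr T X Y) = ZeroArr T X Y"
  using neg_unique[OF ZeroArr_closed ZeroArr_closed] Zero_add_Zero by metis

lemma Comp_neg:
  assumes "f \<in> Hom T X Y" "g \<in> Hom T Y Z"
  shows "g \<cdot> neg f = neg (g \<cdot> f)"
  using neg_unique[OF Comp_closed[OF assms] Comp_closed[OF neg_closed[OF assms(1)] assms(2)]]
    Comp_add_right[OF neg_closed[OF assms(1)] assms] add_neg[OF assms(1)]
    Comp_Zero[OF assms(2) Hom_Obj(1)[OF assms(1)]] by simp

lemma neg_Comp:
  assumes "f \<in> Hom T X Y" "g \<in> Hom T Y Z"
  shows "neg g \<cdot> f = neg (g \<cdot> f)"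
  using neg_unique[OF Comp_closed[OF assms] Comp_closed[OF assms(1) neg_closed[OF assms(2)]]]
    Comp_add_left[OF assms(1) neg_closed[OF assms(2)] assms(2)] add_neg[OF assms(2)]
    Zero_Comp[OF assms(1) Hom_Obj(2)[OF assms(2)]] by simp

definition signed :: "bool \<Rightarrow> 'm \<Rightarrow> 'm" where
  "signed s f = (if s then neg f else f)"

lemma signed_closed: "f \<in> Hom T X Y \<Longrightarrow> signed s f \<in> Hom T X Y"
  by (simp add: signed_def neg_closed)

lemma signed_signed: "f \<in> Hom T X Y \<Longrightarrow> signed s (signed s f) = f"
  by (simp add: signed_def neg_neg)

lemma signed_Comp: "\<lbrakk>f \<in> Hom T X Y; g \<in> Hom T Y Z\<rbrakk> \<Longrightarrow> signed s g \<cdot> f = signed s (g \<cdot> f)"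
  by (simp add: signed_def neg_Comp)

end

section \<open>Triangulated categories and their opposites\<close>

context triangulated_category
begin

definition exact :: "'o \<Rightarrow> 'o \<Rightarrow> 'o \<Rightarrow> 'm \<Rightarrow> 'm \<Rightarrow> 'm \<Rightarrow> bool" where
  "exact X Y Z f g h \<longleftrightarrow> h \<in> Hom T Z (ShO T X) \<and> (\<exists>s. triangle T X Y Z f g (signed s h))"

lemma triangleD:
  assumes "triangle T X Y Z f g h"
  shows "f \<in> Hom T X Y" "g \<in> Hom T Y Z" "h \<in> Hom T Z (ShO T X)"
  using assms by (auto simp: triangle_def)

lemma exactI: "triangle T X Y Z f g h \<Longrightarrow> exact X Y Z f g h"
  unfolding exact_def signed_def using triangleD by (metis (full_types))

lemma exactE:
  assumes "exact X Y Z f g h"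
  obtains s h' where "triangle T X Y Z f g h'" "h' = signed s h" "h = signed s h'"
    "f \<in> Hom T X Y" "g \<in> Hom T Y Z" "h \<in> Hom T Z (ShO T X)" "h' \<in> Hom T Z (ShO T X)"
  using assms signed_signed triangleD unfolding exact_def by metis

lemma ShO_inj: "\<lbrakk>X \<in> Obj T; Y \<in> Obj T; ShO T X = ShO T Y\<rbrakk> \<Longrightarrow> X = Y"
  using ShO_bij by (auto simp: bij_betw_def inj_on_def)

text \<open>\<open>ShA\<close> is bijective on all arrows at once; injectivity of \<open>ShO\<close>
  puts preimages into the right hom-set.\<close>

lemma ShA_bij_Hom:
  assumes "X \<in> Obj T" "Y \<in> Obj T"
  shows "bij_betw (ShA T) (Hom T X Y) (Hom T (ShO T X) (ShO T Y))"
  unfolding bij_betw_def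
proof
  show "inj_on (ShA T) (Hom T X Y)"
    using ShA_bij by (auto simp: bij_betw_def Hom_iff inj_on_def)
  show "ShA T ` Hom T X Y = Hom T (ShO T X) (ShO T Y)"
  proof
    show "ShA T ` Hom T X Y \<subseteq> Hom T (ShO T X) (ShO T Y)" using ShA_Hom by blast
    show "Hom T (ShO T X) (ShO T Y) \<subseteq> ShA T ` Hom T X Y"
    proof
      fix f assume f: "f \<in> Hom T (ShO T X) (ShO T Y)"
      then obtain g where g: "g \<in> Arr T" "f = ShA T g"
        using ShA_bij by (auto simp: bij_betw_def Hom_iff)
      have gH: "g \<in> Hom T (Src T g) (Tgt T g)" using g by (simp add: Hom_iff)
      have "ShO T (Src T g) = ShO T X" "ShO T (Tgt T g) = ShO T Y"
        using ShA_Hom[OF gH] f g(2) by (auto simp: Hom_iff)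
      then have "Src T g = X" "Tgt T g = Y" using ShO_inj Hom_Obj[OF gH] assms by blast+
      then show "f \<in> ShA T ` Hom T X Y" using gH g(2) by blast
    qed
  qed
qed

sublocale sh: shift_category T
  by unfold_locales (use ShO_bij ShA_bij_Hom ShA_Comp ShA_add in blast)+

lemma ShA_neg:
  assumes "f \<in> Hom T X Y"
  shows "ShA T (neg f) = neg (ShA T f)"
  using neg_unique[OF ShA_Hom[OF assms] ShA_Hom[OF neg_closed[OF assms]]]
    ShA_add[OF neg_closed[OF assms] assms] add_neg[OF assms] sh.ShA_Zero Hom_Obj[OF assms] by simp

lemma iso_arr_neg_Ident: "X \<in> Obj T \<Longrightarrow> iso_arr T X X (neg (Ident T X))"
  unfolding iso_arr_def
  using neg_closed[OF Ident_closed] neg_Comp[OF neg_closed[OF Ident_closed] Ident_closed]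
    Ident_Comp[OF neg_closed[OF Ident_closed]] neg_neg[OF Ident_closed] by metis

lemma iso_arr_Ident: "X \<in> Obj T \<Longrightarrow> iso_arr T X X (Ident T X)"
  unfolding iso_arr_def using Ident_closed Comp_Ident by blast

text \<open>An isomorphism of triangles with minus the identity on \<open>Z\<close>.\<close>

lemma triangle_neg:
  assumes "triangle T X Y Z f g h"
  shows "triangle T X Y Z f (neg g) (neg h)"
proof -
  note t = triangleD[OF assms]
  have o: "X \<in> Obj T" "Y \<in> Obj T" "Z \<in> Obj T" using t Hom_Obj by blast+
  note 1 = Ident_closed[OF o(3)]
  have "neg h \<cdot> neg (Ident T Z) = h"
    using Comp_neg[OF 1 neg_closed[OF t(3)]] Comp_Ident[OF neg_closed[OF t(3)]] neg_neg[OF t(3)] by simp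
  moreover have "neg (Ident T Z) \<cdot> g = neg g" using neg_Comp[OF t(2) 1] Ident_Comp[OF t(2)] by simp
  ultimately show ?thesis
    using TR1_iso[OF assms iso_arr_Ident[OF o(1)] iso_arr_Ident[OF o(2)] iso_arr_neg_Ident[OF o(3)]
        t(1) neg_closed[OF t(2)] neg_closed[OF t(3)]] t o
      Comp_Ident Ident_Comp neg_closed ShA_Ident by metis
qed

lemma triangle_rotate:
  assumes "f \<in> Hom T X Y" "g \<in> Hom T Y Z" "h \<in> Hom T Z (ShO T X)"
  shows "triangle T X Y Z f g h \<longleftrightarrow> triangle T Y Z (ShO T X) g h (neg (ShA T f))"
  using TR2[OF assms] neg_eq[OF ShA_Hom[OF assms(1)]] by simp

text \<open>\<open>TR2\<close> negates \<open>ShA T f\<close>, and a sign on \<open>h\<close>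
  becomes one on the second arrow, which \<open>triangle_neg\<close> moves to the third. In total
  the sign flips.\<close>

lemma exact_rotate:
  assumes "exact X Y Z f g h"
  shows "exact Y Z (ShO T X) g h (ShA T f)"
proof -
  obtain s h' where t: "triangle T X Y Z f g h'" "h' = signed s h" "f \<in> Hom T X Y" "g \<in> Hom T Y Z"
    "h \<in> Hom T Z (ShO T X)" "h' \<in> Hom T Z (ShO T X)" using assms by (elim exactE)
  have 1: "triangle T Y Z (ShO T X) g h' (neg (ShA T f))" using triangle_rotate t by blast
  have "triangle T Y Z (ShO T X) g h (signed (\<not> s) (ShA T f))"
  proof (cases s)
    case True
    then show ?thesis using triangle_neg[OF 1] t(2) neg_neg[OF t(5)] neg_neg[OF ShA_Hom[OF t(3)]]
      by (simp add: signed_def)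
  next
    case False
    then show ?thesis using 1 t(2) by (simp add: signed_def)
  qed
  then show ?thesis using ShA_Hom[OF t(3)] unfolding exact_def by blast
qed

lemma exact_unrotate:
  assumes "exact Y Z (ShO T X) g h (ShA T f)" and f: "f \<in> Hom T X Y"
  shows "exact X Y Z f g h"
proof -
  obtain s k where t: "triangle T Y Z (ShO T X) g h k" "k = signed s (ShA T f)"
    "g \<in> Hom T Y Z" "h \<in> Hom T Z (ShO T X)" using assms(1) by (elim exactE)
  have "triangle T X Y Z f g (signed (\<not> s) h)"
  proof (cases s)
    case True
    then show ?thesis using t triangle_rotate[OF f t(3,4)] by (simp add: signed_def)
  next
    case False
    then show ?thesis using triangle_neg[OF t(1)] t triangle_rotate[OF _ neg_closed[OF t(3)], OF f]
        triangle_rotate[OF f t(3) neg_closed[OF t(4)]]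
      by (simp add: signed_def)
  qed
  then show ?thesis using t(4) unfolding exact_def by blast
qed

text \<open>\<open>TR3\<close> compares the identity triangle on \<open>X\<close>, whose third
  object is zero, with the given one.\<close>

lemma triangle_comp:
  assumes "triangle T X Y Z f g h"
  shows "g \<cdot> f = ZeroArr T X Z"
proof -
  note t = triangleD[OF assms]
  have X: "X \<in> Obj T" using t Hom_Obj by blast
  obtain Z0 where Z0: "zero_object T Z0" using ex_zero_object by blast
  have "\<exists>c\<in>Hom T Z0 Z. c \<cdot> ZeroArr T X Z0 = g \<cdot> f \<and> ShA T (Ident T X) \<cdot> ZeroArr T Z0 (ShO T X) = h \<cdot> c"
    by (rule TR3[OF TR1_Ident[OF X Z0] assms Ident_closed[OF X] t(1)]) simp
  then show ?thesis using Comp_Zero X by metis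
qed

text \<open>\<open>TR3\<close> from the rotated identity triangle on \<open>U\<close> yields a map
  between shifts, and fullness of the shift makes it the desired lift.\<close>

lemma triangle_lift:
  assumes tri: "triangle T X Y Z f g h" and u: "u \<in> Hom T U Y" "g \<cdot> u = ZeroArr T U Z"
  shows "\<exists>v\<in>Hom T U X. u = f \<cdot> v"
proof -
  note t = triangleD[OF tri]
  have o: "X \<in> Obj T" "Y \<in> Obj T" "Z \<in> Obj T" "U \<in> Obj T" using t u Hom_Obj by blast+
  obtain Z0 where Z0: "zero_object T Z0" using ex_zero_object by blast
  then have Z0O: "Z0 \<in> Obj T" by (simp add: zero_object_def)
  note z = ZeroArr_closed[OF o(4) Z0O] and z' = ZeroArr_closed[OF Z0O sh.ShO_closed[OF o(4)]]
  have 1: "triangle T U Z0 (ShO T U) (ZeroArr T U Z0) (ZeroArr T Z0 (ShO T U)) (neg (Ident T (ShO T U)))"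
    using TR1_Ident[OF o(4) Z0] triangle_rotate[OF Ident_closed[OF o(4)] z z'] ShA_Ident[OF o(4)] by simp
  have 2: "triangle T Y Z (ShO T X) g h (neg (ShA T f))" using tri triangle_rotate[OF t] by simp
  have "ZeroArr T Z0 Z \<cdot> ZeroArr T U Z0 = g \<cdot> u" using u(2) Zero_Comp[OF z o(3)] by simp
  from TR3[OF 1 2 u(1) ZeroArr_closed[OF Z0O o(3)] this]
  obtain c where c: "c \<in> Hom T (ShO T U) (ShO T X)"
    "ShA T u \<cdot> neg (Ident T (ShO T U)) = neg (ShA T f) \<cdot> c" by blast
  note Su = ShA_Hom[OF u(1)] and Sf = ShA_Hom[OF t(1)]
  have "neg (ShA T u) = neg (ShA T f \<cdot> c)"
    using c(2) Comp_neg[OF Ident_closed[OF sh.ShO_closed[OF o(4)]] Su] Comp_Ident[OF Su] neg_Comp[OF c(1) Sf] by simp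
  then have Suc: "ShA T u = ShA T f \<cdot> c" using neg_neg[OF Su] neg_neg[OF Comp_closed[OF c(1) Sf]] by metis
  obtain v where v: "v \<in> Hom T U X" "c = ShA T v" using sh.ShA_surj[OF c(1) o(4,1)] by blast
  then have "ShA T u = ShA T (f \<cdot> v)" using Suc ShA_Comp[OF v(1) t(1)] by simp
  then show ?thesis using sh.ShA_inj[OF _ u(1) Comp_closed[OF v(1) t(1)]] v(1) by blast
qed

lemma triangle_extend:
  assumes tri: "triangle T X Y Z f g h" and u: "u \<in> Hom T Y U" "u \<cdot> f = ZeroArr T X U"
  shows "\<exists>v\<in>Hom T Z U. u = v \<cdot> g"
proof -
  note t = triangleD[OF tri]
  have o: "X \<in> Obj T" "Y \<in> Obj T" "Z \<in> Obj T" "U \<in> Obj T" using t u Hom_Obj by blast+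
  obtain Z0 where Z0: "zero_object T Z0" using ex_zero_object by blast
  then have "Z0 \<in> Obj T" by (simp add: zero_object_def)
  \<comment> \<open>A zero object is itself a shift, so the identity triangle on \<open>U\<close>
    can be rotated back to start at \<open>W\<close>.\<close>
  then obtain W where W: "W \<in> Obj T" "Z0 = ShO T W" using sh.ShO_surj by blast
  note z = ZeroArr_closed[OF W(1) o(4)] and z' = ZeroArr_closed[OF o(4) sh.ShO_closed[OF W(1)]]
  have "neg (ShA T (ZeroArr T W U)) = ZeroArr T (ShO T W) (ShO T U)"
    using sh.ShA_Zero[OF W(1) o(4)] neg_Zero sh.ShO_closed W o by simp
  then have 1: "triangle T W U U (ZeroArr T W U) (Ident T U) (ZeroArr T U (ShO T W))"
    using triangle_rotate[OF z Ident_closed[OF o(4)] z'] TR1_Ident[OF o(4) Z0] W(2) by simp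
  have "u \<cdot> f = ZeroArr T W U \<cdot> ZeroArr T X W"
    using u(2) Comp_Zero[OF z o(1)] by simp
  from TR3[OF tri 1 ZeroArr_closed[OF o(1) W(1)] u(1) this]
  show ?thesis using Ident_Comp[OF u(1)] by metis
qed

text \<open>\<open>E\<close> is an unshifted cone of the composite of \<open>c\<close> with the
  connecting map, and \<open>y\<close> an unshifted filler from \<open>TR3\<close>, applied to that
  cone and the doubly rotated given triangle.\<close>

lemma exact_base_change:
  assumes "exact P X C p g k" and c: "c \<in> Hom T Q C"
  shows "\<exists>E i \<pi> y. exact P E Q i \<pi> (k \<cdot> c) \<and> y \<in> Hom T E X \<and> y \<cdot> i = p \<and> g \<cdot> y = c \<cdot> \<pi>"
proof -
  obtain s k' where tri: "triangle T P X C p g k'" and k': "k' = signed s k" and t: "p \<in> Hom T P X"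
    "g \<in> Hom T X C" "k \<in> Hom T C (ShO T P)" "k' \<in> Hom T C (ShO T P)" using assms(1) by (elim exactE)
  have o: "P \<in> Obj T" "X \<in> Obj T" "C \<in> Obj T" "Q \<in> Obj T" using t c Hom_Obj by blast+
  note Sp = neg_closed[OF ShA_Hom[OF t(1)]] and Sg = neg_closed[OF ShA_Hom[OF t(2)]]
  have tri2: "triangle T C (ShO T P) (ShO T X) k' (neg (ShA T p)) (neg (ShA T g))"
    using tri triangle_rotate[OF t(1,2,4)] triangle_rotate[OF t(2,4) Sp] by blast
  define \<delta> where "\<delta> = k' \<cdot> c"
  have \<delta>: "\<delta> \<in> Hom T Q (ShO T P)" using Comp_closed[OF c t(4)] by (simp add: \<delta>_def)
  obtain G \<alpha> \<beta> where cone: "triangle T Q (ShO T P) G \<delta> \<alpha> \<beta>" using TR1_cone[OF \<delta>] by blast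
  obtain E where E: "E \<in> Obj T" "G = ShO T E" using sh.ShO_surj triangleD[OF cone] Hom_Obj by metis
  obtain i0 where i0: "i0 \<in> Hom T P E" "\<alpha> = ShA T i0" using sh.ShA_surj[of \<alpha> P E] triangleD[OF cone] E o by metis
  obtain \<pi>0 where \<pi>0: "\<pi>0 \<in> Hom T E Q" "\<beta> = ShA T \<pi>0" using sh.ShA_surj[of \<beta> E Q] triangleD[OF cone] E o by metis
  have "Ident T (ShO T P) \<cdot> \<delta> = k' \<cdot> c" using Ident_Comp[OF \<delta>] by (simp add: \<delta>_def)
  from TR3[OF cone tri2 c Ident_closed[OF sh.ShO_closed[OF o(1)]] this]
  obtain y' where y': "y' \<in> Hom T (ShO T E) (ShO T X)" "y' \<cdot> ShA T i0 = neg (ShA T p)"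
    "ShA T c \<cdot> ShA T \<pi>0 = neg (ShA T g) \<cdot> y'"
    using Comp_Ident[OF Sp] E(2) i0(2) \<pi>0(2) by auto
  obtain y where y: "y \<in> Hom T E X" "y' = ShA T y" using sh.ShA_surj[OF y'(1) E(1) o(2)] by blast
  \<comment> \<open>Two rotations negate the first two arrows of a triangle; these signs
    compensate.\<close>
  define i where "i = neg i0"
  define \<pi> where "\<pi> = neg \<pi>0"
  have i: "i \<in> Hom T P E" and \<pi>: "\<pi> \<in> Hom T E Q" using neg_closed i0 \<pi>0 by (auto simp: i_def \<pi>_def)
  have "ShA T (y \<cdot> i) = ShA T p"
    using y y'(2) ShA_Comp[OF i y(1)] ShA_neg[OF i0(1)] Comp_neg[OF ShA_Hom[OF i0(1)] y'(1)]
      neg_neg[OF ShA_Hom[OF t(1)]] by (simp add: i_def)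
  then have yi: "y \<cdot> i = p" using sh.ShA_inj[OF _ Comp_closed[OF i y(1)] t(1)] by blast
  have "ShA T (c \<cdot> \<pi>) = neg (ShA T c \<cdot> ShA T \<pi>0)"
    using ShA_Comp[OF \<pi> c] ShA_neg[OF \<pi>0(1)] Comp_neg[OF ShA_Hom[OF \<pi>0(1)] ShA_Hom[OF c]] by (simp add: \<pi>_def)
  also have "\<dots> = ShA T (g \<cdot> y)"
    using y'(3) neg_Comp[OF y'(1) ShA_Hom[OF t(2)]] neg_neg[OF Comp_closed[OF y'(1) ShA_Hom[OF t(2)]]]
      ShA_Comp[OF y(1) t(2)] y(2) by simp
  finally have gy: "g \<cdot> y = c \<cdot> \<pi>"
    using sh.ShA_inj[OF _ Comp_closed[OF y(1) t(2)] Comp_closed[OF \<pi> c]] by simp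
  have Si: "neg (ShA T i) = ShA T i0" and S\<pi>: "neg (ShA T \<pi>) = ShA T \<pi>0"
    using ShA_neg i \<pi> neg_neg i0(1) \<pi>0(1) by (metis i_def, metis \<pi>_def)
  have "triangle T P E Q i \<pi> \<delta>"
    using cone triangle_rotate[OF i \<pi> \<delta>] triangle_rotate[OF \<pi> \<delta> neg_closed[OF ShA_Hom[OF i]]]
    unfolding Si S\<pi> i0(2)[symmetric] \<pi>0(2)[symmetric] E(2)[symmetric] by blast
  moreover have "\<delta> = signed s (k \<cdot> c)" using signed_Comp[OF c t(3)] by (simp add: \<delta>_def k')
  ultimately have "exact P E Q i \<pi> (k \<cdot> c)"
    using Comp_closed[OF c t(3)] unfolding exact_def by blast
  then show ?thesis using y(1) yi gy by blast
qed

text \<open>The filler from \<open>TR3\<close> with the identity on \<open>A\<close>; the sign of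
  \<open>h\<close> is carried over to the new third arrow.\<close>

lemma exact_cobase_change:
  assumes "exact A C X f g h" and c: "c \<in> Hom T C Q"
  shows "\<exists>E \<pi> i y. exact A Q E (c \<cdot> f) \<pi> i \<and> y \<in> Hom T X E \<and> y \<cdot> g = \<pi> \<cdot> c \<and> i \<cdot> y = h"
proof -
  obtain s h' where tri: "triangle T A C X f g h'" and h': "h = signed s h'" and t: "f \<in> Hom T A C"
    "g \<in> Hom T C X" "h \<in> Hom T X (ShO T A)" "h' \<in> Hom T X (ShO T A)" using assms(1) by (elim exactE)
  have A: "A \<in> Obj T" using t Hom_Obj by blast
  note cf = Comp_closed[OF t(1) c]
  obtain E \<pi> i0 where cone: "triangle T A Q E (c \<cdot> f) \<pi> i0" using TR1_cone[OF cf] by blast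
  note tc = triangleD[OF cone]
  have "c \<cdot> f = (c \<cdot> f) \<cdot> Ident T A" using Comp_Ident[OF cf] by simp
  from TR3[OF tri cone Ident_closed[OF A] c this]
  obtain y where y: "y \<in> Hom T X E" "y \<cdot> g = \<pi> \<cdot> c" "ShA T (Ident T A) \<cdot> h' = i0 \<cdot> y" by blast
  have "h' = i0 \<cdot> y" using y(3) ShA_Ident[OF A] Ident_Comp[OF t(4)] by simp
  then have "signed s i0 \<cdot> y = h" using signed_Comp[OF y(1) tc(3)] h' by simp
  moreover have "exact A Q E (c \<cdot> f) \<pi> (signed s i0)"
    unfolding exact_def using cone signed_signed[OF tc(3)] signed_closed[OF tc(3)] by metis
  ultimately show ?thesis using y(1,2) by blast
qed

lemma pretriangulated_exact: "pretriangulated T exact"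
proof (intro pretriangulated.intro pretriangulated_axioms.intro sh.shift_category_axioms)
  fix X Y Z f g h U u
  show "f \<in> Hom T X Y \<and> g \<in> Hom T Y Z \<and> h \<in> Hom T Z (ShO T X)" if "exact X Y Z f g h"
    using that by (elim exactE) blast
  show "g \<cdot> f = ZeroArr T X Z" if "exact X Y Z f g h"
    using that by (elim exactE) (rule triangle_comp)
  show "\<exists>Z g h. exact X Y Z f g h" if "f \<in> Hom T X Y"
    using TR1_cone[OF that] exactI by blast
  show "\<exists>v\<in>Hom T U X. u = f \<cdot> v" if "exact X Y Z f g h" "u \<in> Hom T U Y" "g \<cdot> u = ZeroArr T U Z"
    using that(1) by (elim exactE) (rule triangle_lift[OF _ that(2,3)])
  show "\<exists>v\<in>Hom T Z U. u = v \<cdot> g" if "exact X Y Z f g h" "u \<in> Hom T Y U" "u \<cdot> f = ZeroArr T X U"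
    using that(1) by (elim exactE) (rule triangle_extend[OF _ that(2,3)])
qed (fact exact_rotate exact_unrotate exact_base_change exact_cobase_change)+

end

text \<open>
  The triangles of the opposite category are given separately, by \<open>opposite_D\<close> below; hence the dummy field \<^const>\<open>Tri\<close>.
\<close>

definition opposite :: "('o, 'm, 'z) tricat_scheme \<Rightarrow> ('o, 'm) tricat" where
  "opposite T = \<lparr>Obj = Obj T, Arr = Arr T, Src = Tgt T, Tgt = Src T, Ident = Ident T,
    Comp = (\<lambda>g f. f \<cdot>\<^bsub>T\<^esub> g), ZeroArr = (\<lambda>X Y. ZeroArr T Y X), AddArr = AddArr T,
    ShO = inv_into (Obj T) (ShO T), ShA = inv_into (Arr T) (ShA T), Tri = {}\<rparr>"

lemma opposite_simps [simp]:
  "Obj (opposite T) = Obj T" "Arr (opposite T) = Arr T" "Src (opposite T) = Tgt T" "Tgt (opposite T) = Src T"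
  "Ident (opposite T) = Ident T" "g \<cdot>\<^bsub>opposite T\<^esub> f = f \<cdot>\<^bsub>T\<^esub> g"
  "ZeroArr (opposite T) X Y = ZeroArr T Y X" "AddArr (opposite T) = AddArr T"
  "ShO (opposite T) = inv_into (Obj T) (ShO T)" "ShA (opposite T) = inv_into (Arr T) (ShA T)"
  by (simp_all add: opposite_def)

lemma Hom_opposite [simp]: "Hom (opposite T) X Y = Hom T Y X"
  by (auto simp: Hom_def)

lemma zero_object_opposite: "zero_object (opposite T) Z \<longleftrightarrow> zero_object T Z"
  by (auto simp: zero_object_def)

lemma is_biproduct_opposite: "is_biproduct (opposite T) P X Y i j p q \<longleftrightarrow> is_biproduct T P X Y p q i j"
  by (auto simp: is_biproduct_def)

lemma (in additive_category) additive_category_opposite: "additive_category (opposite T)"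
proof (rule additive_category.intro)
  fix X Y assume o: "X \<in> Obj (opposite T)" "Y \<in> Obj (opposite T)"
  then have o': "Y \<in> Obj T" "X \<in> Obj T" by simp_all
  interpret A: abelian_group "hom_group T Y X" using hom_abelian_group[OF o'] .
  have neg: "\<exists>g\<in>Hom T Y X. AddArr T g f = ZeroArr T Y X" if "f \<in> Hom T Y X" for f
    using that A.l_neg A.a_inv_closed by auto
  show "abelian_group (hom_group (opposite T) X Y)"
    by (rule abelian_groupI)
      (use A.a_closed A.zero_closed A.a_assoc A.a_comm A.l_zero neg in \<open>auto simp: hom_group_def\<close>)
  show "\<exists>P i j p q. is_biproduct (opposite T) P X Y i j p q"
    using ex_biproduct[OF o'(2,1)] unfolding is_biproduct_opposite by blast
next
  show "\<exists>Z. zero_object (opposite T) Z" using ex_zero_object unfolding zero_object_opposite .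
qed (auto intro: Src_closed Tgt_closed Ident_closed Comp_closed Comp_Ident Ident_Comp Comp_assoc[symmetric]
    Comp_add_left Comp_add_right)

section \<open>The inverse shift\<close>

context shift_category
begin

definition unO :: "'o \<Rightarrow> 'o" where "unO = inv_into (Obj T) (ShO T)"
definition unA :: "'m \<Rightarrow> 'm" where "unA = inv_into (Arr T) (ShA T)"

lemma unO_closed: "X \<in> Obj T \<Longrightarrow> unO X \<in> Obj T"
  using ShO_surj inv_into_into[of X "ShO T" "Obj T"] by (auto simp: unO_def)

lemma ShO_unO: "X \<in> Obj T \<Longrightarrow> ShO T (unO X) = X"
  using ShO_surj f_inv_into_f[of X "ShO T" "Obj T"] by (auto simp: unO_def)

lemma unO_ShO: "X \<in> Obj T \<Longrightarrow> unO (ShO T X) = X"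
  using ShO_bij by (simp add: unO_def bij_betw_def)

text \<open>The shift of an arrow determines its source and target, so injectivity on each hom-set
  gives injectivity on \<open>Arr T\<close>, over which the inverse is formed.\<close>

lemma ShA_inj_Arr: "inj_on (ShA T) (Arr T)"
proof (rule inj_onI)
  fix f g assume a: "f \<in> Arr T" "g \<in> Arr T" "ShA T f = ShA T g"
  have "ShO T (Src T f) = ShO T (Src T g)" "ShO T (Tgt T f) = ShO T (Tgt T g)"
    using Arr_ShA a by metis+
  then have "Src T f = Src T g" "Tgt T f = Tgt T g" using unO_ShO Src_closed Tgt_closed a by metis+
  then show "f = g" using ShA_inj[OF a(3)] a(1,2) by (simp add: Hom_iff)
qed

lemma unA_ShA: "f \<in> Hom T X Y \<Longrightarrow> unA (ShA T f) = f"
  using ShA_inj_Arr by (simp add: unA_def Hom_iff)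

lemma unA:
  assumes "f \<in> Hom T X Y"
  shows "unA f \<in> Hom T (unO X) (unO Y)" "ShA T (unA f) = f"
proof -
  note o = Hom_Obj[OF assms]
  obtain g where g: "g \<in> Hom T (unO X) (unO Y)" "f = ShA T g"
    using ShA_surj[of f "unO X" "unO Y"] assms o unO_closed ShO_unO by auto
  then show "unA f \<in> Hom T (unO X) (unO Y)" "ShA T (unA f) = f" using unA_ShA by auto
qed

lemma shift_category_opposite: "shift_category (opposite T)"
proof (intro shift_category.intro shift_category_axioms.intro additive_category_opposite)
  show "bij_betw (ShO (opposite T)) (Obj (opposite T)) (Obj (opposite T))"
    using ShO_bij bij_betw_inv_into by simp
next
  fix X Y assume o: "X \<in> Obj (opposite T)" "Y \<in> Obj (opposite T)"
  show "bij_betw (ShA (opposite T)) (Hom (opposite T) X Y)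
    (Hom (opposite T) (ShO (opposite T) X) (ShO (opposite T) Y))"
    unfolding opposite_simps Hom_opposite unO_def[symmetric] unA_def[symmetric]
  proof (rule bij_betw_byWitness[where f' = "ShA T"])
    show "ShA T ` Hom T (unO Y) (unO X) \<subseteq> Hom T Y X"
      using ShA_closed[of _ "unO Y" "unO X"] o by (auto simp: ShO_unO)
  qed (use unA unA_ShA in auto)
next
  fix f g X Y Z assume a: "f \<in> Hom (opposite T) X Y" "g \<in> Hom (opposite T) Y Z"
  then have f: "f \<in> Hom T Y X" and g: "g \<in> Hom T Z Y" by simp_all
  have "unA (f \<cdot> g) = unA f \<cdot> unA g"
    using unA_ShA[OF Comp_closed[OF unA(1)[OF g] unA(1)[OF f]]]
      ShA_Comp[OF unA(1)[OF g] unA(1)[OF f]] unA(2)[OF f] unA(2)[OF g] by simp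
  then show "ShA (opposite T) (g \<cdot>\<^bsub>opposite T\<^esub> f) = ShA (opposite T) g \<cdot>\<^bsub>opposite T\<^esub> ShA (opposite T) f"
    by (simp add: unA_def)
next
  fix f g X Y assume a: "f \<in> Hom (opposite T) X Y" "g \<in> Hom (opposite T) X Y"
  then have f: "f \<in> Hom T Y X" and g: "g \<in> Hom T Y X" by simp_all
  have "unA (AddArr T f g) = AddArr T (unA f) (unA g)"
    using unA_ShA[OF AddArr_closed[OF unA(1)[OF f] unA(1)[OF g]]]
      ShA_add[OF unA(1)[OF f] unA(1)[OF g]] unA(2)[OF f] unA(2)[OF g] by simp
  then show "ShA (opposite T) (AddArr (opposite T) f g) = AddArr (opposite T) (ShA (opposite T) f) (ShA (opposite T) g)"
    by (simp add: unA_def)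
qed

lemma unOn_closed: "X \<in> Obj T \<Longrightarrow> (unO ^^ n) X \<in> Obj T"
  by (induction n) (auto intro: unO_closed)

lemma no_maps_unO_left: "\<lbrakk>X \<in> Obj T; Y \<in> Obj T\<rbrakk> \<Longrightarrow> no_maps (unO X) Y \<longleftrightarrow> no_maps X (ShO T Y)"
  using no_maps_ShO[OF unO_closed, of X Y] by (simp add: ShO_unO)

lemma no_maps_unOn_left: "\<lbrakk>X \<in> Obj T; Y \<in> Obj T\<rbrakk> \<Longrightarrow> no_maps ((unO ^^ n) X) Y \<longleftrightarrow> no_maps X ((ShO T ^^ n) Y)"
proof (induction n arbitrary: Y)
  case (Suc n)
  then show ?case using no_maps_unO_left[OF unOn_closed, of X Y n] ShO_closed by (simp add: funpow_swap1)
qed auto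

lemma shift_nonneg: "shift T (int n) X = (ShO T ^^ n) X"
  by (simp add: shift_def)

lemma shift_neg: "shift T (- int n) X = (unO ^^ n) X"
  by (cases "n = 0") (simp_all add: shift_def unO_def)

lemma pos_shifts_eq: "pos_shifts T M = range (\<lambda>n. (ShO T ^^ Suc n) M)"
proof (intro equalityI subsetI)
  fix X assume "X \<in> pos_shifts T M"
  then obtain i where i: "X = shift T i M" "i > 0" by (auto simp: pos_shifts_def)
  define n where "n = nat i - 1"
  have "i = int (Suc n)" using i(2) by (simp add: n_def)
  then show "X \<in> range (\<lambda>n. (ShO T ^^ Suc n) M)" using i(1) shift_nonneg by blast
next
  fix X assume "X \<in> range (\<lambda>n. (ShO T ^^ Suc n) M)"
  then obtain n where "X = (ShO T ^^ Suc n) M" by blast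
  then have "X = shift T (int (Suc n)) M" by (simp only: shift_nonneg)
  moreover have "int (Suc n) > 0" by simp
  ultimately show "X \<in> pos_shifts T M" unfolding pos_shifts_def by blast
qed

lemma neg_shifts_eq: "neg_shifts T M = range (\<lambda>n. (unO ^^ Suc n) M)"
proof (intro equalityI subsetI)
  fix X assume "X \<in> neg_shifts T M"
  then obtain i where i: "X = shift T i M" "i < 0" by (auto simp: neg_shifts_def)
  define n where "n = nat (- i) - 1"
  have "i = - int (Suc n)" using i(2) by (simp add: n_def)
  then show "X \<in> range (\<lambda>n. (unO ^^ Suc n) M)" using i(1) shift_neg by blast
next
  fix X assume "X \<in> range (\<lambda>n. (unO ^^ Suc n) M)"
  then obtain n where "X = (unO ^^ Suc n) M" by blast
  then have "X = shift T (- int (Suc n)) M" by (simp only: shift_neg)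
  moreover have "- int (Suc n) < 0" by simp
  ultimately show "X \<in> neg_shifts T M" unfolding neg_shifts_def by blast
qed

lemma left_perp_eq: "S \<subseteq> Obj T \<Longrightarrow> left_perp T S = {X \<in> Obj T. \<forall>Y\<in>S. no_maps X Y}"
  using no_maps_iff by (auto simp: left_perp_def)

lemma right_perp_eq: "S \<subseteq> Obj T \<Longrightarrow> right_perp T S = {X \<in> Obj T. \<forall>Y\<in>S. no_maps Y X}"
  using no_maps_iff by (auto simp: right_perp_def)

lemma shift_minus_one: "shift T (- 1) = unO"
  using shift_neg[of 1] by auto

end

lemma (in additive_category) no_maps_opposite:
  "additive_category.no_maps (opposite T) X Y \<longleftrightarrow> no_maps Y X"
  unfolding additive_category.no_maps_def[OF additive_category_opposite] no_maps_def by simp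

section \<open>Duality of the pretriangulated axioms\<close>

context pretriangulated
begin

text \<open>Read in \<open>T\<close>, an opposite triangle runs backwards and starts at the inverse
  shift of \<open>X\<close>. Membership of \<open>X\<close> is demanded because
  \<open>inv_into\<close> is arbitrary outside \<open>Obj T\<close>.\<close>

definition opposite_D :: "'o \<Rightarrow> 'o \<Rightarrow> 'o \<Rightarrow> 'm \<Rightarrow> 'm \<Rightarrow> 'm \<Rightarrow> bool" where
  "opposite_D X Y Z f g h \<longleftrightarrow> X \<in> Obj T \<and> D (unO X) Z Y h g f"

lemma opposite_D_rot: "opposite_D X Y Z f g h \<Longrightarrow> D Z Y X g f (ShA T h)"
  unfolding opposite_D_def using D_rot[of "unO X" Z Y h g f] ShO_unO by simp

text \<open>Lifting is exchanged with extending and \<open>base_change\<close> with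
  \<open>cobase_change\<close>; cones come from \<open>D_extension\<close>.\<close>

lemma pretriangulated_opposite: "pretriangulated (opposite T) opposite_D"
proof (intro pretriangulated.intro pretriangulated_axioms.intro shift_category_opposite,
    unfold opposite_simps Hom_opposite unO_def[symmetric] unA_def[symmetric])
  fix X Y Z f g h assume d: "opposite_D X Y Z f g h"
  then show "f \<in> Hom T Y X \<and> g \<in> Hom T Z Y \<and> h \<in> Hom T (unO X) Z"
    using D_Hom[of "unO X" Z Y h g f] ShO_unO unfolding opposite_D_def by simp
  show "f \<cdot> g = ZeroArr T Z X" using D_comp[OF opposite_D_rot[OF d]] .
  have f: "f \<in> Hom T Y X" using D_Hom[OF opposite_D_rot[OF d]] by blast
  have "D (unO Y) (unO X) Z (unA f) h g"
    using d unA[OF f] D_unrot[of "unO X" Z "unO Y" h g "unA f"] ShO_unO Hom_Obj[OF f]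
    unfolding opposite_D_def by simp
  then show "opposite_D Y Z (unO X) g h (unA f)" unfolding opposite_D_def using Hom_Obj[OF f] by simp
  fix U u
  show "\<exists>v\<in>Hom T X U. u = v \<cdot> f" if "u \<in> Hom T Y U" "u \<cdot> g = ZeroArr T Z U"
    using D_extend[OF opposite_D_rot[OF d] that] .
  show "\<exists>v\<in>Hom T U Z. u = g \<cdot> v" if "u \<in> Hom T U Y" "f \<cdot> u = ZeroArr T U X"
    using D_lift[OF opposite_D_rot[OF d] that] .
next
  fix f X Y assume f: "f \<in> Hom T Y X"
  note o = Hom_Obj[OF f]
  have "\<exists>Z h g. D (unO X) Z Y h g f"
    by (rule D_extension) (use f o in \<open>simp_all add: ShO_unO unO_closed\<close>)
  then show "\<exists>Z g h. opposite_D X Y Z f g h" using o unfolding opposite_D_def by blast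
next
  fix X Y Z f g h assume d: "opposite_D Y Z (unO X) g h (unA f)" and f: "f \<in> Hom T Y X"
  have "D (unO X) Z Y h g (ShA T (unA f))"
    using d D_rot[of "unO Y" "unO X" Z "unA f" h g] ShO_unO unfolding opposite_D_def by simp
  then show "opposite_D X Y Z f g h" using unA(2)[OF f] Hom_Obj[OF f] unfolding opposite_D_def by simp
next
  fix P X C p g k c Q assume d: "opposite_D P X C p g k" and c: "c \<in> Hom T C Q"
  then show "\<exists>E i \<pi> y. opposite_D P E Q i \<pi> (c \<cdot> k) \<and> y \<in> Hom T X E \<and> i \<cdot> y = p \<and> y \<cdot> g = \<pi> \<cdot> c"
    using cobase_change[of "unO P" C X k g p c Q] unfolding opposite_D_def by blast
next
  fix A C X f g h c Q assume d: "opposite_D A C X f g h" and c: "c \<in> Hom T Q C"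
  then show "\<exists>E \<pi> i y. opposite_D A Q E (f \<cdot> c) \<pi> i \<and> y \<in> Hom T E X \<and> g \<cdot> y = c \<cdot> \<pi> \<and> y \<cdot> i = h"
    using base_change[of "unO A" X C h g f c Q] unfolding opposite_D_def by blast
qed

text \<open>\<open>generator\<close> quantifies over thick sets, so generation dualises once those
  of the opposite are thick in \<open>T\<close>.\<close>

lemma thick_set_opposite:
  assumes "pretriangulated.thick_set (opposite T) opposite_D S"
  shows "thick_set S"
proof -
  interpret op: pretriangulated "opposite T" opposite_D by (rule pretriangulated_opposite)
  have S: "S \<subseteq> Obj T" "op.ext_closed S" "\<And>X. X \<in> Obj T \<Longrightarrow> unO X \<in> S \<longleftrightarrow> X \<in> S"
    and ret: "\<And>X Y i p. \<lbrakk>Y \<in> S; i \<in> Hom T Y X; p \<in> Hom T X Y; i \<cdot> p = Ident T X\<rbrakk> \<Longrightarrow> X \<in> S"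
    using assms unfolding op.thick_set_def by (auto simp: unO_def)
  show ?thesis
    unfolding thick_set_def
  proof (intro conjI ballI allI impI)
    show "S \<subseteq> Obj T" by (rule S(1))
    show "ext_closed S"
      unfolding ext_closed_def
    proof (intro allI impI)
      fix X Y Z f g h assume d: "D X Y Z f g h" and XZ: "X \<in> S" "Z \<in> S"
      note h = D_Hom(3)[OF d] and o = D_Obj[OF d]
      have "unA h \<in> Hom T (unO Z) X" using unA(1)[OF h] unO_ShO[OF o(1)] by simp
      then have "D (unO Z) X Y (unA h) f g"
        using D_unrot[of X Y "unO Z" f g "unA h"] d unA(2)[OF h] ShO_unO[OF o(3)] by simp
      then have "opposite_D Z Y X g f (unA h)" using o unfolding opposite_D_def by simp
      then show "Y \<in> S" using XZ S(2)[unfolded op.ext_closed_def, rule_format, of Z Y X g f "unA h"] by simp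
    qed
    show "ShO T X \<in> S \<longleftrightarrow> X \<in> S" if "X \<in> Obj T" for X
      using S(3)[OF ShO_closed[OF that]] unO_ShO[OF that] by simp
    show "X \<in> S" if "Y \<in> S" "i \<in> Hom T X Y" "p \<in> Hom T Y X" "p \<cdot> i = Ident T X" for X Y i p
      using ret[OF that(1,3,2,4)] .
  qed
qed

lemma generator_opposite: "generator N \<Longrightarrow> pretriangulated.generator (opposite T) opposite_D N"
  unfolding generator_def pretriangulated.generator_def[OF pretriangulated_opposite]
  using thick_set_opposite by simp

text \<open>Hom(N[-i], N) and Hom(N, N[i]) correspond under the shift, so the condition is its own
  dual.\<close>

lemma presilting_opposite:
  assumes "presilting N"
  shows "pretriangulated.presilting (opposite T) N"
proof -
  interpret op: pretriangulated "opposite T" opposite_D by (rule pretriangulated_opposite)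
  have "no_maps ((unO ^^ Suc n) N) N" for n
    using assms no_maps_unOn_left[of N N "Suc n"] unfolding presilting_def by blast
  then show ?thesis
    using assms unfolding op.presilting_def presilting_def no_maps_opposite
    by (simp add: unO_def del: funpow.simps)
qed

end

section \<open>Approximations by finitely generated hom-modules\<close>

lemma (in abelian_monoid) finsum_in_subset:
  assumes "finite F" "g \<in> F \<rightarrow> S" "S \<subseteq> carrier G" "\<zero> \<in> S"
    and add: "\<And>x y. \<lbrakk>x \<in> S; y \<in> S\<rbrakk> \<Longrightarrow> x \<oplus> y \<in> S"
  shows "finsum G g F \<in> S"
  using assms(1,2)
proof (induction F rule: finite_induct)
  case (insert x F)
  have gx: "g x \<in> carrier G" and gF: "g \<in> F \<rightarrow> carrier G" using insert assms(3) by auto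
  show ?case using finsum_insert[OF insert(1,2) gF gx] insert add by simp
qed (use assms in simp)

context additive_category
begin

text \<open>One copy of \<open>N\<close> is taken for each element of \<open>F\<close>, with that
  element as component.\<close>

lemma finite_sum_cover:
  assumes N: "N \<in> Obj T" and X: "X \<in> Obj T" and F: "finite F" "F \<subseteq> Hom T N X"
  shows "\<exists>P f. finite_sum N P \<and> f \<in> Hom T P X \<and> (\<forall>y\<in>F. \<exists>v\<in>Hom T N P. y = f \<cdot> v)"
  using F
proof (induction F rule: finite_induct)
  case empty
  obtain Z where Z: "zero_object T Z" using ex_zero_object by blast
  then have "Z \<in> Obj T" by (simp add: zero_object_def)
  then show ?case using finite_sum.zero[OF Z] ZeroArr_closed X by blast
next
  case (insert y F)
  obtain P f where P: "finite_sum N P" and f: "f \<in> Hom T P X"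
    and lift: "\<And>u. u \<in> F \<Longrightarrow> \<exists>v\<in>Hom T N P. u = f \<cdot> v" using insert by blast
  have y: "y \<in> Hom T N X" using insert by blast
  obtain Q i j p q where Q: "is_biproduct T Q P N i j p q" using ex_biproduct finite_sum_Obj[OF P] N by blast
  have t: "i \<in> Hom T P Q" "j \<in> Hom T N Q" "p \<in> Hom T Q P" "q \<in> Hom T Q N"
    and b: "p \<cdot> i = Ident T P" "q \<cdot> j = Ident T N" "q \<cdot> i = ZeroArr T P N" "p \<cdot> j = ZeroArr T N P"
    using Q unfolding is_biproduct_def by auto
  note fp = Comp_closed[OF t(3) f] and yq = Comp_closed[OF t(4) y]

  define f' where "f' = AddArr T (f \<cdot> p) (y \<cdot> q)"
  have f': "f' \<in> Hom T Q X" using AddArr_closed[OF fp yq] by (simp add: f'_def)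
  interpret PX: abelian_group "hom_group T P X" using hom_abelian_group Hom_Obj f by blast
  interpret NX: abelian_group "hom_group T N X" using hom_abelian_group N X by blast
  have "f' \<cdot> i = AddArr T f (ZeroArr T P X)"
    using Comp_add_left[OF t(1) fp yq] Comp_assoc[OF t(1,3) f] Comp_assoc[OF t(1,4) y] b
      Comp_Ident[OF f] Comp_Zero[OF y] finite_sum_Obj[OF P] by (simp add: f'_def)
  then have f'i: "f' \<cdot> i = f" using PX.r_zero[of f] f by simp
  have "f' \<cdot> j = AddArr T (ZeroArr T N X) y"
    using Comp_add_left[OF t(2) fp yq] Comp_assoc[OF t(2,3) f] Comp_assoc[OF t(2,4) y] b
      Comp_Ident[OF y] Comp_Zero[OF f N] by (simp add: f'_def)
  then have f'j: "f' \<cdot> j = y" using NX.l_zero[of y] y by simp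
  have "\<exists>v\<in>Hom T N Q. u = f' \<cdot> v" if u: "u \<in> insert y F" for u
  proof (cases "u = y")
    case True
    then show ?thesis using f'j t(2) by blast
  next
    case False
    then obtain v where v: "v \<in> Hom T N P" "u = f \<cdot> v" using u lift by blast
    then have "u = f' \<cdot> (i \<cdot> v)" using Comp_assoc[OF v(1) t(1) f'] f'i by simp
    then show ?thesis using Comp_closed[OF v(1) t(1)] by blast
  qed
  then show ?case using finite_sum.plus[OF P Q] f' by blast
qed

text \<open>The maps factoring through \<open>f\<close> form an additive submonoid that contains all
  multiples of the generators. \<open>G\<close> is a parameter because the two module structures are
  different records; the second is used in the opposite category.\<close>

lemma finite_sum_approximation:
  assumes N: "N \<in> Obj T" and X: "X \<in> Obj T"
    and G: "abelian_monoid G" "carrier G = Hom T N X" "add G = AddArr T" "zero G = ZeroArr T N X"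
    and F: "finite F" "F \<subseteq> Hom T N X"
    and gen: "\<And>x. x \<in> Hom T N X \<Longrightarrow> \<exists>c\<in>F \<rightarrow> Hom T N N. x = finsum G (\<lambda>y. y \<cdot> c y) F"
  shows "\<exists>P. finite_sum N P \<and> (\<exists>f\<in>Hom T P X. \<forall>u\<in>Hom T N X. \<exists>v\<in>Hom T N P. u = f \<cdot> v)"
proof -
  obtain P f where P: "finite_sum N P" and f: "f \<in> Hom T P X"
    and lift: "\<And>u. u \<in> F \<Longrightarrow> \<exists>v\<in>Hom T N P. u = f \<cdot> v"
    using finite_sum_cover[OF N X F] by blast
  note PO = finite_sum_Obj[OF P]
  let ?S = "{x. \<exists>v\<in>Hom T N P. x = f \<cdot> v}"
  have "x \<in> ?S" if x: "x \<in> Hom T N X" for x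
  proof -
    obtain c where c: "c \<in> F \<rightarrow> Hom T N N" "x = finsum G (\<lambda>y. y \<cdot> c y) F" using gen[OF x] by blast
    have "finsum G (\<lambda>y. y \<cdot> c y) F \<in> ?S"
    proof (rule abelian_monoid.finsum_in_subset[OF G(1) F(1)])
      show "(\<lambda>y. y \<cdot> c y) \<in> F \<rightarrow> ?S"
      proof
        fix y assume y: "y \<in> F"
        obtain v where v: "v \<in> Hom T N P" "y = f \<cdot> v" using lift[OF y] by blast
        have cy: "c y \<in> Hom T N N" using c(1) y by blast
        have "y \<cdot> c y = f \<cdot> (v \<cdot> c y)" using Comp_assoc[OF cy v(1) f] v(2) by simp
        then show "y \<cdot> c y \<in> ?S" using Comp_closed[OF cy v(1)] by blast
      qed
      show "?S \<subseteq> carrier G" unfolding G(2) using Comp_closed[OF _ f] by blast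
      show "\<zero>\<^bsub>G\<^esub> \<in> ?S"
        using Comp_Zero[OF f N] ZeroArr_closed[OF N PO] by (auto simp: G(4) intro!: bexI[of _ "ZeroArr T N P"])
      show "x \<oplus>\<^bsub>G\<^esub> y \<in> ?S" if xy: "x \<in> ?S" "y \<in> ?S" for x y
      proof -
        obtain v w where v: "v \<in> Hom T N P" "x = f \<cdot> v" and w: "w \<in> Hom T N P" "y = f \<cdot> w" using xy by blast
        have "x \<oplus>\<^bsub>G\<^esub> y = f \<cdot> AddArr T v w" using Comp_add_right[OF v(1) w(1) f] v(2) w(2) G(3) by simp
        then show ?thesis using AddArr_closed[OF v(1) w(1)] by blast
      qed
    qed
    then show ?thesis using c(2) by simp
  qed
  then show ?thesis using P f by blast
qed

lemma approximable_of_fg_src: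
  assumes "\<And>X Y. \<lbrakk>X \<in> Obj T; Y \<in> Obj T\<rbrakk> \<Longrightarrow> fg_right_module (End T X) (hom_module_src T X Y)"
  shows approximable
  unfolding approximable_def
proof (intro ballI)
  fix N X assume o: "N \<in> Obj T" "X \<in> Obj T"
  obtain F where F: "finite F" "F \<subseteq> Hom T N X"
    "\<And>x. x \<in> Hom T N X \<Longrightarrow> \<exists>c\<in>F \<rightarrow> Hom T N N. x = finsum (hom_module_src T N X) (\<lambda>y. y \<cdot> c y) F"
    using assms[OF o] unfolding fg_right_module_def by (auto simp: hom_module_src_def)
  have "abelian_monoid (hom_module_src T N X)"
    using right_module_hom_src[OF o] by (auto simp: right_module_def abelian_group_def)
  from finite_sum_approximation[OF o this _ _ _ F]
  show "\<exists>P. finite_sum N P \<and> (\<exists>f\<in>Hom T P X. \<forall>u\<in>Hom T N X. \<exists>v\<in>Hom T N P. u = f \<cdot> v)"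
    by (simp add: hom_module_src_def)
qed

lemma approximable_of_fg_tgt:
  assumes "\<And>X Y. \<lbrakk>X \<in> Obj T; Y \<in> Obj T\<rbrakk> \<Longrightarrow> fg_right_module (opposite_ring (End T Y)) (hom_module_tgt T X Y)"
  shows "additive_category.approximable (opposite T)"
proof -
  interpret op: additive_category "opposite T" by (rule additive_category_opposite)
  show ?thesis
    unfolding op.approximable_def
  proof (intro ballI)
    fix N X assume "N \<in> Obj (opposite T)" "X \<in> Obj (opposite T)"
    then have o: "X \<in> Obj T" "N \<in> Obj T" by simp_all
    obtain F where F: "finite F" "F \<subseteq> Hom T X N"
      "\<And>x. x \<in> Hom T X N \<Longrightarrow> \<exists>c\<in>F \<rightarrow> Hom T N N. x = finsum (hom_module_tgt T X N) (\<lambda>y. c y \<cdot> y) F"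
      using assms[OF o] unfolding fg_right_module_def by (auto simp: hom_module_tgt_def opposite_ring_def)
    have "abelian_monoid (hom_module_tgt T X N)"
      using right_module_hom_tgt[OF o] by (auto simp: right_module_def abelian_group_def)
    from op.finite_sum_approximation[OF _ _ this, of N X F] F o
    show "\<exists>P. op.finite_sum N P \<and> (\<exists>f\<in>Hom (opposite T) P X. \<forall>u\<in>Hom (opposite T) N X.
        \<exists>v\<in>Hom (opposite T) N P. u = f \<cdot>\<^bsub>opposite T\<^esub> v)"
      by (simp add: hom_module_tgt_def)
  qed
qed

end

section \<open>Adjacent t-structures\<close>

context pretriangulated
begin

lemma right_perp_neg_shifts:
  assumes "M \<in> Obj T"
  shows "right_perp T (neg_shifts T M) = sil_aisle M"
proof -
  have "right_perp T (neg_shifts T M) = {X \<in> Obj T. \<forall>n. no_maps ((unO ^^ Suc n) M) X}"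
    unfolding neg_shifts_eq
    by (subst right_perp_eq) (use unOn_closed[OF assms] in \<open>auto simp del: funpow.simps\<close>)
  then show ?thesis
    unfolding sil_aisle_def using no_maps_unOn_left[OF assms] by blast
qed

lemma ShO_sil_coaisle:
  assumes "M \<in> Obj T"
  shows "ShO T ` sil_coaisle M = {Y \<in> Obj T. \<forall>n. no_maps ((ShO T ^^ Suc n) M) Y}"
proof (intro equalityI subsetI)
  fix Y assume "Y \<in> ShO T ` sil_coaisle M"
  then show "Y \<in> {Y \<in> Obj T. \<forall>n. no_maps ((ShO T ^^ Suc n) M) Y}"
    using no_maps_ShO[OF ShOn_closed[OF assms]] ShO_closed by (auto simp: sil_coaisle_def)
next
  fix Y assume Y: "Y \<in> {Y \<in> Obj T. \<forall>n. no_maps ((ShO T ^^ Suc n) M) Y}"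
  then have YO: "Y \<in> Obj T" by blast
  have "no_maps ((ShO T ^^ n) M) (unO Y)" for n
    using Y no_maps_ShO[OF ShOn_closed[OF assms] unO_closed[OF YO], of n] ShO_unO[OF YO] by simp
  then have "unO Y \<in> sil_coaisle M" using unO_closed[OF YO] by (simp add: sil_coaisle_def)
  then show "Y \<in> ShO T ` sil_coaisle M" using ShO_unO[OF YO] by (metis imageI)
qed

lemma right_perp_pos_shifts:
  assumes "M \<in> Obj T"
  shows "right_perp T (pos_shifts T M) = ShO T ` sil_coaisle M"
  unfolding pos_shifts_eq ShO_sil_coaisle[OF assms]
  by (subst right_perp_eq) (use ShOn_closed[OF assms] in \<open>auto simp del: funpow.simps\<close>)

lemma unO_ShO_image: "S \<subseteq> Obj T \<Longrightarrow> unO ` ShO T ` S = S"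
  using unO_ShO by (force simp: image_image)

lemma coreflective_sil_aisle_iff:
  assumes "approximable" "presilting M" "generator M"
  shows "coreflective (sil_aisle M) \<longleftrightarrow>
    (\<forall>X\<in>Obj T. \<exists>A\<in>sil_aisle M. \<exists>B\<in>sil_coaisle M. \<exists>f g h. D A X B f g h)"
proof -
  have "(\<exists>B f g h. D A X B f g h \<and> (\<forall>A'\<in>sil_aisle M. no_maps A' B)) \<longleftrightarrow>
      (\<exists>B\<in>sil_coaisle M. \<exists>f g h. D A X B f g h)" for A X
    unfolding sil_coaisle_eq[OF assms] using D_Obj(3) by blast
  then show ?thesis unfolding coreflective_def by simp
qed

text \<open>Three backward rotations.\<close>

lemma D_unShO:
  assumes d: "D X Y Z f g h"
  shows "\<exists>f g h. D (unO X) (unO Y) (unO Z) f g h"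
proof -
  have step: "\<exists>h. D (unO C) A B h f g" if d: "D A B C f g k" for A B C f g k
  proof -
    note o = D_Obj[OF d] and k = D_Hom(3)[OF d]
    have "unA k \<in> Hom T (unO C) A" using unA(1)[OF k] unO_ShO[OF o(1)] by simp
    then show ?thesis using D_unrot[of A B "unO C" f g "unA k"] d unA(2)[OF k] ShO_unO[OF o(3)] by auto
  qed
  show ?thesis using step[OF d] step by meson
qed

end

context triangulated_category
begin

sublocale ex: pretriangulated T exact by (rule pretriangulated_exact)

sublocale op: pretriangulated "opposite T" ex.opposite_D by (rule ex.pretriangulated_opposite)

lemma ex_triangle_iff: "(\<exists>f g h. triangle T X Y Z f g h) \<longleftrightarrow> (\<exists>f g h. exact X Y Z f g h)"
  using exactI exactE by metis

lemma presilting_of_silting: "silting T M \<Longrightarrow> ex.presilting M"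
  unfolding silting_def ex.presilting_def no_maps_def
  using sh.shift_nonneg by (metis of_nat_0_less_iff subset_refl zero_less_Suc)

text \<open>A \<open>thick_set\<close> is a \<open>thick_subcategory\<close>; in particular a cone
  \<open>Z\<close> of X -> Y is an extension of X[1] by \<open>Y\<close>.\<close>

lemma generator_of_silting:
  assumes "silting T M"
  shows "ex.generator M"
  unfolding ex.generator_def
proof (intro allI impI)
  fix S assume S: "ex.thick_set S" and M: "M \<in> S"
  have SO: "S \<subseteq> Obj T" and ext: "ex.ext_closed S" and sh: "\<And>X. X \<in> Obj T \<Longrightarrow> ShO T X \<in> S \<longleftrightarrow> X \<in> S"
    and ret: "\<And>X Y i p. \<lbrakk>Y \<in> S; i \<in> Hom T X Y; p \<in> Hom T Y X; p \<cdot> i = Ident T X\<rbrakk> \<Longrightarrow> X \<in> S"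
    using S unfolding ex.thick_set_def by blast+
  have "thick_subcategory T S"
    unfolding thick_subcategory_def triangulated_subcategory_def
  proof (intro conjI ballI allI impI)
    show "S \<subseteq> Obj T" "S \<noteq> {}" using SO M by auto
    show "Y \<in> S" if "X \<in> S" "Y \<in> Obj T" "iso_arr T X Y f" for X Y f
      using that ret unfolding iso_arr_def by blast
    show "shift T n X \<in> S" if X: "X \<in> S" for X n
    proof -
      have "(ShO T ^^ k) X \<in> S" for k using X sh SO by (induction k) auto
      moreover have "(sh.unO ^^ k) X \<in> S" for k
      proof (induction k)
        case (Suc k)
        then show ?case using sh[OF sh.unO_closed, of "(sh.unO ^^ k) X"] sh.ShO_unO SO by auto
      qed (use X in simp)
      ultimately show ?thesis
        using sh.shift_nonneg sh.shift_neg by (metis int_cases2)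
    qed
    show "Z \<in> S" if t: "triangle T X Y Z f g h" and X: "X \<in> S" and Y: "Y \<in> S" for X Y Z f g h
    proof -
      have "exact Y Z (ShO T X) g h (ShA T f)" using ex.D_rot[OF exactI[OF t]] .
      then show ?thesis using ext X Y sh SO unfolding ex.ext_closed_def by blast
    qed
    show "X \<in> S" if "Y \<in> S" "direct_summand T X Y" for X Y
      using that ret unfolding direct_summand_def is_biproduct_def by blast
  qed
  then have "thick_closure T M \<subseteq> S" using M unfolding thick_closure_def by blast
  then show "Obj T \<subseteq> S" using assms by (simp add: silting_def)
qed

text \<open>By \<open>sil_coaisle_eq\<close> and \<open>sil_aisle_eq\<close> the two
  perpendicularity clauses follow from the truncation triangles.\<close>

lemma has_right_adjacent_iff:
  assumes ap: "approximable" and M: "ex.presilting M" "ex.generator M"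
  shows "has_right_adjacent_t_structure T M \<longleftrightarrow> ex.coreflective (ex.sil_aisle M)"
proof -
  have MO: "M \<in> Obj T" using M by (simp add: ex.presilting_def)
  let ?A = "ex.sil_aisle M" and ?B = "ex.sil_coaisle M"
  have O: "?A \<subseteq> Obj T" "?B \<subseteq> Obj T" by (auto simp: ex.sil_aisle_def ex.sil_coaisle_def)
  have B1: "shift T (- 1) ` ShO T ` ?B = ?B" using sh.shift_minus_one ex.unO_ShO_image[OF O(2)] by simp
  have BO: "ShO T ` ?B \<subseteq> Obj T" using O(2) sh.ShO_closed by blast
  have sub: "?B \<subseteq> ShO T ` ?B" unfolding ex.ShO_sil_coaisle[OF MO] by (auto simp: ex.sil_coaisle_def simp del: funpow.simps)
  have "has_right_adjacent_t_structure T M \<longleftrightarrow>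
      ?A = left_perp T ?B \<and> ?B = right_perp T ?A \<and>
      (\<forall>X\<in>Obj T. \<exists>X'\<in>?A. \<exists>X''\<in>?B. \<exists>f g h. exact X' X X'' f g h)"
    unfolding has_right_adjacent_t_structure_def t_structure_def ex.right_perp_neg_shifts[OF MO]
      ex.right_perp_pos_shifts[OF MO] B1 Let_def ex_triangle_iff using O BO sub by simp
  also have "\<dots> \<longleftrightarrow> ex.coreflective ?A"
    unfolding sh.left_perp_eq[OF O(2)] sh.right_perp_eq[OF O(1)]
    using ex.coreflective_sil_aisle_iff[OF ap M] ex.sil_coaisle_eq[OF ap M] ex.sil_aisle_eq[OF ap M] by blast
  finally show ?thesis .
qed

text \<open>Reversing arrows exchanges the halves of the t-structure, and the pair in
  \<open>T\<close> differs from the opposite one by an inverse shift.\<close>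

lemma has_left_adjacent_iff:
  assumes ap: "op.approximable" and M: "op.presilting M" "op.generator M"
  shows "has_left_adjacent_t_structure T M \<longleftrightarrow> op.coreflective (op.sil_aisle M)"
proof -
  have MO': "M \<in> Obj (opposite T)" using M by (simp add: op.presilting_def)
  then have MO: "M \<in> Obj T" by simp
  let ?A = "op.sil_aisle M" and ?B = "op.sil_coaisle M"
  have O: "?A \<subseteq> Obj T" "?B \<subseteq> Obj T" by (auto simp: op.sil_aisle_def op.sil_coaisle_def)
  have ShO: "ShO (opposite T) = sh.unO" by (simp add: sh.unO_def)
  have U: "sh.unO ` ?A \<subseteq> Obj T" "sh.unO ` ?B \<subseteq> Obj T" using O sh.unO_closed by blast+
  have unO_perp: "no_maps (sh.unO X) (sh.unO Y) \<longleftrightarrow> no_maps X Y" if "X \<in> Obj T" "Y \<in> Obj T" for X Y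
    using sh.no_maps_unO_left[OF that(1) sh.unO_closed[OF that(2)]] sh.ShO_unO[OF that(2)] by simp
  \<comment> \<open>\<open>neg_shifts\<close> starts at M[-1] but \<open>op.sil_coaisle\<close> is
    tested from \<open>M\<close> on, whence the extra inverse shift.\<close>
  have neg: "left_perp T (neg_shifts T M) = sh.unO ` ?B"
    using op.ShO_sil_coaisle[OF MO']
    unfolding ShO no_maps_opposite sh.neg_shifts_eq
    by (subst sh.left_perp_eq) (use sh.unOn_closed[OF MO] in \<open>auto simp del: funpow.simps\<close>)
  have pos: "left_perp T (pos_shifts T M) = ?A"
    unfolding op.sil_aisle_def ShO no_maps_opposite sh.pos_shifts_eq
    by (subst sh.left_perp_eq)
      (use sh.ShOn_closed[OF MO] sh.no_maps_unOn_left[OF _ MO] in \<open>auto simp del: funpow.simps\<close>)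
  have sub: "sh.unO ` ?A \<subseteq> ?A" using op.sil_aisle_ShO unfolding ShO by blast
  have left: "left_perp T (sh.unO ` ?A) = sh.unO ` {X \<in> Obj T. \<forall>Y\<in>?A. no_maps X Y}"
    unfolding sh.left_perp_eq[OF U(1)]
  proof (intro equalityI subsetI)
    fix X assume X: "X \<in> {X \<in> Obj T. \<forall>Y\<in>sh.unO ` ?A. no_maps X Y}"
    then have XO: "X \<in> Obj T" by blast
    have "no_maps (ShO T X) Y" if Y: "Y \<in> ?A" for Y
      using X Y unO_perp[OF sh.ShO_closed[OF XO], of Y] sh.unO_ShO[OF XO] O(1) by auto
    then have "ShO T X \<in> {X \<in> Obj T. \<forall>Y\<in>?A. no_maps X Y}" using sh.ShO_closed[OF XO] by blast
    then have "sh.unO (ShO T X) \<in> sh.unO ` {X \<in> Obj T. \<forall>Y\<in>?A. no_maps X Y}" by (rule imageI)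
    then show "X \<in> sh.unO ` {X \<in> Obj T. \<forall>Y\<in>?A. no_maps X Y}" unfolding sh.unO_ShO[OF XO] .
  qed (use unO_perp sh.unO_closed O(1) in auto)
  have right: "right_perp T (sh.unO ` ?B) = sh.unO ` {Y \<in> Obj T. \<forall>X\<in>?B. no_maps X Y}"
    unfolding sh.right_perp_eq[OF U(2)]
  proof (intro equalityI subsetI)
    fix Y assume Y: "Y \<in> {Y \<in> Obj T. \<forall>X\<in>sh.unO ` ?B. no_maps X Y}"
    then have YO: "Y \<in> Obj T" by blast
    have "no_maps X (ShO T Y)" if X: "X \<in> ?B" for X
      using Y X unO_perp[OF _ sh.ShO_closed[OF YO], of X] sh.unO_ShO[OF YO] O(2) by auto
    then have "ShO T Y \<in> {Y \<in> Obj T. \<forall>X\<in>?B. no_maps X Y}" using sh.ShO_closed[OF YO] by blast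
    then have "sh.unO (ShO T Y) \<in> sh.unO ` {Y \<in> Obj T. \<forall>X\<in>?B. no_maps X Y}" by (rule imageI)
    then show "Y \<in> sh.unO ` {Y \<in> Obj T. \<forall>X\<in>?B. no_maps X Y}" unfolding sh.unO_ShO[OF YO] .
  qed (use unO_perp sh.unO_closed O(2) in auto)
  \<comment> \<open>A triangle B[-1] -> X[-1] -> A[-1] of \<open>T\<close> shifts to B -> X -> A,
    whose reversal is the opposite triangle A -> X -> B.\<close>
  have tri: "(\<forall>X\<in>Obj T. \<exists>X'\<in>sh.unO ` ?B. \<exists>X''\<in>sh.unO ` ?A. \<exists>f g h. exact X' X X'' f g h) \<longleftrightarrow>
      (\<forall>X\<in>Obj T. \<exists>A\<in>?A. \<exists>B\<in>?B. \<exists>f g h. ex.opposite_D A X B f g h)" (is "?L \<longleftrightarrow> ?R")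
  proof
    assume L: ?L
    show ?R
    proof
      fix X assume X: "X \<in> Obj T"
      obtain A B f g h where A: "A \<in> ?A" "B \<in> ?B" and t: "exact (sh.unO B) (sh.unO X) (sh.unO A) f g h"
        using L sh.unO_closed[OF X] by blast
      have o: "A \<in> Obj T" "B \<in> Obj T" using A O by blast+
      obtain f g h where t': "exact B X A f g h"
        using ex.D_ShO[OF t] sh.ShO_unO X o by auto
      note h = ex.D_Hom(3)[OF t']
      have "sh.unA h \<in> Hom T (sh.unO A) B" using sh.unA(1)[OF h] sh.unO_ShO[OF o(2)] by simp
      then have "exact (sh.unO A) B X (sh.unA h) f g"
        using ex.D_unrot[of B X "sh.unO A" f g "sh.unA h"] t' sh.unA(2)[OF h] sh.ShO_unO[OF o(1)] by simp
      then show "\<exists>A\<in>?A. \<exists>B\<in>?B. \<exists>f g h. ex.opposite_D A X B f g h"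
        using A o unfolding ex.opposite_D_def by blast
    qed
  next
    assume R: ?R
    show ?L
    proof
      fix X assume X: "X \<in> Obj T"
      obtain A B f g h where A: "A \<in> ?A" "B \<in> ?B" and t: "ex.opposite_D A (ShO T X) B f g h"
        using R sh.ShO_closed[OF X] by blast
      have "\<exists>f g h. exact (sh.unO B) X (sh.unO A) f g h"
        using ex.D_unShO[OF ex.opposite_D_rot[OF t]] sh.unO_ShO[OF X] by simp
      then show "\<exists>X'\<in>sh.unO ` ?B. \<exists>X''\<in>sh.unO ` ?A. \<exists>f g h. exact X' X X'' f g h" using A by blast
    qed
  qed
  have "has_left_adjacent_t_structure T M \<longleftrightarrow>
      sh.unO ` ?B = left_perp T (sh.unO ` ?A) \<and> sh.unO ` ?A = right_perp T (sh.unO ` ?B) \<and> ?R"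
    unfolding has_left_adjacent_t_structure_def t_structure_def neg pos sh.shift_minus_one
      Let_def ex_triangle_iff tri[symmetric] using O U sub by simp
  moreover have "?R \<longleftrightarrow> op.coreflective ?A"
    using op.coreflective_sil_aisle_iff[OF ap M] by simp
  moreover have "sh.unO ` ?B = left_perp T (sh.unO ` ?A)"
    using op.sil_coaisle_eq[OF ap M] unfolding left no_maps_opposite by simp
  moreover have "sh.unO ` ?A = right_perp T (sh.unO ` ?B)" if "op.coreflective ?A"
    using op.sil_aisle_eq[OF ap M that] unfolding right no_maps_opposite by simp
  ultimately show ?thesis by blast
qed

end

theorem theorem4p4:
  fixes T :: "('o, 'm, 'z) tricat_scheme" and M N :: 'o
  assumes "triangulated_category T"
    and "\<And>X Y. X \<in> Obj T \<Longrightarrow> Y \<in> Obj T \<Longrightarrow>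
      fg_right_module (End T X) (hom_module_src T X Y)"
    and "\<And>X Y. X \<in> Obj T \<Longrightarrow> Y \<in> Obj T \<Longrightarrow>
      fg_right_module (opposite_ring (End T Y)) (hom_module_tgt T X Y)"
    and "silting T M" and "silting T N"
  shows "(has_right_adjacent_t_structure T M \<longleftrightarrow> has_right_adjacent_t_structure T N) \<and>
    (has_left_adjacent_t_structure T M \<longleftrightarrow> has_left_adjacent_t_structure T N)"
proof -
  interpret triangulated_category T by (rule assms(1))
  note ap = approximable_of_fg_src[OF assms(2)] and ap' = approximable_of_fg_tgt[OF assms(3)]
  note pM = presilting_of_silting[OF assms(4)] and gM = generator_of_silting[OF assms(4)]
  note pN = presilting_of_silting[OF assms(5)] and gN = generator_of_silting[OF assms(5)]
  note pM' = ex.presilting_opposite[OF pM] and gM' = ex.generator_opposite[OF gM]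
  note pN' = ex.presilting_opposite[OF pN] and gN' = ex.generator_opposite[OF gN]
  show ?thesis
    using has_right_adjacent_iff[OF ap pM gM] has_right_adjacent_iff[OF ap pN gN]
      ex.coreflective_sil_aisle_transfer[OF ap pM gM pN gN]
      ex.coreflective_sil_aisle_transfer[OF ap pN gN pM gM]
      has_left_adjacent_iff[OF ap' pM' gM'] has_left_adjacent_iff[OF ap' pN' gN']
      op.coreflective_sil_aisle_transfer[OF ap' pM' gM' pN' gN']
      op.coreflective_sil_aisle_transfer[OF ap' pN' gN' pM' gM'] by blast
qed

end
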